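(* Let $m,n\in\mathbb{Z}$ and $\sigma,\sigma'\in(0,\infty)$. Then \[ \int_0^\pi Q_{m-1/2}(\chi)\cos(n\psi)\,d\psi=\pi(-1)^m\sqrt{\sinh\sigma\sinh\sigma'}\,\frac{\Gamma\left(n-m+\frac12\right)}{\Gamma\left(n+m+\frac12\right)}\,P^m_{n-1/2}(\cosh\sigma_<)\,Q^m_{n-1/2}(\cosh\sigma_>), \] where $\chi=\coth\sigma\coth\sigma'-\operatorname{csch}\sigma\operatorname{csch}\sigma'\cos\psi$ and $\sigma_<=\min\{\sigma,\sigma'\}$, $\sigma_>=\max\{\sigma,\sigma'\}$.
   Context: For $z\in\mathbb{C}\setminus(-\infty,1]$ (principal branches, $\mathbf{F}={}_2F_1/\Gamma(c)$ regularized hypergeometric function): the associated Legendre functions are $P^\mu_\nu(z)=\left(\frac{z+1}{z-1}\right)^{\mu/2}\mathbf{F}\!\left(\nu+1,-\nu;1-\mu;\frac{1-z}{2}\right)$ and $Q^\mu_\nu(z)=e^{\mu\pi i}\frac{\sqrt{\pi}\,\Gamma(\nu+\mu+1)(z^2-1)^{\mu/2}}{2^{\nu+1}z^{\nu+\mu+1}}\,\mathbf{F}\!\left(\frac{\nu+\mu}{2}+1,\frac{\nu+\mu+1}{2};\nu+\frac32;\frac{1}{z^2}\right)$, and $Q_\nu=Q^0_\nu$. *)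

theory Defs
  imports "HOL-Complex_Analysis.Complex_Analysis"
begin

definition hyp_domain :: "complex set" where
  "hyp_domain = - {z. Im z = 0 \<and> 1 \<le> Re z}"

text \<open>Power series of the regularized hypergeometric function 2F1(a,b;c;z)/Gamma(c),
  using the reciprocal Gamma function (entire), valid for norm z < 1.\<close>
definition hyp2F1_reg_series :: "complex \<Rightarrow> complex \<Rightarrow> complex \<Rightarrow> complex \<Rightarrow> complex" where
  "hyp2F1_reg_series a b c z =
     (\<Sum>k. pochhammer a k * pochhammer b k * rGamma (c + of_nat k) / fact k * z ^ k)"

definition hyp2F1_reg :: "complex \<Rightarrow> complex \<Rightarrow> complex \<Rightarrow> complex \<Rightarrow> complex" where
  "hyp2F1_reg a b c = (THE f. f holomorphic_on hyp_domain
        \<and> (\<forall>z. norm z < 1 \<longrightarrow> f z = hyp2F1_reg_series a b c z)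
        \<and> (\<forall>z. z \<notin> hyp_domain \<longrightarrow> f z = 0))"

definition legendreP :: "complex \<Rightarrow> complex \<Rightarrow> complex \<Rightarrow> complex" where
  "legendreP nu mu z =
     ((z + 1) / (z - 1)) powr (mu / 2) * hyp2F1_reg (nu + 1) (- nu) (1 - mu) ((1 - z) / 2)"

definition legendreQ :: "complex \<Rightarrow> complex \<Rightarrow> complex \<Rightarrow> complex" where
  "legendreQ nu mu z =
     exp (mu * of_real pi * \<i>) * of_real (sqrt pi) * Gamma (nu + mu + 1) * (z\<^sup>2 - 1) powr (mu / 2)
       / (2 powr (nu + 1) * z powr (nu + mu + 1))
     * hyp2F1_reg ((nu + mu) / 2 + 1) ((nu + mu + 1) / 2) (nu + 3 / 2) (1 / z\<^sup>2)"

end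

theory Submission
  imports Defs
begin

text \<open>
  Put \<open>A = tanh \<sigma> tanh \<sigma>'\<close> and \<open>B = 1 / (cosh \<sigma> cosh \<sigma>')\<close>, so that \<open>1 / \<chi> = A / (1 - B cos \<psi>)\<close>.
  Expanding the hypergeometric series of \<open>Q\<close> in powers of \<open>1 / \<chi>\<close>, then in powers of \<open>B cos \<psi>\<close>,
  and integrating termwise against \<open>cos (n \<psi>)\<close> yields Appell's double series \<open>F\<^sub>4\<close> at \<open>(A\<^sup>2, B\<^sup>2)\<close>.
  With \<open>X = tanh\<^sup>2 \<sigma>\<^sub><\<close> and \<open>Y = 1 / cosh\<^sup>2 \<sigma>\<^sub>>\<close> one has \<open>A\<^sup>2 = X (1 - Y)\<close> and
  \<open>B\<^sup>2 = Y (1 - X)\<close>, and the parameters satisfy Bailey's condition under which \<open>F\<^sub>4\<close> factors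
  into a Gauss series in \<open>X\<close> times one in \<open>Y\<close>. Euler's transformation and a quadratic
  transformation identify the two factors with \<open>P\<close> and \<open>Q\<close>. The case \<open>\<sigma> = \<sigma>'\<close> lies on
  the boundary \<open>X + Y = 1\<close> of the region of convergence; there all terms are nonnegative and
  the factorization persists by monotone convergence.
\<close>


section \<open>Analytic continuation of the regularized hypergeometric function\<close>

text \<open>\<open>hyp2F1_reg\<close> is a definite description, so none of its values is accessible
  before a holomorphic continuation to the cut plane has been constructed. The unit disc does not
  suffice: \<open>P\<close> is evaluated at \<open>(1 - cosh \<sigma>) / 2\<close>, outside the disc
  once \<open>cosh \<sigma> > 3\<close>, and only after continuation can the quadratic
  transformation move the argument to \<open>1 - 1 / (cosh \<sigma>)\<^sup>2\<close>, which lies in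
  \<open>(0, 1)\<close>.

  Bailey's condition is \<open>a + b + 1 = c + c'\<close>. Here \<open>c = m + 1\<close>,
  \<open>c' = n + 1\<close>, and the duplication formula for the Pochhammer symbol of
  \<open>m + n + 1/2\<close> gives \<open>a = (m + n + 3/2) / 2\<close> and
  \<open>b = (m + n + 1/2) / 2\<close>, so that the condition is an identity in \<open>m\<close> and
  \<open>n\<close>.

  The series argument works with nonnegative \<open>m\<close> and \<open>n\<close>. Depending on the
  signs of the given integers, the lower parameters \<open>1 - m\<close> in \<open>P\<close> and
  \<open>n + 1\<close> in \<open>Q\<close> can be nonpositive integers, where only the regularized
  function makes sense. Each Legendre function is therefore rewritten so that, Gamma factors and
  signs apart, only \<open>\<bar>m\<bar>\<close> and \<open>\<bar>n\<bar>\<close> occur.\<close>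

definition hyp2F1_coeff :: "complex \<Rightarrow> complex \<Rightarrow> complex \<Rightarrow> nat \<Rightarrow> complex" where
  "hyp2F1_coeff a b c k = pochhammer a k * pochhammer b k * rGamma (c + of_nat k) / fact k"

lemma hyp2F1_reg_series_coeff:
  "hyp2F1_reg_series a b c z = (\<Sum>k. hyp2F1_coeff a b c k * z ^ k)"
  by (simp add: hyp2F1_reg_series_def hyp2F1_coeff_def)

text \<open>The factor \<open>c + of_nat k\<close> is kept on the left instead of being divided out,
  so that the recurrence also holds when \<open>c\<close> is a nonpositive integer.\<close>

lemma hyp2F1_coeff_Suc:
  "of_nat (Suc k) * (c + of_nat k) * hyp2F1_coeff a b c (Suc k)
     = (a + of_nat k) * (b + of_nat k) * hyp2F1_coeff a b c k"
proof -
  have "(c + of_nat k) * rGamma (c + of_nat (Suc k)) = rGamma (c + of_nat k)"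
    using rGamma_plus1[of "c + of_nat k"] by (simp add: add_ac)
  hence "(a + of_nat k) * (b + of_nat k) * hyp2F1_coeff a b c k = (a + of_nat k) * (b + of_nat k)
     * pochhammer a k * pochhammer b k * ((c + of_nat k) * rGamma (c + of_nat (Suc k))) / fact k"
    by (simp add: hyp2F1_coeff_def)
  also have "\<dots> = of_nat (Suc k) * (c + of_nat k) * hyp2F1_coeff a b c (Suc k)"
    by (simp add: hyp2F1_coeff_def pochhammer_Suc divide_simps del: of_nat_Suc)
  finally show ?thesis ..
qed

lemma summable_hyp2F1_coeff:
  assumes z: "norm z < 1"
  shows "summable (\<lambda>k. hyp2F1_coeff a b c k * z ^ k)"
proof -
  define r where "r = (1 + norm z) / 2"
  have r: "norm z < r" "r < 1" "r > 0"
    using z by (auto simp: r_def add_pos_nonneg)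
  have lim: "(\<lambda>k. (a + of_nat k) * (b + of_nat k) / (of_nat (Suc k) * (c + of_nat k)) * z)
          \<longlonglongrightarrow> z"
  proof -
    have ev: "eventually (\<lambda>k. (k::nat) > 0) sequentially"
      by (rule eventually_gt_at_top)
    have inv: "(\<lambda>k. x / of_nat k) \<longlonglongrightarrow> 0" for x :: complex
      by (rule lim_const_over_n)
    have "(\<lambda>k. (a / of_nat k + 1) * (b / of_nat k + 1) / ((1 + 1 / of_nat k) * (c / of_nat k + 1)) * z)
            \<longlonglongrightarrow> (0 + 1) * (0 + 1) / ((1 + 0) * (0 + 1)) * z"
      by (intro tendsto_intros inv) auto
    moreover have "eventually (\<lambda>k. (a / of_nat k + 1) * (b / of_nat k + 1) / ((1 + 1 / of_nat k) * (c / of_nat k + 1)) * z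
       = (a + of_nat k) * (b + of_nat k) / (of_nat (Suc k) * (c + of_nat k)) * z) sequentially"
      using ev
    proof eventually_elim
      case (elim k)
      define x :: complex where "x = of_nat k"
      have x: "x \<noteq> 0" using elim by (simp add: x_def)
      have "(a / x + 1) * (b / x + 1) / ((1 + 1 / x) * (c / x + 1))
              = ((a + x) / x * ((b + x) / x)) / (((x + 1) / x) * ((c + x) / x))"
        using x by (simp add: add_divide_distrib)
      also have "\<dots> = (a + x) * (b + x) / ((x + 1) * (c + x))"
        using x by simp
      finally show ?case by (simp add: x_def add_ac)
    qed
    ultimately show ?thesis
      by (simp add: tendsto_cong)
  qed
  have "eventually (\<lambda>k. norm ((a + of_nat k) * (b + of_nat k) / (of_nat (Suc k) * (c + of_nat k)) * z) < r)
          sequentially"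
    using tendsto_norm[OF lim] r(1) by (rule order_tendstoD)
  \<comment> \<open>Beyond \<open>norm c\<close> the factor \<open>c + of_nat k\<close> cannot
    vanish, so the recurrence may be solved for the next coefficient.\<close>
  moreover have "eventually (\<lambda>k. real k > norm c) sequentially"
    by (rule filterlim_at_top_dense[THEN iffD1, rule_format, OF filterlim_real_sequentially])
  ultimately have "eventually (\<lambda>k. norm (hyp2F1_coeff a b c (Suc k) * z ^ Suc k)
                 \<le> r * norm (hyp2F1_coeff a b c k * z ^ k)) sequentially"
  proof eventually_elim
    case (elim k)
    have "c + of_nat k \<noteq> 0"
    proof
      assume "c + of_nat k = 0"
      hence "c = - of_nat k" by (simp add: add_eq_0_iff2)
      hence "norm c = real k" by simp
      thus False using elim by simp
    qed
    hence "hyp2F1_coeff a b c (Suc k) = (a + of_nat k) * (b + of_nat k)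
             / (of_nat (Suc k) * (c + of_nat k)) * hyp2F1_coeff a b c k"
      using hyp2F1_coeff_Suc[of k c a b] by (simp add: divide_simps mult_ac del: of_nat_Suc)
    hence "hyp2F1_coeff a b c (Suc k) * z ^ Suc k = ((a + of_nat k) * (b + of_nat k)
             / (of_nat (Suc k) * (c + of_nat k)) * z) * (hyp2F1_coeff a b c k * z ^ k)"
      by simp
    thus ?case using elim
      by (simp only: norm_mult) (intro mult_right_mono, simp_all add: norm_mult)
  qed
  then obtain N where "\<And>k. k \<ge> N \<Longrightarrow> norm (hyp2F1_coeff a b c (Suc k) * z ^ Suc k)
                 \<le> r * norm (hyp2F1_coeff a b c k * z ^ k)"
    by (auto simp: eventually_sequentially)
  thus ?thesis
    using r by (intro summable_ratio_test[of r N]) auto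
qed

lemma hyp2F1_reg_series_sums:
  "norm z < 1 \<Longrightarrow> (\<lambda>k. hyp2F1_coeff a b c k * z ^ k) sums hyp2F1_reg_series a b c z"
  by (simp add: hyp2F1_reg_series_coeff summable_hyp2F1_coeff summable_sums)

lemma open_hyp_domain [simp]: "open hyp_domain"
proof -
  have "closed ({z. Im z = 0} \<inter> {z. 1 \<le> Re z})"
    by (intro closed_Int closed_Collect_eq closed_Collect_le continuous_intros)
  moreover have "hyp_domain = - ({z. Im z = 0} \<inter> {z. 1 \<le> Re z})"
    by (auto simp: hyp_domain_def)
  ultimately show ?thesis by (metis open_Compl)
qed

lemma ball_subset_hyp_domain: "ball 0 1 \<subseteq> hyp_domain"
proof
  fix z :: complex assume "z \<in> ball 0 1"
  thus "z \<in> hyp_domain"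
    using complex_Re_le_cmod[of z] by (auto simp: hyp_domain_def)
qed

lemma hyp_domain_mult:
  assumes "z \<in> hyp_domain" "0 \<le> t" "t \<le> 1"
  shows "of_real t * z \<in> hyp_domain"
proof (rule ccontr)
  assume "of_real t * z \<notin> hyp_domain"
  hence 1: "t * Im z = 0" "1 \<le> t * Re z" by (auto simp: hyp_domain_def)
  hence "t \<noteq> 0" by auto
  with 1 have "Im z = 0" by simp
  hence "Re z < 1" using assms(1) by (auto simp: hyp_domain_def)
  hence "t * Re z < t * 1"
    using assms \<open>t \<noteq> 0\<close> by (intro mult_strict_left_mono) auto
  thus False using 1 assms(3) by simp
qed

lemma connected_hyp_domain [simp]: "connected hyp_domain"
proof -
  have "starlike hyp_domain"
    unfolding starlike_def
  proof (intro bexI ballI subsetI)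
    show "0 \<in> hyp_domain" using ball_subset_hyp_domain by auto
    fix z w assume "z \<in> hyp_domain" "w \<in> closed_segment 0 z"
    thus "w \<in> hyp_domain"
      using hyp_domain_mult[of z] by (auto simp: closed_segment_def scaleR_conv_of_real)
  qed
  thus ?thesis by (rule starlike_imp_connected)
qed

text \<open>Unlike the predicate behind \<open>hyp2F1_reg\<close>, this one leaves the values on the
  cut open. Derivatives and combinations of continuations can thus be taken directly, and the values
  on the cut are set to 0 only once, at the end.\<close>

definition continues_hyp2F1 :: "complex \<Rightarrow> complex \<Rightarrow> complex \<Rightarrow> (complex \<Rightarrow> complex) \<Rightarrow> bool" where
  "continues_hyp2F1 a b c f \<longleftrightarrow> f holomorphic_on hyp_domain \<and>
     (\<forall>z. norm z < 1 \<longrightarrow> (\<lambda>k. hyp2F1_coeff a b c k * z ^ k) sums f z)"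

text \<open>The operator \<open>z d/dz\<close> multiplies the \<open>k\<close>-th coefficient by
  \<open>k\<close>. Both contiguous relations below are built from it.\<close>

lemma continues_hyp2F1_moment:
  assumes "continues_hyp2F1 a b c f" and z: "norm z < 1"
  shows "(\<lambda>k. of_nat k * hyp2F1_coeff a b c k * z ^ k) sums (z * deriv f z)"
proof -
  let ?h = "hyp2F1_coeff a b c"
  obtain K :: real where K: "norm z < K" "K < 1"
    using z dense by blast
  have nK: "norm (complex_of_real K) = K"
    using K norm_ge_zero[of z] by (simp del: norm_ge_zero)
  have sm: "summable (\<lambda>k. ?h k * of_real K ^ k)"
    by (rule summable_hyp2F1_coeff) (use nK K in simp)
  have der: "((\<lambda>z. \<Sum>k. ?h k * z ^ k) has_field_derivative (\<Sum>k. diffs ?h k * z ^ k)) (at z)"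
    by (rule termdiffs_strong[OF sm]) (use nK K in simp)
  have "(f has_field_derivative (\<Sum>k. diffs ?h k * z ^ k)) (at z)"
  proof (rule DERIV_cong_ev[THEN iffD2, OF refl _ refl der])
    have "eventually (\<lambda>w. w \<in> ball 0 1) (nhds z)"
      using z by (intro eventually_nhds_in_open) auto
    thus "eventually (\<lambda>w. f w = (\<Sum>k. ?h k * w ^ k)) (nhds z)"
      by eventually_elim (use assms(1) in \<open>auto simp: continues_hyp2F1_def sums_iff\<close>)
  qed
  hence D: "deriv f z = (\<Sum>k. diffs ?h k * z ^ k)" by (rule DERIV_imp_deriv)
  have "summable (\<lambda>k. diffs ?h k * z ^ k)"
    by (rule termdiff_converges[where K = 1]) (use z summable_hyp2F1_coeff in auto)
  hence "(\<lambda>k. of_nat k * ?h k * z ^ (k - Suc 0)) sums deriv f z"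
    unfolding D by (rule diffs_equiv)
  hence "(\<lambda>k. z * (of_nat k * ?h k * z ^ (k - Suc 0))) sums (z * deriv f z)"
    by (rule sums_mult)
  moreover have "z * (of_nat k * ?h k * z ^ (k - Suc 0)) = of_nat k * ?h k * z ^ k" for k
    by (cases k) auto
  ultimately show ?thesis by simp
qed

text \<open>Since \<open>rGamma (c - 1 + k) = (c - 1 + k) * rGamma (c + k)\<close>, the operator
  \<open>c - 1 + z d/dz\<close> lowers \<open>c\<close>. With the regularized normalization this
  step has no exceptional values of \<open>c\<close>.\<close>

lemma continues_hyp2F1_lower_c:
  assumes "continues_hyp2F1 a b c f"
  shows "continues_hyp2F1 a b (c - 1) (\<lambda>z. (c - 1) * f z + z * deriv f z)"
  unfolding continues_hyp2F1_def
proof (intro conjI allI impI)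
  show "(\<lambda>z. (c - 1) * f z + z * deriv f z) holomorphic_on hyp_domain"
    using assms by (auto simp: continues_hyp2F1_def intro!: holomorphic_intros)
next
  fix z :: complex assume z: "norm z < 1"
  have 1: "(\<lambda>k. hyp2F1_coeff a b c k * z ^ k) sums f z"
    using assms z by (auto simp: continues_hyp2F1_def)
  have "(\<lambda>k. (c - 1) * (hyp2F1_coeff a b c k * z ^ k) + of_nat k * hyp2F1_coeff a b c k * z ^ k)
           sums ((c - 1) * f z + z * deriv f z)"
    by (intro sums_add sums_mult 1 continues_hyp2F1_moment[OF assms z])
  moreover have "(c - 1) * (hyp2F1_coeff a b c k * z ^ k) + of_nat k * hyp2F1_coeff a b c k * z ^ k
        = hyp2F1_coeff a b (c - 1) k * z ^ k" for k
  proof -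
    have r: "rGamma (c - 1 + of_nat k) = (c - 1 + of_nat k) * rGamma (c + of_nat k)"
      using rGamma_plus1[of "c - 1 + of_nat k"] by (simp add: algebra_simps)
    show ?thesis unfolding hyp2F1_coeff_def r
      by (simp add: algebra_simps add_divide_distrib diff_divide_distrib)
  qed
  ultimately show "(\<lambda>k. hyp2F1_coeff a b (c - 1) k * z ^ k) sums ((c - 1) * f z + z * deriv f z)"
    by simp
qed

text \<open>With \<open>\<theta> = z d/dz\<close> this is the contiguous relation
  \<open>(c - b) F(b - 1) = (\<theta> + c - b) F - z (\<theta> + a) F\<close>. On coefficients it
  reduces to \<open>(j + 1 + c - b) (b + j) - (j + 1) (c + j) = (c - b) (b - 1)\<close>.\<close>

lemma continues_hyp2F1_lower_b:
  assumes "continues_hyp2F1 a b c f" "b \<noteq> c"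
  shows "continues_hyp2F1 a (b - 1) c
           (\<lambda>z. (z * (1 - z) * deriv f z - (b - c + a * z) * f z) / (c - b))"
  unfolding continues_hyp2F1_def
proof (intro conjI allI impI)
  show "(\<lambda>z. (z * (1 - z) * deriv f z - (b - c + a * z) * f z) / (c - b)) holomorphic_on hyp_domain"
    using assms by (auto simp: continues_hyp2F1_def intro!: holomorphic_intros)
next
  fix z :: complex assume z: "norm z < 1"
  let ?h = "hyp2F1_coeff a b c"
  have 1: "(\<lambda>k. ?h k * z ^ k) sums f z"
    using assms z by (auto simp: continues_hyp2F1_def)
  have 2: "(\<lambda>k. of_nat k * ?h k * z ^ k) sums (z * deriv f z)"
    by (rule continues_hyp2F1_moment[OF assms(1) z])
  \<comment> \<open>Coefficients of \<open>z (\<theta> + a) F\<close>: multiplication by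
    \<open>z\<close> moves the index by one, hence the separate value at 0.\<close>
  define s where "s k = (if k = 0 then 0 else (of_nat (k-1) + a) * ?h (k-1) * z ^ k)" for k
  have "(\<lambda>k. z * (of_nat k * ?h k * z ^ k + a * (?h k * z ^ k))) sums (z * (z * deriv f z + a * f z))"
    by (intro sums_mult sums_add 1 2)
  hence "(\<lambda>k. s (Suc k)) sums (z * (z * deriv f z + a * f z))"
    by (simp add: s_def algebra_simps)
  hence 3: "s sums (z * (z * deriv f z + a * f z))"
    by (subst (asm) sums_Suc_iff) (simp add: s_def)
  have "(\<lambda>k. ((of_nat k * ?h k * z ^ k + (c - b) * (?h k * z ^ k)) - s k) / (c - b)) sums
          (((z * deriv f z + (c - b) * f z) - z * (z * deriv f z + a * f z)) / (c - b))"
    by (intro sums_divide sums_diff sums_add sums_mult 1 2 3)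
  moreover have "((of_nat k * ?h k * z ^ k + (c - b) * (?h k * z ^ k)) - s k) / (c - b)
       = hyp2F1_coeff a (b - 1) c k * z ^ k" for k
  proof (cases k)
    case 0
    thus ?thesis using assms(2) by (simp add: s_def hyp2F1_coeff_def)
  next
    case (Suc j)
    define P where "P = pochhammer a (Suc j) * pochhammer b j * rGamma (c + of_nat (Suc j)) / fact (Suc j)"
    have r: "rGamma (c + of_nat j) = (c + of_nat j) * rGamma (c + of_nat (Suc j))"
      using rGamma_plus1[of "c + of_nat j"] by (simp add: add_ac)
    have p: "pochhammer (b - 1) (Suc j) = (b - 1) * pochhammer b j"
      by (simp add: pochhammer_rec)
    have hk: "?h (Suc j) = (b + of_nat j) * P"
      by (simp add: hyp2F1_coeff_def P_def pochhammer_Suc)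
    have hj: "(of_nat j + a) * ?h j = of_nat (Suc j) * (c + of_nat j) * P"
      unfolding hyp2F1_coeff_def P_def r
      by (simp add: pochhammer_Suc divide_simps del: of_nat_Suc)
    have hb: "hyp2F1_coeff a (b - 1) c (Suc j) = (b - 1) * P"
      unfolding hyp2F1_coeff_def P_def p by simp
    have "(of_nat k * ?h k * z ^ k + (c - b) * (?h k * z ^ k)) - s k
            = ((of_nat (Suc j) + c - b) * ((b + of_nat j) * P) - of_nat (Suc j) * (c + of_nat j) * P) * z ^ k"
      using hj by (simp add: s_def Suc hk algebra_simps)
    also have "\<dots> = (c - b) * ((b - 1) * P * z ^ k)"
      by (simp add: algebra_simps)
    finally show ?thesis using assms(2) hb Suc by simp
  qed
  ultimately show "(\<lambda>k. hyp2F1_coeff a (b - 1) c k * z ^ k) sums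
         ((z * (1 - z) * deriv f z - (b - c + a * z) * f z) / (c - b))"
    by (simp add: algebra_simps)
qed

text \<open>For \<open>z\<close> in the star-shaped cut plane and \<open>t\<close> in
  \<open>[0, 1]\<close>, the number \<open>1 - z t\<close> avoids the branch cut of
  \<open>powr\<close>, so the integral is holomorphic in \<open>z\<close>. Inside the disc the
  binomial series of \<open>(1 - z t) powr (-a)\<close> converges uniformly in \<open>t\<close>, and
  the Beta integrals of its terms reproduce the coefficients up to the constant
  \<open>Gamma b * Gamma (c - b)\<close>.\<close>

lemma continues_hyp2F1_Euler_integral:
  fixes b c :: real
  assumes bc: "b > 1" "c > b + 1"
  shows "\<exists>f. continues_hyp2F1 a (of_real b) (of_real c) f"
proof -
  define w where "w t = t powr (b - 1) * (1 - t) powr (c - b - 1)" for t :: real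
  define E where "E z = integral {0..1} (\<lambda>t. of_real (w t) * (1 - z * of_real t) powr (-a))" for z
  have w_cont: "continuous_on {0..1} w"
    unfolding w_def using bc by (intro continuous_intros continuous_on_powr') auto
  have cw: "continuous_on {0..1} (\<lambda>t. complex_of_real (w t))"
    by (intro continuous_intros w_cont)
  have ndom: "1 - z * of_real t \<notin> \<real>\<^sub>\<le>\<^sub>0" if "z \<in> hyp_domain" "t \<in> {0..1}" for z t
    using hyp_domain_mult[of z t] that
    by (auto simp: hyp_domain_def complex_nonpos_Reals_iff mult.commute)
  have cont: "continuous_on (U \<times> {0..1}) (\<lambda>(z, t). of_real (w t) * (1 - z * of_real t) powr s)"
    if "U \<subseteq> hyp_domain" for U s
  proof -
    have nn: "1 - fst p * of_real (snd p) \<notin> \<real>\<^sub>\<le>\<^sub>0" if "p \<in> U \<times> {0..1}" for p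
      using that \<open>U \<subseteq> hyp_domain\<close> by (intro ndom) auto
    have "continuous_on (U \<times> {0..1}) (\<lambda>p. of_real (w (snd p)) * (1 - fst p * of_real (snd p)) powr s)"
      by (intro continuous_on_mult continuous_on_powr_complex continuous_on_of_real
            continuous_on_compose2[OF w_cont] continuous_on_diff continuous_on_const
            continuous_on_fst continuous_on_snd continuous_on_id)
         ((use nn in \<open>force simp: complex_nonpos_Reals_iff\<close>) | (metis nn nonpos_Reals_zero_I))+
    thus ?thesis by (simp add: case_prod_unfold)
  qed
  have hol: "E holomorphic_on hyp_domain"
  proof (subst holomorphic_on_open, simp, intro ballI)
    fix z0 assume "z0 \<in> hyp_domain"
    \<comment> \<open>The Leibniz rule wants a convex domain, which the cut plane is not; a ball
      around each point is enough for differentiability.\<close>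
    then obtain e where e: "e > 0" "ball z0 e \<subseteq> hyp_domain"
      using open_contains_ball open_hyp_domain by blast
    have "(\<lambda>z. integral (cbox 0 1) (\<lambda>t. of_real (w t) * (1 - z * of_real t) powr (-a))) holomorphic_on ball z0 e"
    proof (rule leibniz_rule_holomorphic[where fx = "\<lambda>z t. of_real (w t) * (1 - z * of_real t) powr (-a-1) * (a * of_real t)"])
      fix z t assume zt: "z \<in> ball z0 e" "t \<in> cbox 0 (1::real)"
      hence nn: "1 - z * of_real t \<notin> \<real>\<^sub>\<le>\<^sub>0" using ndom e by auto
      show "((\<lambda>z. of_real (w t) * (1 - z * of_real t) powr (-a)) has_field_derivative
          of_real (w t) * (1 - z * of_real t) powr (-a-1) * (a * of_real t)) (at z within ball z0 e)"
        by (rule derivative_eq_intros refl nn | use nn in simp)+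
    next
      fix z assume z: "z \<in> ball z0 e"
      have "continuous_on {0..1} (\<lambda>t. of_real (w t) * (1 - z * of_real t) powr (-a))"
        using continuous_on_compose2[OF cont[OF e(2), of "-a"], of "{0..1}" "\<lambda>t. (z, t)"] z
        by (simp add: continuous_on_Pair image_subset_iff)
      thus "(\<lambda>t. of_real (w t) * (1 - z * of_real t) powr (-a)) integrable_on cbox 0 1"
        by (intro integrable_continuous) simp
    next
      have "continuous_on (ball z0 e \<times> {0..1}) (\<lambda>p. (\<lambda>(z,t). of_real (w t) * (1 - z * of_real t) powr (-a-1)) p * (a * of_real (snd p)))"
        by (intro continuous_on_mult cont e continuous_intros)
      thus "continuous_on (ball z0 e \<times> cbox 0 1)
             (\<lambda>(z, t). of_real (w t) * (1 - z * of_real t) powr (-a-1) * (a * of_real t))"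
        by (simp add: case_prod_unfold)
    qed auto
    moreover have "E = (\<lambda>z. integral (cbox 0 1) (\<lambda>t. of_real (w t) * (1 - z * of_real t) powr (-a)))"
      by (simp add: E_def fun_eq_iff)
    ultimately have "E holomorphic_on ball z0 e" by simp
    thus "\<exists>f'. (E has_field_derivative f') (at z0)"
      using e(1) by (subst (asm) holomorphic_on_open) auto
  qed
  have G0: "Gamma b \<noteq> 0" "Gamma (c - b) \<noteq> 0"
    using bc by (auto simp: Gamma_eq_zero_iff elim!: nonpos_Ints_cases)
  have ser: "(\<lambda>k. hyp2F1_coeff a (of_real b) (of_real c) k * z ^ k) sums (E z / of_real (Gamma b * Gamma (c - b)))"
    if z: "norm z < 1" for z
  proof -
    define g where "g k t = complex_of_real (w t) * (((-a) gchoose k) * (- z * of_real t) ^ k)" for k t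
    have sums_g: "(\<lambda>k. g k t) sums (of_real (w t) * (1 - z * of_real t) powr (-a))" if t: "t \<in> {0..1}" for t
    proof -
      have "norm (- z * of_real t) \<le> norm z"
        using t by (simp add: norm_mult mult_left_le)
      hence "norm (- z * of_real t) < 1" using z by simp
      from gen_binomial_complex[OF this, of "-a"] show ?thesis
        unfolding g_def by (intro sums_mult) simp
    qed
    obtain B where "\<forall>x\<in>w ` {0..1}. norm x \<le> B"
      using compact_imp_bounded[OF compact_continuous_image[OF w_cont compact_Icc]]
      unfolding bounded_iff by blast
    hence B: "norm (w t) \<le> B" if "t \<in> {0..1}" for t
      using that by blast
    have smb: "summable (\<lambda>k. norm (((-a) gchoose k) * z ^ k))"
    proof -
      obtain K :: real where K: "norm z < K" "K < 1"
        using z dense by blast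
      have nK: "norm (complex_of_real K) = K"
        using K norm_ge_zero[of z] by (simp del: norm_ge_zero)
      have "summable (\<lambda>k. ((-a) gchoose k) * of_real K ^ k)"
        using gen_binomial_complex[of "of_real K" "-a"] nK K by (auto simp: sums_iff)
      from powser_insidea[OF this] show ?thesis using nK K by simp
    qed
    have ul: "uniform_limit {0..1} (\<lambda>n t. \<Sum>k<n. g k t)
            (\<lambda>t. of_real (w t) * (1 - z * of_real t) powr (-a)) sequentially"
    proof -
      have "uniform_limit {0..1} (\<lambda>n t. \<Sum>k<n. g k t) (\<lambda>t. suminf (\<lambda>k. g k t)) sequentially"
      proof (rule Weierstrass_m_test)
        fix k t assume t: "t \<in> {0..1::real}"
        have "norm (g k t) = norm (w t) * (norm (((-a) gchoose k) * z ^ k) * \<bar>t\<bar> ^ k)"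
          by (simp add: g_def norm_mult norm_power power_mult_distrib mult_ac)
        also have "\<dots> \<le> B * (norm (((-a) gchoose k) * z ^ k) * 1)"
          using t B[of t] by (intro mult_mono) (auto intro!: power_le_one order.trans[OF norm_ge_zero B[of t]])
        finally show "norm (g k t) \<le> B * norm (((-a) gchoose k) * z ^ k)" by simp
      qed (use smb in \<open>auto intro: summable_mult\<close>)
      moreover have "(\<Sum>k. g k t) = of_real (w t) * (1 - z * of_real t) powr (-a)" if "t \<in> {0..1}" for t
        using sums_g[OF that] by (simp add: sums_iff)
      ultimately show ?thesis by (subst uniform_limit_cong'[OF refl, of _ _ "\<lambda>t. suminf (\<lambda>k. g k t)"]) auto
    qed
    have cg: "continuous_on {0..1} (\<lambda>t. \<Sum>k<n. g k t)" for n
      unfolding g_def by (intro continuous_intros cw)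
    obtain I J where IJ: "\<And>n. ((\<lambda>t. \<Sum>k<n. g k t) has_integral I n) {0..1}"
       "((\<lambda>t. of_real (w t) * (1 - z * of_real t) powr (-a)) has_integral J) {0..1}" "I \<longlonglongrightarrow> J"
      using uniform_limit_integral[OF ul cg] by auto
    have J: "J = E z" using IJ(2) by (simp add: E_def integral_unique)
    have int_g: "((\<lambda>t. g k t) has_integral
        (hyp2F1_coeff a (of_real b) (of_real c) k * z ^ k * of_real (Gamma b * Gamma (c - b)))) {0..1}" for k
    proof -
      have I1: "((\<lambda>t. t powr ((b + real k) - 1) * (1 - t) powr ((c - b) - 1)) has_integral Beta (b + real k) (c - b)) {0..1}"
        using bc by (intro has_integral_Beta_real) auto
      \<comment> \<open>At \<open>t = 0\<close> both sides vanish because of the convention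
        \<open>0 powr s = 0\<close>.\<close>
      have E1: "t powr ((b + real k) - 1) * (1 - t) powr ((c - b) - 1) = w t * t ^ k"
        if t: "t \<in> {0..1}" for t
      proof (cases "t = 0")
        case False
        hence "t powr (b + real k - 1) = t powr (b - 1) * t ^ k"
          using t by (simp add: powr_realpow[symmetric] powr_add[symmetric] algebra_simps)
        thus ?thesis by (simp add: w_def)
      qed (use bc in \<open>auto simp: w_def\<close>)
      have "((\<lambda>t. w t * t ^ k) has_integral Beta (b + real k) (c - b)) {0..1}"
        by (rule has_integral_eq[OF _ I1]) (rule E1)
      hence "((\<lambda>t. (((-a) gchoose k) * (-z) ^ k) * complex_of_real (w t * t ^ k)) has_integral
               ((((-a) gchoose k) * (-z) ^ k) * of_real (Beta (b + real k) (c - b)))) {0..1}"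
        by (intro has_integral_mult_right has_integral_of_real)
      moreover have "(((-a) gchoose k) * (-z) ^ k) * complex_of_real (w t * t ^ k) = g k t" for t
        by (simp only: g_def power_mult_distrib of_real_mult of_real_power mult_ac)
      moreover have "(((-a) gchoose k) * (-z) ^ k) * of_real (Beta (b + real k) (c - b))
         = hyp2F1_coeff a (of_real b) (of_real c) k * z ^ k * of_real (Gamma b * Gamma (c - b))"
      proof -
        have "b \<notin> \<int>\<^sub>\<le>\<^sub>0" using bc by (auto elim!: nonpos_Ints_cases)
        hence "pochhammer b k = Gamma (b + real k) / Gamma b"
          by (rule pochhammer_Gamma)
        hence "Gamma (b + real k) = pochhammer b k * Gamma b"
          using G0 by simp
        hence be: "Beta (b + real k) (c - b) = pochhammer b k * Gamma b * Gamma (c - b) * rGamma (c + real k)"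
          by (simp add: Beta_def rGamma_inverse_Gamma field_simps add_ac)
        have m: "(-1) ^ k * (-z) ^ k = z ^ k"
          by (simp flip: power_mult_distrib)
        have rg: "rGamma (complex_of_real c + of_nat k) = of_real (rGamma (c + real k))"
          by (simp flip: rGamma_complex_of_real)
        have po: "complex_of_real (pochhammer b k) = pochhammer (of_real b) k"
          by (simp add: pochhammer_of_real)
        have "(((-a) gchoose k) * (-z) ^ k) * of_real (Beta (b + real k) (c - b))
           = ((-1) ^ k * (-z) ^ k) * pochhammer a k / fact k * of_real (Beta (b + real k) (c - b))"
          by (simp add: gbinomial_pochhammer)
        also have "\<dots> = hyp2F1_coeff a (of_real b) (of_real c) k * z ^ k * of_real (Gamma b * Gamma (c - b))"
          unfolding m be hyp2F1_coeff_def by (simp add: po rg)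
        finally show ?thesis .
      qed
      ultimately show ?thesis by simp
    qed
    have "I n = (\<Sum>k<n. hyp2F1_coeff a (of_real b) (of_real c) k * z ^ k * of_real (Gamma b * Gamma (c - b)))" for n
    proof -
      have "((\<lambda>t. \<Sum>k<n. g k t) has_integral (\<Sum>k<n. hyp2F1_coeff a (of_real b) (of_real c) k * z ^ k * of_real (Gamma b * Gamma (c - b)))) {0..1}"
        by (intro has_integral_sum int_g) auto
      thus ?thesis using IJ(1)[of n] has_integral_unique by blast
    qed
    hence "I = (\<lambda>n. \<Sum>k<n. hyp2F1_coeff a (of_real b) (of_real c) k * z ^ k * of_real (Gamma b * Gamma (c - b)))"
      by (rule ext)
    hence "(\<lambda>k. hyp2F1_coeff a (of_real b) (of_real c) k * z ^ k * of_real (Gamma b * Gamma (c - b))) sums E z"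
      using IJ(3) J unfolding sums_def by simp
    from sums_divide[OF this, of "of_real (Gamma b * Gamma (c - b))"] show ?thesis
      using G0 by simp
  qed
  show ?thesis
    unfolding continues_hyp2F1_def
    by (rule exI[of _ "\<lambda>z. E z / of_real (Gamma b * Gamma (c - b))"])
       (use hol ser G0 in \<open>auto intro!: holomorphic_intros\<close>)
qed


lemma continues_hyp2F1_lower_b_iterate:
  fixes b c :: real
  assumes "continues_hyp2F1 a (of_real (b + real n)) (of_real c) f" "c > b + real n"
  shows "\<exists>f. continues_hyp2F1 a (of_real b) (of_real c) f"
  using assms
proof (induction n arbitrary: f)
  case (Suc n)
  have "continues_hyp2F1 a (of_real (b + real (Suc n)) - 1) (of_real c)
          (\<lambda>z. (z * (1 - z) * deriv f z - (of_real (b + real (Suc n)) - of_real c + a * z) * f z)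
             / (of_real c - of_real (b + real (Suc n))))"
    using Suc.prems by (intro continues_hyp2F1_lower_b) (auto simp only: of_real_eq_iff)
  moreover have "complex_of_real (b + real (Suc n)) - 1 = of_real (b + real n)" by simp
  ultimately show ?case using Suc.IH Suc.prems(2) by auto
qed auto

lemma continues_hyp2F1_lower_c_iterate:
  assumes "continues_hyp2F1 a b (c + of_nat n) f"
  shows "\<exists>f. continues_hyp2F1 a b c f"
  using assms
proof (induction n arbitrary: f)
  case (Suc n)
  from continues_hyp2F1_lower_c[OF Suc.prems] have "\<exists>g. continues_hyp2F1 a b (c + of_nat n) g"
    by auto
  thus ?case using Suc.IH by blast
qed auto

text \<open>
  Euler's integral has a continuous integrand once \<open>1 < b\<close> and \<open>b + 1 < c\<close>; first-order
  contiguous relations then lower \<open>b\<close> and \<open>c\<close> to arbitrary values. Lowering \<open>b\<close> divides by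
  \<open>c - b\<close>, so it is done while \<open>c\<close> is still large.
\<close>

lemma continues_hyp2F1_exists:
  fixes b c :: real
  shows "\<exists>f. continues_hyp2F1 a (of_real b) (of_real c) f"
proof -
  obtain n :: nat where n: "real n > 1 - b"
    using reals_Archimedean2 by blast
  obtain k :: nat where k: "real k > b + real n + 1 - c"
    using reals_Archimedean2 by blast
  obtain f where "continues_hyp2F1 a (of_real (b + real n)) (of_real (c + real k)) f"
    using continues_hyp2F1_Euler_integral[of "b + real n" "c + real k" a] n k by auto
  then obtain g where "continues_hyp2F1 a (of_real b) (of_real (c + real k)) g"
    using continues_hyp2F1_lower_b_iterate[of a b n "c + real k" f] k by auto
  thus ?thesis using continues_hyp2F1_lower_c_iterate[of a "of_real b" "of_real c" k g] by simp
qed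

text \<open>The description has exactly one solution: some continuation, reset to 0 on the cut,
  satisfies it, and the identity theorem on the connected cut plane together with the prescribed
  zeros leaves no other. From here on \<open>hyp2F1_reg\<close> is used only through its power
  series and holomorphy.\<close>

lemma continues_hyp2F1_hyp2F1_reg:
  assumes "b \<in> \<real>" "c \<in> \<real>"
  shows "continues_hyp2F1 a b c (hyp2F1_reg a b c)"
proof -
  define P where "P f \<longleftrightarrow> f holomorphic_on hyp_domain
        \<and> (\<forall>z. norm z < 1 \<longrightarrow> f z = hyp2F1_reg_series a b c z)
        \<and> (\<forall>z. z \<notin> hyp_domain \<longrightarrow> f z = 0)" for f
  obtain f where f: "continues_hyp2F1 a b c f"
    using continues_hyp2F1_exists assms by (metis Reals_cases)
  define g where "g z = (if z \<in> hyp_domain then f z else 0)" for z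
  have "P g"
    unfolding P_def
  proof (intro conjI allI impI)
    have "f holomorphic_on hyp_domain" using f by (simp add: continues_hyp2F1_def)
    thus "g holomorphic_on hyp_domain"
      by (rule holomorphic_transform) (simp add: g_def)
    fix z :: complex assume "norm z < 1"
    moreover from this have "z \<in> hyp_domain" using ball_subset_hyp_domain by auto
    ultimately show "g z = hyp2F1_reg_series a b c z"
      using f by (simp add: g_def continues_hyp2F1_def hyp2F1_reg_series_coeff sums_iff)
  qed (simp add: g_def)
  moreover have "h = g" if "P h" for h
  proof
    fix z
    show "h z = g z"
    proof (cases "z \<in> hyp_domain")
      case True
      show ?thesis
      proof (rule analytic_continuation_open[of "ball 0 1" hyp_domain h g])
        show "h holomorphic_on hyp_domain" "g holomorphic_on hyp_domain"
          using \<open>P h\<close> \<open>P g\<close> by (auto simp: P_def)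
      qed (use True ball_subset_hyp_domain \<open>P h\<close> \<open>P g\<close> in \<open>auto simp: P_def\<close>)
    qed (use \<open>P h\<close> \<open>P g\<close> in \<open>simp add: P_def\<close>)
  qed
  ultimately have "P (THE f. P f)" by (rule theI[of P])
  moreover have "(THE f. P f) = hyp2F1_reg a b c"
    unfolding P_def hyp2F1_reg_def ..
  ultimately have "P (hyp2F1_reg a b c)" by simp
  thus ?thesis
    by (simp add: P_def continues_hyp2F1_def hyp2F1_reg_series_sums)
qed

lemma hyp2F1_reg_holomorphic:
  "b \<in> \<real> \<Longrightarrow> c \<in> \<real> \<Longrightarrow> hyp2F1_reg a b c holomorphic_on hyp_domain"
  using continues_hyp2F1_hyp2F1_reg by (simp add: continues_hyp2F1_def)

lemma hyp2F1_reg_sums: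
  "b \<in> \<real> \<Longrightarrow> c \<in> \<real> \<Longrightarrow> norm z < 1 \<Longrightarrow>
     (\<lambda>k. hyp2F1_coeff a b c k * z ^ k) sums hyp2F1_reg a b c z"
  using continues_hyp2F1_hyp2F1_reg by (simp add: continues_hyp2F1_def)

lemma holomorphic_eq_of_eventually_eq:
  assumes "open U" "connected U" "w \<in> U" "f holomorphic_on U" "g holomorphic_on U"
    "eventually (\<lambda>z. f z = g z) (nhds w)" "z \<in> U"
  shows "f z = g z"
proof -
  obtain V where V: "open V" "w \<in> V" "\<And>z. z \<in> V \<Longrightarrow> f z = g z"
    using assms(6) by (auto simp: eventually_nhds)
  show ?thesis
    by (rule analytic_continuation_open[of "V \<inter> U" U f g]) (use V assms in auto)
qed

section \<open>Symmetry in the upper parameters, and nonpositive integers as lower parameter\<close>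

lemma hyp2F1_reg_commute: "hyp2F1_reg a b c = hyp2F1_reg b a c"
  by (simp add: hyp2F1_reg_def hyp2F1_reg_series_def mult_ac)

lemma hyp2F1_coeff_shift:
  "hyp2F1_coeff a b (1 - of_nat M) (k + M)
     = pochhammer a M * pochhammer b M * hyp2F1_coeff (a + of_nat M) (b + of_nat M) (1 + of_nat M) k"
proof -
  have 1: "pochhammer x (k + M) = pochhammer x M * pochhammer (x + of_nat M) k" for x :: complex
    using pochhammer_product'[of x M k] by (simp add: add.commute)
  have "1 - of_nat M + of_nat (k + M) = (of_nat (Suc k) :: complex)" by simp
  hence r1: "rGamma (1 - of_nat M + of_nat (k + M)) = (inverse (fact k) :: complex)"
    by (simp only: rGamma_inverse_Gamma Gamma_fact[symmetric]) (simp add: add.commute)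
  have "(1 + of_nat M) + of_nat k = (1 + of_nat (k + M) :: complex)" by simp
  hence r2: "rGamma ((1 + of_nat M) + of_nat k) = (inverse (fact (k + M)) :: complex)"
    by (simp only: rGamma_inverse_Gamma Gamma_fact)
  show ?thesis
    by (simp only: hyp2F1_coeff_def 1 r1 r2) (simp add: field_simps)
qed

text \<open>The zeros of \<open>rGamma\<close> annihilate the first \<open>M\<close> coefficients,
  and the remaining ones are those of the function with all three parameters raised by
  \<open>M\<close>. This serves \<open>Q\<close> of negative degree and \<open>P\<close> of
  nonnegative order.\<close>

lemma hyp2F1_reg_nonpos_int:
  assumes b: "b \<in> \<real>" and z: "z \<in> hyp_domain"
  shows "hyp2F1_reg a b (1 - of_nat M) z = pochhammer a M * pochhammer b M * z ^ M
           * hyp2F1_reg (a + of_nat M) (b + of_nat M) (1 + of_nat M) z"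
proof (rule sym, rule holomorphic_eq_of_eventually_eq[of hyp_domain 0
    "\<lambda>z. pochhammer a M * pochhammer b M * z ^ M
           * hyp2F1_reg (a + of_nat M) (b + of_nat M) (1 + of_nat M) z"])
  show "(\<lambda>z. pochhammer a M * pochhammer b M * z ^ M
           * hyp2F1_reg (a + of_nat M) (b + of_nat M) (1 + of_nat M) z) holomorphic_on hyp_domain"
    using b by (intro holomorphic_intros hyp2F1_reg_holomorphic) auto
  have "eventually (\<lambda>z. z \<in> ball (0::complex) 1) (nhds 0)"
    by (intro eventually_nhds_in_open) auto
  thus "eventually (\<lambda>z. pochhammer a M * pochhammer b M * z ^ M
           * hyp2F1_reg (a + of_nat M) (b + of_nat M) (1 + of_nat M) z
           = hyp2F1_reg a b (1 - of_nat M) z) (nhds 0)"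
  proof eventually_elim
    case (elim z)
    have "(\<lambda>k. pochhammer a M * pochhammer b M * z ^ M *
             (hyp2F1_coeff (a + of_nat M) (b + of_nat M) (1 + of_nat M) k * z ^ k))
            sums (pochhammer a M * pochhammer b M * z ^ M
              * hyp2F1_reg (a + of_nat M) (b + of_nat M) (1 + of_nat M) z)"
      using elim b by (intro sums_mult hyp2F1_reg_sums) auto
    moreover have "pochhammer a M * pochhammer b M * z ^ M *
             (hyp2F1_coeff (a + of_nat M) (b + of_nat M) (1 + of_nat M) k * z ^ k)
           = hyp2F1_coeff a b (1 - of_nat M) (k + M) * z ^ (k + M)" for k
      by (simp add: hyp2F1_coeff_shift power_add mult_ac)
    ultimately have 1: "(\<lambda>k. hyp2F1_coeff a b (1 - of_nat M) (k + M) * z ^ (k + M)) sums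
        (pochhammer a M * pochhammer b M * z ^ M
              * hyp2F1_reg (a + of_nat M) (b + of_nat M) (1 + of_nat M) z)" by simp
    have "hyp2F1_coeff a b (1 - of_nat M) k = 0" if "k < M" for k
    proof -
      have "1 - of_nat M + of_nat k = - (of_nat (M - Suc k) :: complex)"
        using that by (simp add: of_nat_diff)
      thus ?thesis by (simp add: hyp2F1_coeff_def rGamma_eq_zero_iff)
    qed
    hence "(\<Sum>k<M. hyp2F1_coeff a b (1 - of_nat M) k * z ^ k) = 0" by simp
    with sums_iff_shift'[of "\<lambda>k. hyp2F1_coeff a b (1 - of_nat M) k * z ^ k" M] 1
    have "(\<lambda>k. hyp2F1_coeff a b (1 - of_nat M) k * z ^ k) sums
        (pochhammer a M * pochhammer b M * z ^ M
              * hyp2F1_reg (a + of_nat M) (b + of_nat M) (1 + of_nat M) z)"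
      using sums_iff_shift[of "\<lambda>k. hyp2F1_coeff a b (1 - of_nat M) k * z ^ k" M] by simp
    moreover have "(\<lambda>k. hyp2F1_coeff a b (1 - of_nat M) k * z ^ k) sums hyp2F1_reg a b (1 - of_nat M) z"
      using elim b by (intro hyp2F1_reg_sums) auto
    ultimately show ?case by (rule sums_unique2)
  qed
qed (use b z ball_subset_hyp_domain hyp2F1_reg_holomorphic in auto)


section \<open>The hypergeometric equation and transformation formulas\<close>

text \<open>The differential equation is the coefficient recurrence in disguise. This is read in
  both directions: the recurrence yields the equation for \<open>hyp2F1_reg\<close>, and the
  equation yields the recurrence for an arbitrary solution.\<close>

lemma fps_hypergeometric_operator_nth:
  fixes F :: "complex fps"
  shows "fps_nth (fps_X * (1 - fps_X) * fps_deriv (fps_deriv F)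
      + (fps_const c - fps_const (a + b + 1) * fps_X) * fps_deriv F - fps_const (a * b) * F) k
    = of_nat (Suc k) * (c + of_nat k) * fps_nth F (Suc k) - (a + of_nat k) * (b + of_nat k) * fps_nth F k"
proof -
  have "fps_X * (1 - fps_X) * fps_deriv (fps_deriv F)
      + (fps_const c - fps_const (a + b + 1) * fps_X) * fps_deriv F - fps_const (a * b) * F
    = fps_X * fps_deriv (fps_deriv F) - fps_X * (fps_X * fps_deriv (fps_deriv F))
      + fps_const c * fps_deriv F - fps_const (a + b + 1) * (fps_X * fps_deriv F) - fps_const (a * b) * F"
    by (simp add: algebra_simps)
  also have "fps_nth \<dots> k = of_nat (Suc k) * (c + of_nat k) * fps_nth F (Suc k)
       - (a + of_nat k) * (b + of_nat k) * fps_nth F k"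
  proof (cases k)
    case (Suc j)
    thus ?thesis by (cases j) (simp_all add: algebra_simps)
  qed simp
  finally show ?thesis .
qed

lemma has_fps_expansion_hypergeometric_operator:
  assumes "f has_fps_expansion F"
  shows "(\<lambda>z. z * (1 - z) * deriv (deriv f) z + (c - (a + b + 1) * z) * deriv f z - a * b * f z)
    has_fps_expansion (fps_X * (1 - fps_X) * fps_deriv (fps_deriv F)
      + (fps_const c - fps_const (a + b + 1) * fps_X) * fps_deriv F - fps_const (a * b) * F)"
  by (intro fps_expansion_intros has_fps_expansion_mult has_fps_expansion_cmult_left assms)

lemma hyp2F1_reg_has_fps_expansion:
  assumes "b \<in> \<real>" "c \<in> \<real>"
  shows "hyp2F1_reg a b c has_fps_expansion Abs_fps (hyp2F1_coeff a b c)"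
proof (rule has_fps_expansionI)
  have "eventually (\<lambda>z. z \<in> ball (0::complex) 1) (nhds 0)"
    by (intro eventually_nhds_in_open) auto
  thus "\<forall>\<^sub>F u in nhds 0. (\<lambda>n. fps_nth (Abs_fps (hyp2F1_coeff a b c)) n * u ^ n) sums hyp2F1_reg a b c u"
    by eventually_elim (use assms hyp2F1_reg_sums in simp)
qed

lemma hyp2F1_reg_ode:
  assumes bc: "b \<in> \<real>" "c \<in> \<real>" and z: "z \<in> hyp_domain"
  shows "z * (1 - z) * deriv (deriv (hyp2F1_reg a b c)) z
     + (c - (a + b + 1) * z) * deriv (hyp2F1_reg a b c) z - a * b * hyp2F1_reg a b c z = 0"
proof -
  let ?f = "hyp2F1_reg a b c"
  let ?L = "\<lambda>z. z * (1 - z) * deriv (deriv ?f) z + (c - (a + b + 1) * z) * deriv ?f z - a * b * ?f z"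
  have h: "?f holomorphic_on hyp_domain" by (rule hyp2F1_reg_holomorphic[OF bc])
  have "?L has_fps_expansion (fps_X * (1 - fps_X) * fps_deriv (fps_deriv (Abs_fps (hyp2F1_coeff a b c)))
      + (fps_const c - fps_const (a + b + 1) * fps_X) * fps_deriv (Abs_fps (hyp2F1_coeff a b c))
        - fps_const (a * b) * (Abs_fps (hyp2F1_coeff a b c)))"
    by (intro has_fps_expansion_hypergeometric_operator hyp2F1_reg_has_fps_expansion bc)
  also have "\<dots> = 0"
    by (rule fps_ext) (simp only: fps_hypergeometric_operator_nth fps_nth_Abs_fps hyp2F1_coeff_Suc
          fps_zero_nth diff_self)
  finally have "?L has_fps_expansion 0" .
  hence ev: "eventually (\<lambda>z. ?L z = (\<lambda>_. 0) z) (nhds 0)"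
    unfolding has_fps_expansion_def by (auto elim: eventually_mono)
  show ?thesis
    by (rule holomorphic_eq_of_eventually_eq[OF open_hyp_domain connected_hyp_domain _ _ _ ev z])
       (use ball_subset_hyp_domain in \<open>auto intro!: holomorphic_intros h\<close>)
qed

text \<open>The recurrence can be solved for the next coefficient as no \<open>c + k\<close>
  vanishes, so a solution holomorphic at 0 is determined by its value there. The domain
  \<open>U\<close> is a parameter because the quadratic transformation lives on a half-plane
  only.\<close>

lemma hypergeometric_ode_unique:
  assumes bc: "b \<in> \<real>" "c \<in> \<real>" "c \<notin> \<int>\<^sub>\<le>\<^sub>0"
    and U: "open U" "connected U" "U \<subseteq> hyp_domain" "0 \<in> U"
    and f1: "\<And>z. z \<in> U \<Longrightarrow> (f has_field_derivative f1 z) (at z)"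
    and f2: "\<And>z. z \<in> U \<Longrightarrow> (f1 has_field_derivative f2 z) (at z)"
    and ode: "\<And>z. z \<in> U \<Longrightarrow> z * (1 - z) * f2 z + (c - (a + b + 1) * z) * f1 z - a * b * f z = 0"
    and z: "z \<in> U"
  shows "f z = f 0 * Gamma c * hyp2F1_reg a b c z"
proof -
  have fh: "f holomorphic_on U"
    using f1 U(1) by (auto simp: holomorphic_on_open)
  define F where "F = fps_expansion f 0"
  have F: "f has_fps_expansion F"
    unfolding F_def using U(1) U(4) fh by (rule has_fps_expansion_fps_expansion)
  have d1: "deriv f z = f1 z" if "z \<in> U" for z
    using f1[OF that] by (rule DERIV_imp_deriv)
  have d2: "deriv (deriv f) z = f2 z" if "z \<in> U" for z
  proof -
    have "eventually (\<lambda>w. w \<in> U) (nhds z)" by (rule eventually_nhds_in_open[OF U(1) that])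
    hence "eventually (\<lambda>w. deriv f w = f1 w) (nhds z)" by eventually_elim (rule d1)
    hence "deriv (deriv f) z = deriv f1 z" by (rule deriv_cong_ev) simp
    thus ?thesis using f2[OF that] DERIV_imp_deriv by metis
  qed
  let ?L = "\<lambda>z. z * (1 - z) * deriv (deriv f) z + (c - (a + b + 1) * z) * deriv f z - a * b * f z"
  have L0: "eventually (\<lambda>z. 0 = ?L z) (nhds 0)"
    using eventually_nhds_in_open[OF U(1) U(4)]
    by eventually_elim (use ode d1 d2 in simp)
  hence "?L has_fps_expansion 0"
    unfolding has_fps_expansion_def by simp
  with has_fps_expansion_hypergeometric_operator[OF F]
  have "fps_X * (1 - fps_X) * fps_deriv (fps_deriv F)
      + (fps_const c - fps_const (a + b + 1) * fps_X) * fps_deriv F - fps_const (a * b) * F = 0"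
    by (rule fps_expansion_unique_complex)
  hence rec: "of_nat (Suc k) * (c + of_nat k) * fps_nth F (Suc k) = (a + of_nat k) * (b + of_nat k) * fps_nth F k" for k
    using fps_hypergeometric_operator_nth[of F c a b k] by simp
  have c0: "c + of_nat k \<noteq> 0" for k
    using bc(3) plus_of_nat_eq_0_imp by blast
  have F0: "fps_nth F 0 = f 0"
    using F by (simp add: has_fps_expansion_imp_0_eq_fps_nth_0)
  have "Gamma c \<noteq> 0" using bc(3) by (simp add: Gamma_eq_zero_iff)
  have coeff: "fps_nth F k = f 0 * Gamma c * hyp2F1_coeff a b c k" for k
  proof (induction k)
    case 0
    show ?case using \<open>Gamma c \<noteq> 0\<close> by (simp add: F0 hyp2F1_coeff_def rGamma_inverse_Gamma)
  next
    case (Suc k)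
    have "of_nat (Suc k) * (c + of_nat k) * fps_nth F (Suc k)
        = of_nat (Suc k) * (c + of_nat k) * (f 0 * Gamma c * hyp2F1_coeff a b c (Suc k))"
      using rec[of k] hyp2F1_coeff_Suc[of k c a b] Suc by (simp del: of_nat_Suc add: mult_ac)
    thus ?case using c0[of k] by (simp del: of_nat_Suc)
  qed
  have "F = fps_const (f 0 * Gamma c) * Abs_fps (hyp2F1_coeff a b c)"
    by (rule fps_ext) (simp add: coeff)
  moreover have "(\<lambda>z. f 0 * Gamma c * hyp2F1_reg a b c z) has_fps_expansion
      fps_const (f 0 * Gamma c) * Abs_fps (hyp2F1_coeff a b c)"
    by (intro has_fps_expansion_cmult_left hyp2F1_reg_has_fps_expansion bc)
  ultimately have "(\<lambda>z. f 0 * Gamma c * hyp2F1_reg a b c z) has_fps_expansion F" by simp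
  hence "eventually (\<lambda>z. eval_fps F z = f 0 * Gamma c * hyp2F1_reg a b c z) (nhds 0)"
    by (simp add: has_fps_expansion_def)
  moreover have "eventually (\<lambda>z. eval_fps F z = f z) (nhds 0)"
    using F by (simp add: has_fps_expansion_def)
  ultimately have ev: "eventually (\<lambda>z. f z = f 0 * Gamma c * hyp2F1_reg a b c z) (nhds 0)"
    by eventually_elim simp
  show ?thesis
  proof (rule holomorphic_eq_of_eventually_eq[OF U(1,2,4) fh _ ev z])
    show "(\<lambda>z. f 0 * Gamma c * hyp2F1_reg a b c z) holomorphic_on U"
      using holomorphic_on_subset[OF hyp2F1_reg_holomorphic[OF bc(1,2)] U(3)]
      by (intro holomorphic_intros)
  qed
qed

section \<open>Euler's transformation and a quadratic transformation, by uniqueness for the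
  differential equation\<close>

lemma hyp2F1_reg_0:
  assumes "b \<in> \<real>" "c \<in> \<real>"
  shows "hyp2F1_reg a b c 0 = rGamma c"
proof -
  have "(\<lambda>k. hyp2F1_coeff a b c k * 0 ^ k) sums hyp2F1_reg a b c 0"
    using assms by (intro hyp2F1_reg_sums) auto
  moreover have "(\<lambda>k. hyp2F1_coeff a b c k * 0 ^ k) sums hyp2F1_coeff a b c 0"
    by (rule powser_sums_zero)
  ultimately have "hyp2F1_reg a b c 0 = hyp2F1_coeff a b c 0" by (rule sums_unique2)
  thus ?thesis by (simp add: hyp2F1_coeff_def)
qed

lemma hyp2F1_reg_DERIV:
  assumes "b \<in> \<real>" "c \<in> \<real>" "z \<in> hyp_domain"
  shows "(hyp2F1_reg a b c has_field_derivative deriv (hyp2F1_reg a b c) z) (at z)"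
    and "(deriv (hyp2F1_reg a b c) has_field_derivative deriv (deriv (hyp2F1_reg a b c)) z) (at z)"
  using hyp2F1_reg_holomorphic[OF assms(1,2)] assms(3)
  by (auto intro!: holomorphic_derivI[OF _ open_hyp_domain] holomorphic_deriv)

text \<open>With \<open>c - a - b\<close> a natural number the prefactor is a polynomial, so no
  choice of branch enters. The right-hand side solves the equation of the left-hand side, and both
  have the value \<open>rGamma c\<close> at 0.\<close>

lemma hyp2F1_reg_Euler_transformation:
  assumes ab: "a \<in> \<real>" "b \<in> \<real>" and c: "c \<notin> \<int>\<^sub>\<le>\<^sub>0" "c = a + b + of_nat M" and z: "z \<in> hyp_domain"
  shows "hyp2F1_reg a b c z = (1 - z) ^ M * hyp2F1_reg (c - a) (c - b) c z"
proof -
  define G where "G = hyp2F1_reg (c - a) (c - b) c"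
  define G1 where "G1 = deriv G"
  define G2 where "G2 = deriv G1"
  have cR: "c \<in> \<real>" "c - a \<in> \<real>" "c - b \<in> \<real>" using ab c(2) by auto
  have D: "(G has_field_derivative G1 z) (at z)" "(G1 has_field_derivative G2 z) (at z)"
    if "z \<in> hyp_domain" for z
    unfolding G2_def G1_def G_def using hyp2F1_reg_DERIV[OF cR(3,1) that] by auto
  define f where "f z = (1 - z) ^ M * G z" for z
  define f1 where "f1 z = (1 - z) ^ M * (G1 z - of_nat M * G z / (1 - z))" for z
  define f2 where "f2 z = (1 - z) ^ M * (G2 z - 2 * of_nat M * G1 z / (1 - z)
      + of_nat M * (of_nat M - 1) * G z / (1 - z)\<^sup>2)" for z
  have n1: "1 - z \<noteq> 0" if "z \<in> hyp_domain" for z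
    using that by (auto simp: hyp_domain_def)
  have pw: "((\<lambda>z. (1 - z) ^ M) has_field_derivative - of_nat M * (1 - z) ^ M / (1 - z)) (at z)"
    if "z \<in> hyp_domain" for z :: complex
  proof -
    have "((\<lambda>z. (1 - z) ^ M) has_field_derivative of_nat M * (- 1 * (1 - z) ^ (M - Suc 0))) (at z)"
      by (rule derivative_eq_intros refl | simp)+
    also have "of_nat M * (- 1 * (1 - z) ^ (M - Suc 0)) = - of_nat M * (1 - z) ^ M / (1 - z)"
      using n1[OF that] by (cases M) (simp_all del: of_nat_Suc)
    finally show ?thesis .
  qed
  have "f z = f 0 * Gamma c * hyp2F1_reg a b c z"
  proof (rule hypergeometric_ode_unique[of b c hyp_domain f f1 f2])
    fix z :: complex assume zd: "z \<in> hyp_domain"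
    note n = n1[OF zd]
    define p where "p = 1 - z"
    have p: "p \<noteq> 0" "z = 1 - p" using n by (auto simp: p_def)
    show "(f has_field_derivative f1 z) (at z)"
      unfolding f_def f1_def
      by (rule DERIV_cong, rule DERIV_mult[OF pw[OF zd] D(1)[OF zd]]) (use n in \<open>simp add: field_simps\<close>)
    have "((\<lambda>z. (1 - z) ^ M * (G1 z - of_nat M * G z / (1 - z))) has_field_derivative
       (- of_nat M * (1 - z) ^ M / (1 - z)) * (G1 z - of_nat M * G z / (1 - z))
        + (G2 z - (of_nat M * G1 z * (1 - z) + of_nat M * G z) / (1 - z)\<^sup>2) * (1 - z) ^ M) (at z)"
      by (rule DERIV_mult[OF pw[OF zd]])
         (rule derivative_eq_intros D zd refl | use n in \<open>simp add: power2_eq_square\<close>)+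
    also have "(- of_nat M * (1 - z) ^ M / (1 - z)) * (G1 z - of_nat M * G z / (1 - z))
        + (G2 z - (of_nat M * G1 z * (1 - z) + of_nat M * G z) / (1 - z)\<^sup>2) * (1 - z) ^ M = f2 z"
      unfolding f2_def p_def[symmetric] using p(1) by (simp add: field_simps power2_eq_square)
    finally show "(f1 has_field_derivative f2 z) (at z)"
      unfolding f1_def .
    have G_ode: "z * (1 - z) * G2 z + (c - ((c - a) + (c - b) + 1) * z) * G1 z - (c - a) * (c - b) * G z = 0"
      unfolding G2_def G1_def G_def by (rule hyp2F1_reg_ode[OF cR(3,1) zd])
    \<comment> \<open>The prefactor conjugates the operator with parameters \<open>a\<close>,
      \<open>b\<close> into the one with parameters \<open>c - a\<close>,
      \<open>c - b\<close>.\<close>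
    have "z * (1 - z) * f2 z + (c - (a + b + 1) * z) * f1 z - a * b * f z
       = p ^ M * (z * (1 - z) * G2 z + (c - ((c - a) + (c - b) + 1) * z) * G1 z - (c - a) * (c - b) * G z)"
      unfolding f2_def f1_def f_def p_def[symmetric] p(2) c(2) using p(1)
      by (simp add: field_simps power2_eq_square)
    thus "z * (1 - z) * f2 z + (c - (a + b + 1) * z) * f1 z - a * b * f z = 0"
      using G_ode by simp
  qed (use ab cR c z ball_subset_hyp_domain in auto)
  moreover have "f 0 = rGamma c"
    using cR by (simp add: f_def G_def hyp2F1_reg_0)
  ultimately show ?thesis
    using c(1) by (simp add: f_def G_def rGamma_inverse_Gamma Gamma_eq_zero_iff)
qed

text \<open>On the half-plane \<open>Re w < 1 / 2\<close> the base \<open>1 - 2 * w\<close> has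
  positive real part. This keeps the principal power holomorphic and the new argument off the cut.
  Pulling the equation for \<open>G\<close> back along \<open>y\<close> gives the equation in
  \<open>w\<close> precisely when \<open>c = (a + b + 1) / 2\<close>; at \<open>w = 0\<close> the
  prefactor is 1 and \<open>y\<close> is 0.\<close>

lemma hyp2F1_reg_quadratic_transformation:
  assumes ab: "a \<in> \<real>" "b \<in> \<real>" and c: "c \<notin> \<int>\<^sub>\<le>\<^sub>0" "c = (a + b + 1) / 2" and w: "Re w < 1 / 2"
  shows "hyp2F1_reg a b c w
     = (1 - 2 * w) powr (-a) * hyp2F1_reg (a / 2) ((a + 1) / 2) c (1 - 1 / (1 - 2 * w)\<^sup>2)"
proof -
  define G where "G = hyp2F1_reg (a / 2) ((a + 1) / 2) c"
  define G1 where "G1 = deriv G"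
  define G2 where "G2 = deriv G1"
  have "(a + b + 1) / 2 \<in> \<real>" "(a + 1) / 2 \<in> \<real>" using ab by auto
  hence cR: "c \<in> \<real>" "(a + 1) / 2 \<in> \<real>" unfolding c(2) by simp_all
  have D: "(G has_field_derivative G1 z) (at z)" "(G1 has_field_derivative G2 z) (at z)"
    if "z \<in> hyp_domain" for z
    unfolding G2_def G1_def G_def using hyp2F1_reg_DERIV[OF cR(2,1) that] by auto
  define U where "U = {w. Re w < 1 / 2}"
  define y where "y w = 1 - 1 / (1 - 2 * w)\<^sup>2" for w :: complex
  define P where "P w = (1 - 2 * w) powr (-a)" for w
  define f where "f w = P w * G (y w)" for w
  define f1 where "f1 w = P w * (2 * a * G (y w) / (1 - 2 * w) - 4 * G1 (y w) / (1 - 2 * w) ^ 3)" for w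
  define f2 where "f2 w = P w * (4 * a * (a + 1) * G (y w) / (1 - 2 * w)\<^sup>2
     - 8 * (2 * a + 3) * G1 (y w) / (1 - 2 * w) ^ 4 + 16 * G2 (y w) / (1 - 2 * w) ^ 6)" for w
  have pos: "Re (1 - 2 * w) > 0" if "w \<in> U" for w using that by (simp add: U_def)
  have n1: "1 - 2 * w \<noteq> 0" if "w \<in> U" for w using pos[OF that] by (metis zero_complex.simps(1) less_irrefl)
  have nn: "1 - 2 * w \<notin> \<real>\<^sub>\<le>\<^sub>0" if "w \<in> U" for w using pos[OF that] by (auto simp: complex_nonpos_Reals_iff)
  \<comment> \<open>If \<open>y w\<close> were real and at least 1, then
    \<open>q\<^sup>2 \<le> 0\<close> for \<open>q = 1 / (1 - 2 w)\<close>, which is impossible with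
    \<open>Re q > 0\<close>.\<close>
  have yd: "y w \<in> hyp_domain" if "w \<in> U" for w
  proof (rule ccontr)
    assume "y w \<notin> hyp_domain"
    define q where "q = inverse (1 - 2 * w)"
    have q: "Re q > 0"
    proof -
      have "Re q = Re (1 - 2 * w) / ((Re (1 - 2 * w))\<^sup>2 + (Im (1 - 2 * w))\<^sup>2)"
        unfolding q_def by (rule inverse_complex.simps)
      thus ?thesis using pos[OF that] by (auto intro!: divide_pos_pos add_pos_nonneg)
    qed
    have "1 / (1 - 2 * w)\<^sup>2 = q\<^sup>2" by (simp add: q_def divide_inverse power_inverse)
    hence "Im (q\<^sup>2) = 0" "Re (q\<^sup>2) \<le> 0"
      using \<open>y w \<notin> hyp_domain\<close> by (auto simp: y_def hyp_domain_def)
    moreover from this(1) q have "Im q = 0" by (simp add: power2_eq_square)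
    ultimately show False using q by (simp add: power2_eq_square mult_le_0_iff)
  qed
  have DP: "(P has_field_derivative 2 * a * P w / (1 - 2 * w)) (at w)" if "w \<in> U" for w
  proof -
    have "(P has_field_derivative (-a) * (1 - 2 * w) powr (-a - 1) * (-2)) (at w)"
      unfolding P_def by (rule derivative_eq_intros refl nn that | simp)+
    thus ?thesis using n1[OF that] by (simp add: P_def powr_diff mult_ac)
  qed
  have r1: "((\<lambda>w. 1 / (1 - 2 * w)) has_field_derivative 2 / (1 - 2 * w)\<^sup>2) (at w)" if "w \<in> U" for w
    using n1[OF that] by (auto intro!: derivative_eq_intros simp: power2_eq_square)
  have Dy: "(y has_field_derivative - 4 / (1 - 2 * w) ^ 3) (at w)" if "w \<in> U" for w
  proof -
    have "((\<lambda>w. 1 - (1 / (1 - 2 * w))\<^sup>2) has_field_derivative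
        0 - of_nat 2 * (2 / (1 - 2 * w)\<^sup>2 * (1 / (1 - 2 * w)) ^ (2 - Suc 0))) (at w)"
      by (intro DERIV_diff DERIV_const DERIV_power r1 that)
    also have "0 - of_nat 2 * (2 / (1 - 2 * w)\<^sup>2 * (1 / (1 - 2 * w)) ^ (2 - Suc 0)) = - 4 / (1 - 2 * w) ^ 3"
      by (simp add: power2_eq_square power3_eq_cube)
    finally show ?thesis unfolding y_def by (simp add: power_one_over)
  qed
  have DG: "((\<lambda>w. G (y w)) has_field_derivative G1 (y w) * (- 4 / (1 - 2 * w) ^ 3)) (at w)"
     "((\<lambda>w. G1 (y w)) has_field_derivative G2 (y w) * (- 4 / (1 - 2 * w) ^ 3)) (at w)" if "w \<in> U" for w
    using DERIV_chain2[OF D(1)[OF yd[OF that]] Dy[OF that]] DERIV_chain2[OF D(2)[OF yd[OF that]] Dy[OF that]] .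
  have "f w = f 0 * Gamma c * hyp2F1_reg a b c w"
  proof (rule hypergeometric_ode_unique[of b c U f f1 f2])
    fix w :: complex assume wU: "w \<in> U"
    note n = n1[OF wU]
    define p where "p = 1 - 2 * w"
    have p: "p \<noteq> 0" "w = (1 - p) / 2" using n by (auto simp: p_def)
    show "(f has_field_derivative f1 w) (at w)"
      unfolding f_def f1_def
      by (rule DERIV_cong, rule DERIV_mult[OF DP[OF wU] DG(1)[OF wU]]) (use n in \<open>simp add: algebra_simps\<close>)
    have r3: "((\<lambda>w. 1 / (1 - 2 * w) ^ 3) has_field_derivative 6 / (1 - 2 * w) ^ 4) (at w)"
      using DERIV_power[OF r1[OF wU], of 3]
      by (simp add: power_one_over[symmetric]) (simp add: power_numeral_reduce mult_ac)
    have "((\<lambda>w. P w * ((2 * a) * (G (y w) * (1 / (1 - 2 * w))) - 4 * (G1 (y w) * (1 / (1 - 2 * w) ^ 3))))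
        has_field_derivative
        (2 * a * P w / p) * ((2 * a) * (G (y w) * (1 / p)) - 4 * (G1 (y w) * (1 / p ^ 3)))
       + ((2 * a) * ((G1 (y w) * (- 4 / p ^ 3)) * (1 / p) + (2 / p\<^sup>2) * G (y w))
         - 4 * ((G2 (y w) * (- 4 / p ^ 3)) * (1 / p ^ 3) + (6 / p ^ 4) * G1 (y w))) * P w) (at w)"
      unfolding p_def
      by (intro DERIV_mult DERIV_diff DERIV_cmult DP DG r1 r3 wU)
    also have "(2 * a * P w / p) * ((2 * a) * (G (y w) * (1 / p)) - 4 * (G1 (y w) * (1 / p ^ 3)))
       + ((2 * a) * ((G1 (y w) * (- 4 / p ^ 3)) * (1 / p) + (2 / p\<^sup>2) * G (y w))
         - 4 * ((G2 (y w) * (- 4 / p ^ 3)) * (1 / p ^ 3) + (6 / p ^ 4) * G1 (y w))) * P w = f2 w"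
      unfolding f2_def p_def[symmetric] using p(1)
      by (simp add: field_simps power_numeral_reduce)
    also have "(\<lambda>w. P w * ((2 * a) * (G (y w) * (1 / (1 - 2 * w))) - 4 * (G1 (y w) * (1 / (1 - 2 * w) ^ 3)))) = f1"
      by (simp add: f1_def fun_eq_iff)
    finally show "(f1 has_field_derivative f2 w) (at w)" .
    have G_ode: "y w * (1 - y w) * G2 (y w) + (c - (a / 2 + (a + 1) / 2 + 1) * y w) * G1 (y w)
        - (a / 2) * ((a + 1) / 2) * G (y w) = 0"
      unfolding G2_def G1_def G_def by (rule hyp2F1_reg_ode[OF cR(2,1) yd[OF wU]])
    have yw: "y w = 1 - 1 / p\<^sup>2" by (simp add: y_def p_def)
    have "2 * c = a + b + 1" unfolding c(2) by simp
    hence b: "b = 2 * c - a - 1" by algebra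
    have "w * (1 - w) * f2 w + (c - (a + b + 1) * w) * f1 w - a * b * f w
       = - 4 * P w / p\<^sup>2 * (y w * (1 - y w) * G2 (y w) + (c - (a / 2 + (a + 1) / 2 + 1) * y w) * G1 (y w)
        - (a / 2) * ((a + 1) / 2) * G (y w))"
    proof -
      define g g1 g2 Q where "g = G (y w)" and "g1 = G1 (y w)" and "g2 = G2 (y w)" and "Q = P w"
      have w1: "w * (1 - w) = (1 - p\<^sup>2) / 4" and w2: "c - (a + b + 1) * w = c * p"
        unfolding b p(2) by (simp_all add: field_simps power2_eq_square)
      show ?thesis
        unfolding f2_def f1_def f_def p_def[symmetric] g_def[symmetric] g1_def[symmetric]
          g2_def[symmetric] Q_def[symmetric] w1 w2
        unfolding yw b using p(1)
        by (simp add: field_simps power_numeral_reduce)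
    qed
    thus "w * (1 - w) * f2 w + (c - (a + b + 1) * w) * f1 w - a * b * f w = 0"
      using G_ode by simp
  next
    show "open U" unfolding U_def by (rule open_halfspace_Re_lt)
    have "convex U" unfolding U_def by (rule convex_halfspace_Re_lt)
    thus "connected U" by (rule convex_connected)
    show "U \<subseteq> hyp_domain" by (auto simp: U_def hyp_domain_def)
  qed (use ab cR(1) c(1) w in \<open>auto simp: U_def\<close>)
  moreover have "f 0 = rGamma c"
    using cR by (simp add: f_def G_def P_def y_def hyp2F1_reg_0)
  ultimately show ?thesis
    using c(1) by (simp add: f_def G_def P_def y_def rGamma_inverse_Gamma Gamma_eq_zero_iff)
qed


section \<open>Factorization of Appell's double series\<close>

text \<open>Coefficient of \<open>x\<^sup>k y\<^sup>j\<close> in Appell's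
  \<open>F\<^sub>4(a, b; m + 1, n + 1; x, y)\<close> divided by \<open>m! n!\<close>, the
  two-variable analogue of the regularization. In the same way \<open>gauss_coeff\<close> belongs to
  the Gauss series with lower parameter \<open>m + 1\<close>, divided by \<open>m!\<close>.\<close>

definition appell_coeff :: "real \<Rightarrow> real \<Rightarrow> nat \<Rightarrow> nat \<Rightarrow> nat \<Rightarrow> nat \<Rightarrow> real" where
  "appell_coeff a b m n k j = pochhammer a (k + j) * pochhammer b (k + j)
     / (fact k * fact (m + k) * fact j * fact (n + j))"

definition gauss_coeff :: "real \<Rightarrow> real \<Rightarrow> nat \<Rightarrow> nat \<Rightarrow> real" where
  "gauss_coeff a b m k = pochhammer a k * pochhammer b k / (fact k * fact (m + k))"

lemma appell_coeff_nonneg: "a > 0 \<Longrightarrow> b > 0 \<Longrightarrow> appell_coeff a b m n k j \<ge> 0"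
  unfolding appell_coeff_def
  by (intro divide_nonneg_nonneg mult_nonneg_nonneg pochhammer_nonneg) auto

lemma gauss_coeff_nonneg: "a > 0 \<Longrightarrow> b > 0 \<Longrightarrow> gauss_coeff a b m k \<ge> 0"
  unfolding gauss_coeff_def
  by (intro divide_nonneg_nonneg mult_nonneg_nonneg pochhammer_nonneg) auto

lemma appell_coeff_Suc1:
  "real (Suc k) * (real (Suc k) + real m) * appell_coeff a b m n (Suc k) j
     = (real (k + j) + a) * (real (k + j) + b) * appell_coeff a b m n k j"
proof -
  have "fact (Suc k) = real (Suc k) * fact k" "fact (m + Suc k) = (real (Suc k) + real m) * fact (m + k)"
    by (simp_all add: algebra_simps)
  moreover have "real (Suc k) + real m \<noteq> 0" by linarith
  ultimately show ?thesis
    by (simp add: appell_coeff_def pochhammer_Suc divide_simps del: of_nat_Suc fact_Suc)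
       (simp add: algebra_simps)
qed

lemma appell_coeff_Suc2:
  "real (Suc j) * (real (Suc j) + real n) * appell_coeff a b m n k (Suc j)
     = (real (k + j) + a) * (real (k + j) + b) * appell_coeff a b m n k j"
proof -
  have "fact (Suc j) = real (Suc j) * fact j" "fact (n + Suc j) = (real (Suc j) + real n) * fact (n + j)"
    by (simp_all add: algebra_simps)
  moreover have "real (Suc j) + real n \<noteq> 0" by linarith
  ultimately show ?thesis
    by (simp add: appell_coeff_def pochhammer_Suc divide_simps del: of_nat_Suc fact_Suc)
       (simp add: algebra_simps)
qed

lemma gauss_coeff_Suc:
  "real (Suc k) * (real (Suc k) + real m) * gauss_coeff a b m (Suc k)
     = (real k + a) * (real k + b) * gauss_coeff a b m k"
proof -
  have "fact (Suc k) = real (Suc k) * fact k" "fact (m + Suc k) = (real (Suc k) + real m) * fact (m + k)"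
    by (simp_all add: algebra_simps)
  moreover have "real (Suc k) + real m \<noteq> 0" by linarith
  ultimately show ?thesis
    by (simp add: gauss_coeff_def pochhammer_Suc divide_simps del: of_nat_Suc fact_Suc)
       (simp add: algebra_simps)
qed

section \<open>Growth of the coefficients and the region of convergence\<close>

lemma pochhammer_le_fact_power:
  fixes a :: real
  assumes "0 \<le> a" "a \<le> real d"
  shows "pochhammer a N \<le> fact N * real (N + 1) ^ d"
proof (induction N)
  case (Suc N)
  \<comment> \<open>Bernoulli's inequality carries the induction. Any polynomial bound on
    \<open>pochhammer a N / fact N\<close> is good enough, as it will be dominated by a geometric
    factor.\<close>
  have "1 + real d * (1 / real (N + 1)) \<le> (1 + 1 / real (N + 1)) ^ d"
    by (rule Bernoulli_inequality) (simp add: field_simps)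
  hence "real (N + 1 + d) / real (N + 1) \<le> (real (N + 2) / real (N + 1)) ^ d"
    by (simp add: field_simps)
  hence B: "(real (N + 1) + real d) * real (N + 1) ^ d \<le> real (N + 1) * real (N + 2) ^ d"
    by (simp add: power_divide field_simps)
  have "pochhammer a (Suc N) = pochhammer a N * (a + real N)"
    by (simp add: pochhammer_Suc)
  also have "\<dots> \<le> (fact N * real (N + 1) ^ d) * (real (N + 1) + real d)"
    using Suc assms by (intro mult_mono) auto
  also have "\<dots> \<le> fact N * (real (N + 1) * real (N + 2) ^ d)"
    using B by (simp add: mult_ac)
  also have "\<dots> = fact (Suc N) * real (Suc N + 1) ^ d" by (simp add: mult_ac)
  finally show ?case .
qed simp

lemma appell_coeff_le:
  assumes ab: "a > 0" "b > 0" "a \<le> real d" "b \<le> real d"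
  shows "appell_coeff a b m n k j \<le> real (k + j + 1) ^ (2 * d) * real ((k + j) choose k) ^ 2"
proof -
  have "appell_coeff a b m n k j \<le> (fact (k + j) * real (k + j + 1) ^ d) * (fact (k + j) * real (k + j + 1) ^ d)
      / (fact k * fact k * fact j * fact j)"
    unfolding appell_coeff_def using ab
    by (intro frac_le mult_mono pochhammer_le_fact_power fact_mono mult_nonneg_nonneg pochhammer_nonneg) auto
  also have "\<dots> = real (k + j + 1) ^ (2 * d) * (fact (k + j) / (fact k * fact j)) ^ 2"
    by (simp add: power2_eq_square power_mult field_simps power_mult_distrib)
  also have "fact (k + j) / (fact k * fact j) = real ((k + j) choose k)"
    by (subst binomial_fact) auto
  finally show ?thesis .
qed

lemma gauss_coeff_le:
  assumes ab: "a > 0" "b > 0" "a \<le> real d" "b \<le> real d"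
  shows "gauss_coeff a b m k \<le> real (k + 1) ^ (2 * d)"
proof -
  have "gauss_coeff a b m k \<le> (fact k * real (k + 1) ^ d) * (fact k * real (k + 1) ^ d) / (fact k * fact k)"
    unfolding gauss_coeff_def using ab
    by (intro frac_le mult_mono pochhammer_le_fact_power fact_mono mult_nonneg_nonneg pochhammer_nonneg) auto
  also have "\<dots> = real (k + 1) ^ (2 * d)"
    by (simp add: power2_eq_square power_mult power_mult_distrib)
  finally show ?thesis .
qed

lemma summable_poly_times_geometric:
  assumes "0 \<le> r" "r < (1::real)"
  shows "summable (\<lambda>N. real (N + 1) ^ D * r ^ N)"
proof -
  obtain s where s: "r < s" "s < 1" using assms dense by blast
  have "(\<lambda>N. (1 + 1 / real (Suc N)) ^ D * r) \<longlonglongrightarrow> (1 + 0) ^ D * r"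
    by (intro tendsto_intros LIMSEQ_Suc[OF lim_const_over_n])
  hence "eventually (\<lambda>N. (1 + 1 / real (Suc N)) ^ D * r < s) sequentially"
    using s by (intro order_tendstoD) auto
  then obtain M where M: "\<And>N. N \<ge> M \<Longrightarrow> (1 + 1 / real (Suc N)) ^ D * r < s"
    by (auto simp: eventually_sequentially)
  show ?thesis
  proof (rule summable_ratio_test[of s M])
    fix N assume "N \<ge> M"
    have "real (Suc N + 1) = (1 + 1 / real (Suc N)) * real (N + 1)"
      by (simp add: field_simps)
    hence "real (Suc N + 1) ^ D * r ^ Suc N = ((1 + 1 / real (Suc N)) ^ D * r) * (real (N + 1) ^ D * r ^ N)"
      by (simp only: power_mult_distrib power_Suc mult_ac)
    also have "\<dots> \<le> s * (real (N + 1) ^ D * r ^ N)"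
      using M[OF \<open>N \<ge> M\<close>] assms by (intro mult_right_mono) auto
    finally show "norm (real (Suc N + 1) ^ D * r ^ Suc N) \<le> s * norm (real (N + 1) ^ D * r ^ N)"
      using assms by simp
  qed (use s in auto)
qed

text \<open>For nonnegative numbers the sum of the squares is at most the square of the sum, and
  that sum is a binomial expansion in \<open>sqrt x\<close> and \<open>sqrt y\<close>. The square
  roots in the convergence condition come from here.\<close>

lemma sum_binomial_square_le:
  fixes x y :: real
  assumes "x \<ge> 0" "y \<ge> 0"
  shows "(\<Sum>k\<le>N. real (N choose k) ^ 2 * x ^ k * y ^ (N - k)) \<le> ((sqrt x + sqrt y) ^ 2) ^ N"
proof -
  have "(\<Sum>k\<le>N. real (N choose k) ^ 2 * x ^ k * y ^ (N - k))
      = (\<Sum>k\<le>N. (real (N choose k) * sqrt x ^ k * sqrt y ^ (N - k)) ^ 2)"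
    using assms by (intro sum.cong refl) (simp add: power_mult_distrib power_mult[symmetric] mult.commute[of _ 2] power_mult)
  also have "\<dots> \<le> (\<Sum>k\<le>N. real (N choose k) * sqrt x ^ k * sqrt y ^ (N - k)) ^ 2"
  proof -
    let ?f = "\<lambda>k. real (N choose k) * sqrt x ^ k * sqrt y ^ (N - k)"
    have "L2_set ?f {..N} ^ 2 \<le> sum ?f {..N} ^ 2"
      using assms by (intro power_mono L2_set_le_sum) auto
    thus ?thesis by (simp add: L2_set_def sum_nonneg)
  qed
  also have "(\<Sum>k\<le>N. real (N choose k) * sqrt x ^ k * sqrt y ^ (N - k)) = (sqrt x + sqrt y) ^ N"
    by (simp add: binomial_ring)
  finally show ?thesis by (simp add: power_mult[symmetric] mult.commute)
qed


section \<open>The hypergeometric operator acting on polynomials\<close>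

definition euler_op :: "complex poly \<Rightarrow> complex poly" where
  "euler_op p = [:0, 1:] * pderiv p"

text \<open>Expanded form of
  \<open>\<theta> (\<theta> + m) - x (\<theta> + a) (\<theta> + b)\<close> with
  \<open>\<theta> = x d/dx\<close>, that is, \<open>x\<close> times the hypergeometric operator with
  \<open>c = m + 1\<close>. Working on polynomials keeps the algebra of the double series apart from
  its convergence.\<close>

definition gauss_op :: "complex \<Rightarrow> complex \<Rightarrow> nat \<Rightarrow> complex poly \<Rightarrow> complex poly" where
  "gauss_op a b m p = euler_op (euler_op p) - [:0, 1:] * euler_op (euler_op p)
     + smult (of_nat m) (euler_op p) - smult (a + b) ([:0, 1:] * euler_op p) - smult (a * b) ([:0, 1:] * p)"

lemma coeff_euler_op: "coeff (euler_op p) k = of_nat k * coeff p k"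
  by (cases k) (auto simp: euler_op_def coeff_pderiv)

lemma coeff_gauss_op_Suc:
  "coeff (gauss_op a b m p) (Suc k) = of_nat (Suc k) * (of_nat (Suc k) + of_nat m) * coeff p (Suc k)
      - (of_nat k + a) * (of_nat k + b) * coeff p k"
  by (simp add: gauss_op_def coeff_euler_op algebra_simps)

lemma euler_op_add: "euler_op (p + q) = euler_op p + euler_op q"
  and euler_op_smult: "euler_op (smult c p) = smult c (euler_op p)"
  and euler_op_0: "euler_op 0 = 0"
  by (simp_all add: euler_op_def pderiv_add pderiv_smult algebra_simps)

lemma euler_op_mult: "euler_op (p * q) = euler_op p * q + p * euler_op q"
  by (simp add: euler_op_def pderiv_mult algebra_simps)

lemma euler_op_const: "euler_op [:c:] = 0"
  by (simp add: euler_op_def)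

lemma euler_op_power: "euler_op (p ^ Suc k) = of_nat (Suc k) * p ^ k * euler_op p"
  by (induction k) (simp_all add: euler_op_mult algebra_simps)

lemma gauss_op_add: "gauss_op a b m (p + q) = gauss_op a b m p + gauss_op a b m q"
  by (simp add: gauss_op_def euler_op_add smult_add_right distrib_left del: mult_pCons_left)

lemma gauss_op_smult: "gauss_op a b m (smult c p) = smult c (gauss_op a b m p)"
  by (simp add: gauss_op_def euler_op_smult smult_add_right smult_diff_right mult.commute del: mult_pCons_left)

lemma gauss_op_0: "gauss_op a b m 0 = 0"
  by (simp add: gauss_op_def euler_op_0)

lemma gauss_op_sum: "gauss_op a b m (sum f A) = (\<Sum>i\<in>A. gauss_op a b m (f i))"
  by (induction A rule: infinite_finite_induct) (simp_all add: gauss_op_add gauss_op_0)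

text \<open>Everything follows from \<open>\<theta> u = u\<close>, \<open>\<theta> v = - x y\<close>
  and \<open>v = y (1 - x)\<close>. Bailey's condition enters where the coefficient
  \<open>j + a + b - m - 1\<close> becomes \<open>j + n\<close>, which restores the symmetry between
  the two indices.\<close>

lemma gauss_op_monomial:
  fixes y :: complex
  defines "u \<equiv> [:0, 1 - y:]" and "v \<equiv> [:y, - y:]"
  assumes ab: "a + b = of_nat m + of_nat n + 1"
  shows "gauss_op a b m (u ^ k * v ^ j) = of_nat (k * (k + m)) * u ^ k * v ^ j
     + of_nat (j * (j + n)) * [:0, y:] * u ^ k * v ^ (j - 1)
     - [:(of_nat (k + j) + a) * (of_nat (k + j) + b):] * [:0, 1:] * u ^ k * v ^ j"
proof -
  define x :: "complex poly" where "x = [:0, 1:]"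
  define Y where "Y = [:y:]"
  have u: "u = x * (1 - Y)" and v: "v = Y * (1 - x)" and xy: "[:0, y:] = x * Y"
    by (simp_all add: u_def v_def x_def Y_def one_pCons)
  have Ex: "euler_op x = x" by (simp add: euler_op_def x_def pderiv_pCons)
  have EY: "euler_op Y = 0" by (simp add: Y_def euler_op_const)
  have E1: "euler_op 1 = 0" by (simp add: one_pCons euler_op_const)
  have Em: "euler_op (p - q) = euler_op p - euler_op q" for p q
    by (simp add: euler_op_def pderiv_diff algebra_simps)
  have En: "euler_op (of_nat i * p) = of_nat i * euler_op p" for i p
    by (simp add: of_nat_poly euler_op_smult)
  have Ek: "euler_op (of_nat i) = 0" for i
    by (simp add: of_nat_poly euler_op_const)
  have Eu1: "euler_op u = u"
    by (simp add: u euler_op_mult Em Ex EY E1)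
  have Eu: "euler_op (u ^ k) = of_nat k * u ^ k"
  proof (cases k)
    case (Suc i)
    show ?thesis unfolding Suc euler_op_power Eu1 by (simp add: mult_ac)
  qed (simp add: E1)
  have Ev1: "euler_op v = - (x * Y)"
    by (simp add: v euler_op_mult Em Ex EY E1)
  have Exy: "euler_op (x * Y) = x * Y" by (simp add: euler_op_mult Ex EY)
  have Euv0: "euler_op (u ^ k * v ^ 0) = of_nat k * u ^ k" by (simp add: Eu)
  have EuvS: "euler_op (u ^ k * v ^ Suc i) = of_nat k * u ^ k * v ^ Suc i
        - of_nat (Suc i) * (x * Y * (u ^ k * v ^ i))" for i
    by (simp only: euler_op_mult Eu euler_op_power Ev1) (simp add: algebra_simps)
  define A B where "A = [:a:]" and "B = [:b:]"
  have C: "[:(of_nat (k + j) + a) * (of_nat (k + j) + b):] = (of_nat k + of_nat j + A) * (of_nat k + of_nat j + B)"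
    by (simp add: A_def B_def of_nat_poly)
  have n: "(of_nat n :: complex poly) = A + B - of_nat m - 1"
  proof -
    have "of_nat n = a + b - of_nat m - 1" using ab by simp
    thus ?thesis by (simp add: A_def B_def of_nat_poly one_pCons)
  qed
  have L: "gauss_op a b m p = (1 - x) * euler_op (euler_op p)
     + (of_nat m - (A + B) * x) * euler_op p - A * B * x * p" for p
  proof -
    have "of_nat m * q = smult (of_nat m) q" "(A + B) * q = smult (a + b) q" "A * B * q = smult (a * b) q" for q
      by (simp_all add: of_nat_poly A_def B_def mult.commute)
    hence "gauss_op a b m p = euler_op (euler_op p) - x * euler_op (euler_op p)
        + of_nat m * euler_op p - (A + B) * (x * euler_op p) - A * B * (x * p)"
      by (simp only: gauss_op_def x_def)
    thus ?thesis by (simp add: algebra_simps)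
  qed
  show ?thesis
  proof (cases j)
    case 0
    show ?thesis unfolding 0 L Euv0 C[unfolded 0] xy x_def[symmetric]
      by (simp add: En Eu) (simp add: algebra_simps)
  next
    case (Suc i)
    define U V Z where "U = u ^ k" and "V = v ^ i" and "Z = v ^ (i - 1)"
    define K I where "K = (of_nat k :: complex poly)" and "I = (of_nat i :: complex poly)"
    \<comment> \<open>For \<open>i = 0\<close> the truncated exponent in \<open>Z\<close> is
      harmless, as the factor \<open>I\<close> vanishes.\<close>
    define T where "T = I * (x * Y * (U * Z))"
    have F: "u ^ k * v ^ j = U * (v * V)" by (simp add: U_def V_def Suc)
    have EF: "euler_op (U * (v * V)) = K * (U * (v * V)) - (1 + I) * (x * Y * (U * V))"
      using EuvS[of i] by (simp add: U_def V_def K_def I_def mult.assoc)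
    have EV: "euler_op (U * V) = K * (U * V) - T"
    proof (cases i)
      case 0
      thus ?thesis by (simp add: U_def V_def T_def I_def K_def Eu)
    next
      case (Suc l)
      thus ?thesis using EuvS[of l] by (simp add: U_def V_def T_def I_def K_def Z_def mult.assoc)
    qed
    have I': "1 + I = of_nat (Suc i)" by (simp add: I_def)
    have EE: "euler_op (K * (U * (v * V)) - (1 + I) * (x * Y * (U * V))) = (K * (K * (U * (v * V)) - (1 + I) * (x * Y * (U * V)))
        - (1 + I) * (x * Y * (U * V) + x * Y * (K * (U * V)))) + (1 + I) * (x * Y) * T"
    proof -
      have "euler_op (K * (U * (v * V)) - (1 + I) * (x * Y * (U * V)))
         = K * euler_op (U * (v * V)) - (1 + I) * (x * Y * (U * V) + x * Y * euler_op (U * V))"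
        unfolding K_def I' Em En euler_op_mult[of "x * Y"] Exy ..
      thus ?thesis by (simp only: EF EV) (simp add: algebra_simps)
    qed
    \<comment> \<open>The second application of \<open>\<theta>\<close> lowers the power of
      \<open>v\<close> once too often; the factor \<open>1 - x\<close> in front of
      \<open>\<theta>\<^sup>2\<close>, together with the \<open>y\<close> in \<open>T\<close>, gives
      back the missing \<open>v\<close>.\<close>
    have T: "(1 - x) * T = I * x * (U * V)"
    proof (cases i)
      case (Suc l)
      thus ?thesis by (simp add: T_def V_def Z_def v mult_ac)
    qed (simp add: T_def I_def)
    have "(1 - x) * (p + (1 + I) * (x * Y) * T) = (1 - x) * p + (1 + I) * (x * Y) * ((1 - x) * T)" for p
      by (simp only: distrib_left mult_ac)
    hence "gauss_op a b m (U * (v * V)) = (1 - x) * (K * (K * (U * (v * V)) - (1 + I) * (x * Y * (U * V)))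
        - (1 + I) * (x * Y * (U * V) + x * Y * (K * (U * V)))) + (1 + I) * (x * Y) * (I * x * (U * V))
        + (of_nat m - (A + B) * x) * (K * (U * (v * V)) - (1 + I) * (x * Y * (U * V))) - A * B * x * (U * (v * V))"
      by (simp only: L EE T EF)
    also have "\<dots> = K * (K + of_nat m) * (U * (v * V)) + (1 + I) * (1 + I + (A + B - of_nat m - 1)) * (x * Y) * (U * V)
         - ((K + (1 + I) + A) * (K + (1 + I) + B)) * x * (U * (v * V))"
      by (simp add: v) (simp add: algebra_simps)
    also have "\<dots> = of_nat (k * (k + m)) * u ^ k * v ^ j
     + of_nat (j * (j + n)) * [:0, y:] * u ^ k * v ^ (j - 1)
     - [:(of_nat (k + j) + a) * (of_nat (k + j) + b):] * [:0, 1:] * u ^ k * v ^ j"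
      by (simp only: C[unfolded Suc of_nat_add] xy x_def[symmetric] of_nat_mult of_nat_add n[symmetric]
          K_def I' Suc U_def V_def mult.assoc diff_Suc_1 power_Suc)
    finally show ?thesis by (simp only: F)
  qed
qed

lemma smult_sum_right: "smult c (sum f A) = (\<Sum>i\<in>A. smult c (f i))"
  by (induction A rule: infinite_finite_induct) (simp_all add: smult_add_right)

definition appell_layer :: "real \<Rightarrow> real \<Rightarrow> nat \<Rightarrow> nat \<Rightarrow> complex \<Rightarrow> nat \<Rightarrow> complex poly" where
  "appell_layer a b m n y N =
     (\<Sum>k\<le>N. smult (of_real (appell_coeff a b m n k (N - k))) ([:0, 1 - y:] ^ k * [:y, - y:] ^ (N - k)))"

text \<open>
  With \<open>u = x (1 - y)\<close> and \<open>v = y (1 - x)\<close> as polynomials in \<open>x\<close>, the homogeneous layers of the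
  double series telescope under the hypergeometric operator in \<open>x\<close>, because \<open>u + x y = x\<close>. Hence the
  full sum satisfies the hypergeometric equation in \<open>x\<close>.
\<close>

lemma gauss_op_appell_layer:
  fixes y :: complex and a b :: real
  assumes ab: "a + b = real m + real n + 1"
  defines "q \<equiv> \<lambda>N. complex_of_real ((real N + a) * (real N + b))"
  shows "gauss_op a b m (appell_layer a b m n y N) = [:0, 1:] *
     ((if N = 0 then 0 else smult (q (N - 1)) (appell_layer a b m n y (N - 1)))
       - smult (q N) (appell_layer a b m n y N))"
proof -
  define u v where "u = [:0, 1 - y:]" and "v = [:y, - y:]"
  define A where "A k j = complex_of_real (appell_coeff a b m n k j)" for k j
  define T1 where "T1 N = (\<Sum>k\<le>N. smult (of_nat (k * (k + m)) * A k (N - k)) (u ^ k * v ^ (N - k)))" for N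
  define T2 where "T2 N = (\<Sum>k\<le>N. smult (of_nat ((N - k) * (N - k + n)) * A k (N - k)) (u ^ k * v ^ (N - k - 1)))" for N
  define S where "S = appell_layer a b m n y"
  have S: "S N = (\<Sum>k\<le>N. smult (A k (N - k)) (u ^ k * v ^ (N - k)))" for N
    by (simp add: S_def appell_layer_def A_def u_def v_def)
  have ab': "complex_of_real a + complex_of_real b = of_nat m + of_nat n + 1"
    using arg_cong[OF ab, of complex_of_real] by simp
  have A1: "of_nat (Suc k * (Suc k + m)) * A (Suc k) j = q (k + j) * A k j" for k j
    using arg_cong[OF appell_coeff_Suc1[of k m a b n j], of complex_of_real]
    by (simp only: A_def q_def of_real_mult of_real_add of_real_of_nat_eq of_nat_mult of_nat_add)
  have A2: "of_nat (Suc j * (Suc j + n)) * A k (Suc j) = q (k + j) * A k j" for k j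
    using arg_cong[OF appell_coeff_Suc2[of j n a b m k], of complex_of_real]
    by (simp only: A_def q_def of_real_mult of_real_add of_real_of_nat_eq of_nat_mult of_nat_add)
  \<comment> \<open>The factor \<open>k (k + m)\<close> kills the term \<open>k = 0\<close>, and the
    recurrence in \<open>k\<close> turns the rest into the previous layer times \<open>u\<close>.
    \<open>T2\<close> does the same with the other index, losing the term
    \<open>k = Suc N\<close>.\<close>
  have T1_Suc: "T1 (Suc N) = u * smult (q N) (S N)" for N
  proof -
    have "T1 (Suc N) = (\<Sum>k\<le>N. smult (of_nat (Suc k * (Suc k + m)) * A (Suc k) (N - k)) (u ^ Suc k * v ^ (N - k)))"
      unfolding T1_def by (subst sum.atMost_Suc_shift) simp
    also have "\<dots> = (\<Sum>k\<le>N. u * smult (q N * A k (N - k)) (u ^ k * v ^ (N - k)))"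
      by (intro sum.cong refl) (simp only: A1, simp add: mult_ac)
    finally show ?thesis by (simp add: S sum_distrib_left smult_sum_right mult_ac)
  qed
  have T2_Suc: "T2 (Suc N) = smult (q N) (S N)" for N
  proof -
    have "T2 (Suc N) = (\<Sum>k\<le>N. smult (of_nat ((Suc N - k) * (Suc N - k + n)) * A k (Suc N - k)) (u ^ k * v ^ (Suc N - k - 1)))"
      unfolding T2_def by simp
    also have "\<dots> = (\<Sum>k\<le>N. smult (q N * A k (N - k)) (u ^ k * v ^ (N - k)))"
    proof (intro sum.cong refl)
      fix k assume "k \<in> {..N}"
      hence "Suc N - k = Suc (N - k)" "k + (N - k) = N" by auto
      thus "smult (of_nat ((Suc N - k) * (Suc N - k + n)) * A k (Suc N - k)) (u ^ k * v ^ (Suc N - k - 1))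
          = smult (q N * A k (N - k)) (u ^ k * v ^ (N - k))"
        using A2[of "N - k" k] by simp
    qed
    finally show ?thesis by (simp add: S smult_sum_right mult_ac)
  qed
  have "gauss_op a b m (S N) = (\<Sum>k\<le>N. smult (A k (N - k)) (gauss_op a b m (u ^ k * v ^ (N - k))))"
    unfolding S gauss_op_sum gauss_op_smult ..
  also have "\<dots> = (\<Sum>k\<le>N. smult (of_nat (k * (k + m)) * A k (N - k)) (u ^ k * v ^ (N - k))
      + [:0, y:] * smult (of_nat ((N - k) * (N - k + n)) * A k (N - k)) (u ^ k * v ^ (N - k - 1))
      - [:0, 1:] * smult (q N) (smult (A k (N - k)) (u ^ k * v ^ (N - k))))"
  proof (intro sum.cong refl)
    fix k assume "k \<in> {..N}"
    hence kN: "k + (N - k) = N" by auto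
    have q': "(of_nat N + complex_of_real a) * (of_nat N + complex_of_real b) = q N"
      by (simp add: q_def)
    show "smult (A k (N - k)) (gauss_op a b m (u ^ k * v ^ (N - k))) =
      smult (of_nat (k * (k + m)) * A k (N - k)) (u ^ k * v ^ (N - k))
      + [:0, y:] * smult (of_nat ((N - k) * (N - k + n)) * A k (N - k)) (u ^ k * v ^ (N - k - 1))
      - [:0, 1:] * smult (q N) (smult (A k (N - k)) (u ^ k * v ^ (N - k)))"
      unfolding u_def v_def gauss_op_monomial[OF ab'] kN q' of_nat_poly
      by (simp add: smult_add_right smult_diff_right mult_ac)
  qed
  also have "\<dots> = T1 N + [:0, y:] * T2 N - [:0, 1:] * smult (q N) (S N)"
    by (simp only: sum.distrib sum_subtractf T1_def T2_def S sum_distrib_left smult_sum_right)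
  finally have main: "gauss_op a b m (S N) = T1 N + [:0, y:] * T2 N - [:0, 1:] * smult (q N) (S N)" .
  show ?thesis
  proof (cases N)
    case 0
    have "T1 0 = 0" "T2 0 = 0" by (simp_all add: T1_def T2_def)
    with main 0 show ?thesis by (simp add: S_def)
  next
    case (Suc M)
    have "u + [:0, y:] = [:0, 1:]" by (simp add: u_def)
    hence "u * p + [:0, y:] * p - [:0, 1:] * r = [:0, 1:] * (p - r)" for p r
      by (metis distrib_right right_diff_distrib)
    with main show ?thesis
      by (simp only: Suc T1_Suc T2_Suc S_def[symmetric]) simp
  qed
qed

text \<open>Only the last layer survives the telescoping. Since \<open>q\<close> grows quadratically
  while the layers decay geometrically in the region of convergence, the limit satisfies the
  homogeneous equation.\<close>

lemma gauss_op_appell_partial_sum: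
  fixes a b :: real
  assumes ab: "a + b = real m + real n + 1"
  shows "gauss_op a b m (\<Sum>N\<le>K. appell_layer a b m n y N)
     = - ([:0, 1:] * smult (of_real ((real K + a) * (real K + b))) (appell_layer a b m n y K))"
proof (induction K)
  case (Suc K)
  thus ?case
    by (simp only: sum.atMost_Suc gauss_op_add gauss_op_appell_layer[OF ab])
       (simp only: right_diff_distrib nat.simps if_False diff_Suc_1, simp)
qed (use gauss_op_appell_layer[OF ab, of y 0] in simp)

lemma norm_appell_layer_le:
  fixes a b y :: real
  assumes ab: "a > 0" "b > 0" "a \<le> real d" "b \<le> real d" and y: "0 \<le> y" "y \<le> 1"
  shows "norm (poly (appell_layer a b m n y N) x)
     \<le> real (N + 1) ^ (2 * d) * ((sqrt (norm x * (1 - y)) + sqrt (y * norm (1 - x)))\<^sup>2) ^ N"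
proof -
  have "norm (poly (appell_layer a b m n y N) x) \<le>
      (\<Sum>k\<le>N. appell_coeff a b m n k (N - k) * (norm x * (1 - y)) ^ k * (y * norm (1 - x)) ^ (N - k))"
    unfolding appell_layer_def poly_sum
  proof (rule sum_norm_le)
    fix k
    have 1: "poly [:0, 1 - complex_of_real y:] x = of_real (1 - y) * x"
      "poly [:complex_of_real y, - of_real y:] x = of_real y * (1 - x)"
      by (simp_all add: algebra_simps)
    show "norm (poly (smult (of_real (appell_coeff a b m n k (N - k))) ([:0, 1 - complex_of_real y:] ^ k
        * [:complex_of_real y, - of_real y:] ^ (N - k))) x)
       \<le> appell_coeff a b m n k (N - k) * (norm x * (1 - y)) ^ k * (y * norm (1 - x)) ^ (N - k)"
      unfolding poly_smult poly_mult poly_power 1 norm_mult norm_power norm_of_real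
      using ab y appell_coeff_nonneg[of a b m n k "N - k"] by (simp add: mult_ac)
  qed
  also have "\<dots> \<le> (\<Sum>k\<le>N. real (N + 1) ^ (2 * d) * (real (N choose k) ^ 2 * (norm x * (1 - y)) ^ k * (y * norm (1 - x)) ^ (N - k)))"
  proof (rule sum_mono)
    fix k assume "k \<in> {..N}"
    hence "k + (N - k) = N" by simp
    hence "appell_coeff a b m n k (N - k) \<le> real (N + 1) ^ (2 * d) * real (N choose k) ^ 2"
      using appell_coeff_le[OF ab, of m n k "N - k"] by simp
    thus "appell_coeff a b m n k (N - k) * (norm x * (1 - y)) ^ k * (y * norm (1 - x)) ^ (N - k)
       \<le> real (N + 1) ^ (2 * d) * (real (N choose k) ^ 2 * (norm x * (1 - y)) ^ k * (y * norm (1 - x)) ^ (N - k))"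
      using y by (simp only: mult.assoc[symmetric]) (intro mult_right_mono, auto)
  qed
  also have "\<dots> = real (N + 1) ^ (2 * d) * (\<Sum>k\<le>N. real (N choose k) ^ 2 * (norm x * (1 - y)) ^ k * (y * norm (1 - x)) ^ (N - k))"
    by (simp add: sum_distrib_left)
  also have "\<dots> \<le> real (N + 1) ^ (2 * d) * ((sqrt (norm x * (1 - y)) + sqrt (y * norm (1 - x)))\<^sup>2) ^ N"
    using y by (intro mult_left_mono sum_binomial_square_le) auto
  finally show ?thesis .
qed


text \<open>This translates uniform convergence near 0, which passes to all derivatives, into
  convergence of each polynomial coefficient.\<close>

lemma higher_deriv_poly_0: "(deriv ^^ k) (poly p) 0 = fact k * coeff p k" for p :: "complex poly"
proof -
  have "poly p has_fps_expansion fps_of_poly p"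
    by (simp add: has_fps_expansion_def)
  from fps_nth_fps_expansion[OF this, of k] show ?thesis by simp
qed

lemma summable_gauss_coeff:
  assumes ab: "a > 0" "b > 0" and x: "norm (x :: complex) < 1"
  shows "summable (\<lambda>k. of_real (gauss_coeff a b m k) * x ^ k)"
proof -
  obtain d :: nat where d: "max a b \<le> real d" using real_arch_simple by blast
  show ?thesis
  proof (rule summable_comparison_test')
    show "summable (\<lambda>N. real (N + 1) ^ (2 * d) * norm x ^ N)"
      using x by (intro summable_poly_times_geometric) auto
    show "norm (of_real (gauss_coeff a b m k) * x ^ k) \<le> real (k + 1) ^ (2 * d) * norm x ^ k" for k
      using gauss_coeff_nonneg[OF ab, of m k] gauss_coeff_le[OF ab, of d m k] d
      by (simp add: norm_mult norm_power mult_right_mono)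
  qed
qed

lemma summable_gauss_coeff_real:
  assumes "a > 0" "b > 0" "\<bar>x\<bar> < (1 :: real)"
  shows "summable (\<lambda>k. gauss_coeff a b m k * x ^ k)"
proof -
  have "summable (\<lambda>k. complex_of_real (gauss_coeff a b m k * x ^ k))"
    using summable_gauss_coeff[of a b "of_real x" m] assms by simp
  thus ?thesis by (simp only: summable_complex_of_real)
qed

text \<open>Two arithmetic-geometric mean inequalities, whose right-hand sides add up to 1. They are
  strict because \<open>x < 1 - y\<close> and \<open>y < 1 - x\<close>.\<close>

lemma sqrt_mult_add_sqrt_mult_lt_1:
  assumes "0 \<le> x" "0 \<le> y" "x + y < (1::real)"
  shows "sqrt (x * (1 - y)) + sqrt (y * (1 - x)) < 1"
proof -
  have 1: "sqrt (s * t) < (s + t) / 2" if "0 \<le> s" "s < t" for s t :: real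
  proof (rule real_less_lsqrt)
    have "((s + t) / 2)\<^sup>2 - s * t = ((t - s) / 2)\<^sup>2"
      by (simp add: power2_eq_square field_simps)
    moreover have "((t - s) / 2)\<^sup>2 > 0" using that by simp
    ultimately show "s * t < ((s + t) / 2)\<^sup>2" by linarith
  qed (use that in auto)
  have "sqrt (x * (1 - y)) + sqrt (y * (1 - x)) < (x + (1 - y)) / 2 + (y + (1 - x)) / 2"
    using assms by (intro add_strict_mono 1) auto
  also have "\<dots> = 1" by (simp add: field_simps)
  finally show ?thesis .
qed

text \<open>
  Near \<open>X = 0\<close> the power series coefficients of the sum satisfy the recurrence of the Gauss
  series; the identity then extends to the whole interval \<open>0 \<le> X < 1 - Y\<close> by analytic continuation inside
  the region where \<open>\<bar>X (1 - Y)\<bar>\<^sup>1\<^sup>/\<^sup>2 + \<bar>Y (1 - X)\<bar>\<^sup>1\<^sup>/\<^sup>2 < 1\<close>.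
\<close>

proposition appell_factorization_sums:
  fixes a b X Y :: real
  assumes ab: "a > 0" "b > 0" "a + b = real m + real n + 1"
    and XY: "0 \<le> X" "0 \<le> Y" "X + Y < 1"
  shows "(\<lambda>N. \<Sum>k\<le>N. appell_coeff a b m n k (N - k) * (X * (1 - Y)) ^ k * (Y * (1 - X)) ^ (N - k))
      sums ((\<Sum>k. gauss_coeff a b m k * X ^ k) * (\<Sum>k. gauss_coeff a b n k * Y ^ k))"
proof -
  define d where "d = m + n + 1"
  have d: "a \<le> real d" "b \<le> real d" "1 \<le> real d" using ab by (auto simp: d_def)
  have Y1: "Y < 1" "Y \<le> 1" using XY by auto
  define e where "e = appell_layer a b m n (complex_of_real Y)"
  define \<rho> where "\<rho> x = sqrt (norm x * (1 - Y)) + sqrt (Y * norm (1 - x))" for x :: complex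
  \<comment> \<open>On \<open>V r\<close> with \<open>r < 1\<close> the layers have a common
    summable majorant. On \<open>V 1\<close> convergence is only locally uniform, which is all that
    holomorphy requires.\<close>
  define V where "V r = {x. \<rho> x < r}" for r
  define h where "h x = (\<Sum>N. poly (e N) x)" for x
  define q where "q K = complex_of_real ((real K + a) * (real K + b))" for K
  define g where "g = (\<Sum>k. gauss_coeff a b n k * Y ^ k)"
  have \<rho>0: "\<rho> x \<ge> 0" for x using XY by (simp add: \<rho>_def)
  have V_open: "open (V r)" for r
    unfolding V_def \<rho>_def by (intro open_Collect_less continuous_intros)
  have bound: "norm (poly (e N) x) \<le> real (N + 1) ^ (2 * d) * (r\<^sup>2) ^ N" if "x \<in> V r" for x r N
  proof -
    have "norm (poly (e N) x) \<le> real (N + 1) ^ (2 * d) * ((\<rho> x)\<^sup>2) ^ N"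
      unfolding e_def \<rho>_def using ab d XY Y1 by (intro norm_appell_layer_le) auto
    also have "\<dots> \<le> real (N + 1) ^ (2 * d) * (r\<^sup>2) ^ N"
      using that \<rho>0[of x] by (intro mult_left_mono power_mono) (auto simp: V_def)
    finally show ?thesis .
  qed
  have sq: "0 \<le> r\<^sup>2" "r\<^sup>2 < 1" if "0 \<le> r" "r < 1" for r :: real
    using that by (auto simp: power_less_one_iff abs_square_less_1)
  have ul: "uniform_limit (V r) (\<lambda>K x. \<Sum>N<K. poly (e N) x) h sequentially" if "0 \<le> r" "r < 1" for r
    unfolding h_def
    by (rule Weierstrass_m_test[where M = "\<lambda>N. real (N + 1) ^ (2 * d) * (r\<^sup>2) ^ N"])
       (use bound summable_poly_times_geometric[OF sq[OF that]] in auto)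
  \<comment> \<open>The quadratic growth of \<open>q\<close> is absorbed by raising the exponent of
    the polynomial factor by 2.\<close>
  have ul0: "uniform_limit (V r) (\<lambda>K x. poly (smult (q K) (e K)) x) (\<lambda>_. 0) sequentially"
    if r: "0 \<le> r" "r < 1" for r
  proof (rule uniform_limitI)
    fix \<epsilon> :: real assume \<epsilon>: "\<epsilon> > 0"
    have "(\<lambda>N. (real d)\<^sup>2 * (real (N + 1) ^ (2 * d + 2) * (r\<^sup>2) ^ N)) \<longlonglongrightarrow> (real d)\<^sup>2 * 0"
      by (intro tendsto_mult tendsto_const summable_LIMSEQ_zero summable_poly_times_geometric sq r)
    hence "eventually (\<lambda>N. (real d)\<^sup>2 * (real (N + 1) ^ (2 * d + 2) * (r\<^sup>2) ^ N) < \<epsilon>) sequentially"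
      using \<epsilon> by (intro order_tendstoD) auto
    thus "\<forall>\<^sub>F K in sequentially. \<forall>x\<in>V r. dist (poly (smult (q K) (e K)) x) 0 < \<epsilon>"
    proof eventually_elim
      case (elim K)
      have qb: "norm (q K) \<le> (real d)\<^sup>2 * real (K + 1) ^ 2"
      proof -
        have "(real K + c) \<le> real d * real (K + 1)" if "c \<le> real d" for c
        proof -
          have "real K * 1 \<le> real K * real d" using d by (intro mult_left_mono) auto
          thus ?thesis using that by (simp add: algebra_simps)
        qed
        hence "(real K + a) * (real K + b) \<le> (real d * real (K + 1)) * (real d * real (K + 1))"
          using ab d by (intro mult_mono) auto
        moreover have "norm (q K) = (real K + a) * (real K + b)"
          using ab unfolding q_def norm_of_real by (intro abs_of_nonneg mult_nonneg_nonneg) auto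
        ultimately show ?thesis by (simp add: power2_eq_square mult_ac)
      qed
      show ?case
      proof
        fix x assume x: "x \<in> V r"
        have "norm (q K * poly (e K) x) \<le> ((real d)\<^sup>2 * real (K + 1) ^ 2) * (real (K + 1) ^ (2 * d) * (r\<^sup>2) ^ K)"
          unfolding norm_mult by (intro mult_mono qb bound x) auto
        also have "\<dots> = (real d)\<^sup>2 * (real (K + 1) ^ (2 * d + 2) * (r\<^sup>2) ^ K)"
          by (simp add: power_add power2_eq_square)
        also have "\<dots> < \<epsilon>" by (rule elim)
        finally show "dist (poly (smult (q K) (e K)) x) 0 < \<epsilon>" by simp
      qed
    qed
  qed
  \<comment> \<open>The value of \<open>\<rho>\<close> at 0 is \<open>sqrt Y\<close>, so any radius
    between it and 1 gives a neighbourhood of 0.\<close>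
  have "sqrt Y < 1" using Y1 XY by simp
  then obtain r0 where r0: "sqrt Y < r0" "r0 < 1" using dense by blast
  have r0': "0 \<le> r0" using r0 XY real_sqrt_ge_zero[of Y] by linarith
  have V0: "0 \<in> V r0" using r0 by (simp add: V_def \<rho>_def)
  define \<alpha> where "\<alpha> k = (deriv ^^ k) h 0 / fact k" for k
  have lim1: "(\<lambda>K. coeff (\<Sum>N\<le>K. e N) k) \<longlonglongrightarrow> \<alpha> k" for k
  proof -
    have "(\<lambda>K. (deriv ^^ k) (\<lambda>x. \<Sum>N<K. poly (e N) x) 0) \<longlonglongrightarrow> (deriv ^^ k) h 0"
      by (rule higher_deriv_complex_uniform_limit[OF ul[OF r0' r0(2)] _ _ V_open V0])
         (auto intro!: always_eventually holomorphic_intros)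
    moreover have "(\<lambda>x. \<Sum>N<K. poly (e N) x) = poly (\<Sum>N<K. e N)" for K
      by (simp add: fun_eq_iff poly_sum)
    ultimately have "(\<lambda>K. fact k * coeff (\<Sum>N<K. e N) k) \<longlonglongrightarrow> (deriv ^^ k) h 0"
      by (simp only: higher_deriv_poly_0)
    hence "(\<lambda>K. fact k * coeff (\<Sum>N<K. e N) k / fact k) \<longlonglongrightarrow> \<alpha> k"
      unfolding \<alpha>_def by (intro tendsto_divide tendsto_const) auto
    hence "(\<lambda>K. coeff (\<Sum>N<K. e N) k) \<longlonglongrightarrow> \<alpha> k" by simp
    from LIMSEQ_Suc[OF this] show ?thesis by (simp only: lessThan_Suc_atMost)
  qed
  have lim0: "(\<lambda>K. coeff (smult (q K) (e K)) k) \<longlonglongrightarrow> 0" for k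
  proof -
    have "(\<lambda>K. (deriv ^^ k) (poly (smult (q K) (e K))) 0) \<longlonglongrightarrow> (deriv ^^ k) (\<lambda>_. 0 :: complex) 0"
      by (rule higher_deriv_complex_uniform_limit[OF ul0[OF r0' r0(2)] _ _ V_open V0])
         (auto intro!: always_eventually holomorphic_intros simp del: poly_smult)
    moreover have "(deriv ^^ k) (\<lambda>_. 0 :: complex) 0 = 0"
      using higher_deriv_poly_0[of k 0] by (simp add: poly_0[abs_def])
    ultimately have "(\<lambda>K. fact k * coeff (smult (q K) (e K)) k) \<longlonglongrightarrow> 0"
      by (simp only: higher_deriv_poly_0)
    hence "(\<lambda>K. fact k * coeff (smult (q K) (e K)) k / fact k) \<longlonglongrightarrow> 0 / fact k"
      by (intro tendsto_divide tendsto_const) auto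
    thus ?thesis by simp
  qed
  \<comment> \<open>The remainder carries a factor \<open>x\<close>, so its coefficient at
    \<open>Suc k\<close> is minus that of \<open>smult (q K) (e K)\<close> at \<open>k\<close>,
    which tends to 0.\<close>
  have rec: "of_nat (Suc k) * (of_nat (Suc k) + of_nat m) * \<alpha> (Suc k) = (of_nat k + of_real a) * (of_nat k + of_real b) * \<alpha> k" for k
  proof -
    have "(\<lambda>K. of_nat (Suc k) * (of_nat (Suc k) + of_nat m) * coeff (\<Sum>N\<le>K. e N) (Suc k)
        - (of_nat k + of_real a) * (of_nat k + of_real b) * coeff (\<Sum>N\<le>K. e N) k)
        \<longlonglongrightarrow> of_nat (Suc k) * (of_nat (Suc k) + of_nat m) * \<alpha> (Suc k) - (of_nat k + of_real a) * (of_nat k + of_real b) * \<alpha> k"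
      by (intro tendsto_intros lim1)
    moreover have "of_nat (Suc k) * (of_nat (Suc k) + of_nat m) * coeff (\<Sum>N\<le>K. e N) (Suc k)
        - (of_nat k + of_real a) * (of_nat k + of_real b) * coeff (\<Sum>N\<le>K. e N) k = - coeff (smult (q K) (e K)) k" for K
      unfolding coeff_gauss_op_Suc[symmetric] e_def q_def gauss_op_appell_partial_sum[OF ab(3)]
      by simp
    moreover have "(\<lambda>K. - coeff (smult (q K) (e K)) k) \<longlonglongrightarrow> - 0"
      by (intro tendsto_minus lim0)
    ultimately show ?thesis using LIMSEQ_unique by fastforce
  qed
  \<comment> \<open>At \<open>x = 0\<close> one has \<open>u = 0\<close> and \<open>v = Y\<close>,
    so each layer keeps only its term \<open>k = 0\<close> and the Gauss series in \<open>Y\<close>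
    remains. It supplies the constant factor of the solution in \<open>X\<close>.\<close>
  have \<alpha>0: "\<alpha> 0 = of_real (g / fact m)"
  proof -
    have "poly (e N) 0 = of_real (gauss_coeff a b n N * Y ^ N / fact m)" for N
    proof -
      have "poly (e N) 0 = (\<Sum>k\<le>N. if k = 0 then of_real (appell_coeff a b m n 0 N * Y ^ N) else 0)"
        unfolding e_def appell_layer_def poly_sum by (intro sum.cong) (auto simp: poly_power)
      also have "\<dots> = of_real (appell_coeff a b m n 0 N * Y ^ N)" by simp
      finally show ?thesis by (simp add: appell_coeff_def gauss_coeff_def)
    qed
    moreover have "(\<lambda>N. of_real (gauss_coeff a b n N * Y ^ N / fact m) :: complex) sums of_real (g / fact m)"
      unfolding g_def sums_of_real_iff using ab XY Y1
      by (intro sums_divide summable_sums summable_gauss_coeff_real) auto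
    ultimately have "h 0 = of_real (g / fact m)" by (simp add: h_def sums_iff)
    thus ?thesis by (simp add: \<alpha>_def)
  qed
  have \<alpha>: "\<alpha> k = of_real (g * gauss_coeff a b m k)" for k
  proof (induction k)
    case 0
    show ?case by (simp add: \<alpha>0 gauss_coeff_def)
  next
    case (Suc k)
    have "of_nat (Suc k) * (of_nat (Suc k) + of_nat m) * \<alpha> (Suc k)
        = of_real ((real k + a) * (real k + b) * (g * gauss_coeff a b m k))"
      unfolding rec Suc by simp
    also have "\<dots> = of_real (g * (real (Suc k) * (real (Suc k) + real m) * gauss_coeff a b m (Suc k)))"
      unfolding gauss_coeff_Suc by (simp add: mult_ac)
    also have "\<dots> = of_nat (Suc k) * (of_nat (Suc k) + of_nat m) * of_real (g * gauss_coeff a b m (Suc k))"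
      by (simp add: mult_ac del: of_nat_Suc)
    finally have eq: "of_nat (Suc k) * (of_nat (Suc k) + of_nat m) * \<alpha> (Suc k)
       = of_nat (Suc k) * (of_nat (Suc k) + of_nat m) * of_real (g * gauss_coeff a b m (Suc k))" .
    have "of_nat (Suc k) * (of_nat (Suc k) + of_nat m) \<noteq> (0 :: complex)"
      by (simp only: of_nat_add[symmetric] of_nat_mult[symmetric] of_nat_eq_0_iff) simp
    with eq show ?case by (simp only: mult_cancel_left) simp
  qed
  define G where "G x = of_real g * (\<Sum>k. of_real (gauss_coeff a b m k) * x ^ k)" for x :: complex
  have G_sums: "(\<lambda>k. \<alpha> k * x ^ k) sums G x" if "norm x < 1" for x
    unfolding \<alpha> G_def of_real_mult mult.assoc
    by (intro sums_mult summable_sums summable_gauss_coeff ab that)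
  have h_hol: "h holomorphic_on V 1"
  proof (rule holomorphic_uniform_sequence[OF V_open])
    show "(\<lambda>x. \<Sum>N<K. poly (e N) x) holomorphic_on V 1" for K
      by (intro holomorphic_intros)
    fix x assume "x \<in> V 1"
    hence "\<rho> x < 1" by (simp add: V_def)
    then obtain r where r: "\<rho> x < r" "r < 1" using dense by blast
    have r': "0 \<le> r" using \<rho>0[of x] r by simp
    have "x \<in> V r" using r by (simp add: V_def)
    then obtain \<delta> where \<delta>: "\<delta> > 0" "cball x \<delta> \<subseteq> V r"
      using V_open open_contains_cball by blast
    have "V r \<subseteq> V 1" using r by (auto simp: V_def)
    thus "\<exists>d>0. cball x d \<subseteq> V 1 \<and> uniform_limit (cball x d) (\<lambda>K x. \<Sum>N<K. poly (e N) x) h sequentially"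
      using \<delta> ul[OF r' r(2)] by (intro exI[of _ \<delta>]) (auto intro: uniform_limit_on_subset)
  qed
  have G_hol: "G holomorphic_on ball 0 1"
    by (rule power_series_holomorphic[where a = \<alpha>]) (use G_sums in auto)
  have V10: "0 \<in> V 1" using V0 r0 by (auto simp: V_def)
  have ev: "eventually (\<lambda>x. h x = G x) (nhds 0)"
  proof -
    have "h has_fps_expansion fps_expansion h 0"
      by (rule has_fps_expansion_fps_expansion[OF V_open V10 h_hol])
    moreover have "fps_expansion h 0 = Abs_fps \<alpha>"
      by (rule fps_ext) (simp add: fps_expansion_def \<alpha>_def)
    moreover have "G has_fps_expansion Abs_fps \<alpha>"
    proof (rule has_fps_expansionI)
      have "eventually (\<lambda>z. z \<in> ball (0::complex) 1) (nhds 0)"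
        by (intro eventually_nhds_in_open) auto
      thus "\<forall>\<^sub>F u in nhds 0. (\<lambda>n. fps_nth (Abs_fps \<alpha>) n * u ^ n) sums G u"
        by eventually_elim (use G_sums in auto)
    qed
    ultimately have "eventually (\<lambda>x. eval_fps (Abs_fps \<alpha>) x = h x) (nhds 0)"
      "eventually (\<lambda>x. eval_fps (Abs_fps \<alpha>) x = G x) (nhds 0)"
      by (simp_all add: has_fps_expansion_def)
    thus ?thesis by eventually_elim simp
  qed
  \<comment> \<open>Connectedness of the whole intersection is avoided: its component of 0 contains
    the segment from 0 to \<open>X\<close>, and the identity theorem applies there.\<close>
  define W where "W = connected_component_set (V 1 \<inter> ball 0 1) 0"
  have "open (V 1 \<inter> ball 0 1)" "0 \<in> V 1 \<inter> ball 0 1" using V10 V_open by auto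
  hence W: "open W" "connected W" "0 \<in> W"
    unfolding W_def by (simp_all add: open_connected_component connected_component_refl)
  have W_sub: "W \<subseteq> V 1 \<inter> ball 0 1"
    unfolding W_def by (rule connected_component_subset)
  have "closed_segment 0 (complex_of_real X) \<subseteq> V 1 \<inter> ball 0 1"
  proof
    fix z assume "z \<in> closed_segment 0 (complex_of_real X)"
    then obtain t where t: "0 \<le> t" "t \<le> 1" "z = of_real (t * X)"
      by (auto simp: closed_segment_def scaleR_conv_of_real)
    have tX: "0 \<le> t * X" "t * X \<le> X"
      using t XY by (auto simp: mult_left_le_one_le)
    have n1: "norm z = t * X" "norm (1 - z) = 1 - t * X"
    proof -
      show "norm z = t * X" unfolding t(3) norm_of_real using tX by simp
      have "1 - z = of_real (1 - t * X)" using t(3) by simp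
      hence "norm (1 - z) = \<bar>1 - t * X\<bar>" by (simp only: norm_of_real)
      thus "norm (1 - z) = 1 - t * X" using tX XY by simp
    qed
    have "\<rho> z < 1"
      unfolding \<rho>_def n1 using tX XY by (intro sqrt_mult_add_sqrt_mult_lt_1) auto
    thus "z \<in> V 1 \<inter> ball 0 1" using n1 tX XY by (simp add: V_def)
  qed
  hence "connected_component (V 1 \<inter> ball 0 1) 0 (complex_of_real X)"
    by (meson connected_component_def connected_segment ends_in_segment)
  hence XW: "of_real X \<in> W" by (simp add: W_def)
  have "h (of_real X) = G (of_real X)"
    by (rule holomorphic_eq_of_eventually_eq[OF W _ _ ev XW])
       (use h_hol G_hol W_sub in \<open>auto intro: holomorphic_on_subset\<close>)
  moreover have "(\<lambda>N. poly (e N) (of_real X)) sums h (of_real X)"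
  proof -
    have X1: "of_real X \<in> V 1" using XW W_sub by auto
    hence "\<rho> (of_real X) < 1" by (simp add: V_def)
    then obtain r where r: "\<rho> (of_real X) < r" "r < 1" using dense by blast
    have r': "0 \<le> r" using \<rho>0[of "of_real X"] r by simp
    have "(\<lambda>K. \<Sum>N<K. poly (e N) (of_real X)) \<longlonglongrightarrow> h (of_real X)"
      by (rule tendsto_uniform_limitI[OF ul[OF r' r(2)]]) (use r in \<open>simp add: V_def\<close>)
    thus ?thesis by (simp add: sums_def)
  qed
  moreover have "G (of_real X) = of_real ((\<Sum>k. gauss_coeff a b m k * X ^ k) * g)"
  proof -
    have "(\<lambda>k. complex_of_real (gauss_coeff a b m k * X ^ k)) sums of_real (\<Sum>k. gauss_coeff a b m k * X ^ k)"
      unfolding sums_of_real_iff using ab XY by (intro summable_sums summable_gauss_coeff_real) auto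
    thus ?thesis by (simp add: G_def sums_iff)
  qed
  moreover have "poly (e N) (of_real X) =
     of_real (\<Sum>k\<le>N. appell_coeff a b m n k (N - k) * (X * (1 - Y)) ^ k * (Y * (1 - X)) ^ (N - k))" for N
    unfolding e_def appell_layer_def poly_sum of_real_sum
    by (intro sum.cong refl) (simp add: poly_power algebra_simps)
  ultimately show ?thesis
    by (simp only: sums_of_real_iff g_def)
qed


text \<open>The terms are nonnegative, so summation along the diagonals \<open>k + j = N\<close> may
  be replaced by unordered summation over all pairs. This form is independent of the order of
  summation, as the later reindexing requires.\<close>

lemma appell_factorization_has_sum_interior:
  fixes a b X Y :: real
  assumes ab: "a > 0" "b > 0" "a + b = real m + real n + 1"
    and XY: "0 \<le> X" "0 \<le> Y" "X + Y < 1"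
  shows "((\<lambda>(k, j). appell_coeff a b m n k j * (X * (1 - Y)) ^ k * (Y * (1 - X)) ^ j)
      has_sum ((\<Sum>k. gauss_coeff a b m k * X ^ k) * (\<Sum>k. gauss_coeff a b n k * Y ^ k))) UNIV"
proof -
  define B where "B k j = appell_coeff a b m n k j * (X * (1 - Y)) ^ k * (Y * (1 - X)) ^ j" for k j
  define S where "S = (\<Sum>k. gauss_coeff a b m k * X ^ k) * (\<Sum>k. gauss_coeff a b n k * Y ^ k)"
  have B0: "B k j \<ge> 0" for k j
    unfolding B_def using appell_coeff_nonneg[OF ab(1,2)] XY by (intro mult_nonneg_nonneg) auto
  have "(\<lambda>N. \<Sum>k\<le>N. B k (N - k)) sums S"
    unfolding B_def S_def by (rule appell_factorization_sums[OF ab XY])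
  hence outer: "((\<lambda>N. \<Sum>k\<le>N. B k (N - k)) has_sum S) UNIV"
    by (rule sums_nonneg_imp_has_sum) (simp add: sum_nonneg B0)
  have inner: "((\<lambda>k. (\<lambda>(N, k). B k (N - k)) (N, k)) has_sum (\<Sum>k\<le>N. B k (N - k))) {..N}" for N
    by (simp add: has_sum_finiteI)
  have "((\<lambda>(N, k). B k (N - k)) has_sum S) (Sigma UNIV (\<lambda>N. {..N}))"
    by (intro has_sum_SigmaI[OF inner outer] summable_on_SigmaI[OF inner has_sum_imp_summable[OF outer]])
       (auto simp: B0)
  hence "((\<lambda>(k, j). B k j) has_sum S) UNIV"
    by (subst has_sum_reindex_bij_witness[of UNIV "\<lambda>(N, k). (k, N - k)" "\<lambda>(k, j). (k + j, k)"
          "Sigma UNIV (\<lambda>N. {..N})" "\<lambda>(N, k). B k (N - k)"]) auto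
  thus ?thesis by (simp add: B_def S_def)
qed

text \<open>
  Moving from \<open>(X, Y)\<close> to \<open>(X - s, Y - s)\<close> turns the arguments \<open>(X\<^sup>2, Y\<^sup>2)\<close> of the double
  series into \<open>(X\<^sup>2 - s\<^sup>2, Y\<^sup>2 - s\<^sup>2)\<close>, so that both increase as \<open>s\<close> decreases to \<open>0\<close>.
\<close>

lemma appell_factorization_has_sum_boundary:
  fixes a b X Y :: real
  assumes ab: "a > 0" "b > 0" "a + b = real m + real n + 1"
    and XY: "0 < X" "0 < Y" "X + Y = 1"
  shows "((\<lambda>(k, j). appell_coeff a b m n k j * (X * (1 - Y)) ^ k * (Y * (1 - X)) ^ j)
      has_sum ((\<Sum>k. gauss_coeff a b m k * X ^ k) * (\<Sum>k. gauss_coeff a b n k * Y ^ k))) UNIV"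
proof -
  define f where "f x = (\<Sum>k. gauss_coeff a b m k * x ^ k)" for x
  define g where "g x = (\<Sum>k. gauss_coeff a b n k * x ^ k)" for x
  define B where "B s = (\<lambda>(k, j). appell_coeff a b m n k j * (X\<^sup>2 - s\<^sup>2) ^ k * (Y\<^sup>2 - s\<^sup>2) ^ j)" for s
  have cont: "isCont (\<lambda>x. \<Sum>k. gauss_coeff a b l k * x ^ k) x" if x: "\<bar>x\<bar> < 1" for x :: real and l
  proof -
    obtain K where K: "\<bar>x\<bar> < K" "K < 1" using dense[OF x] by blast
    have "\<bar>K\<bar> < 1" using K by simp
    hence "summable (\<lambda>k. gauss_coeff a b l k * K ^ k)"
      by (rule summable_gauss_coeff_real[OF ab(1,2)])
    thus ?thesis by (rule isCont_powser) (use K in simp)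
  qed
  have lim: "((\<lambda>s. f (X - s) * g (Y - s)) \<longlongrightarrow> f (X - 0) * g (Y - 0)) (at_right 0)"
    unfolding f_def g_def using XY
    by (intro tendsto_mult isCont_tendsto_compose[OF cont] tendsto_intros) auto
  have ev: "eventually (\<lambda>s::real. 0 < s \<and> s < min X Y) (at_right 0)"
    using XY eventually_at_right_real[of 0 "min X Y"] by (auto elim: eventually_mono)
  have Bs: "(B s has_sum f (X - s) * g (Y - s)) UNIV" if "0 < s" "s < min X Y" for s
  proof -
    have "(X - s) * (1 - (Y - s)) = X\<^sup>2 - s\<^sup>2" "(Y - s) * (1 - (X - s)) = Y\<^sup>2 - s\<^sup>2"
    proof -
      have 1: "1 - (Y - s) = X + s" "1 - (X - s) = Y + s" using XY by auto
      show "(X - s) * (1 - (Y - s)) = X\<^sup>2 - s\<^sup>2" "(Y - s) * (1 - (X - s)) = Y\<^sup>2 - s\<^sup>2"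
        unfolding 1 by (simp_all add: power2_eq_square algebra_simps)
    qed
    thus ?thesis
      using appell_factorization_has_sum_interior[OF ab, of "X - s" "Y - s"] that XY
      unfolding B_def f_def g_def by simp
  qed
  have Bnn: "B s p \<ge> 0" if "0 \<le> s" "s < min X Y" for s p
    unfolding B_def using that appell_coeff_nonneg[OF ab(1,2), of m n]
    by (cases p) (auto intro!: mult_nonneg_nonneg zero_le_power power_mono)
  have Bmono: "B s p \<le> B 0 p" if "0 \<le> s" "s < min X Y" for s p
    unfolding B_def using that appell_coeff_nonneg[OF ab(1,2), of m n]
    by (cases p) (auto intro!: mult_mono power_mono mult_nonneg_nonneg zero_le_power)
  \<comment> \<open>Upper bound: for a finite set of pairs the limit
    \<open>s \<rightarrow> 0\<close> may be taken term by term.\<close>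
  have le: "sum (B 0) F \<le> f X * g Y" if "finite F" for F
  proof -
    have "((\<lambda>s. sum (B s) F) \<longlongrightarrow> sum (B 0) F) (at_right 0)"
    proof (rule tendsto_sum)
      fix p assume "p \<in> F"
      obtain k j where p: "p = (k, j)" by (cases p)
      have "((\<lambda>s. appell_coeff a b m n k j * (X\<^sup>2 - s\<^sup>2) ^ k * (Y\<^sup>2 - s\<^sup>2) ^ j)
         \<longlongrightarrow> appell_coeff a b m n k j * (X\<^sup>2 - 0\<^sup>2) ^ k * (Y\<^sup>2 - 0\<^sup>2) ^ j) (at_right 0)"
        by (intro tendsto_intros)
      thus "((\<lambda>s. B s p) \<longlongrightarrow> B 0 p) (at_right 0)" by (simp add: B_def p)
    qed
    moreover have "eventually (\<lambda>s. sum (B s) F \<le> f (X - s) * g (Y - s)) (at_right 0)"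
      using ev by eventually_elim (use Bs Bnn that in \<open>auto intro!: finite_sum_le_has_sum\<close>)
    ultimately show ?thesis using lim by (auto intro: tendsto_le[rotated, rotated])
  qed
  have sm: "B 0 summable_on UNIV"
    by (rule nonneg_bdd_above_summable_on)
       (use Bnn[of 0] XY le in \<open>auto intro!: bdd_aboveI2[of _ _ "f X * g Y"]\<close>)
  hence hs: "(B 0 has_sum infsum (B 0) UNIV) UNIV" by simp
  have "infsum (B 0) UNIV \<le> f X * g Y"
    by (rule has_sum_le_finite_sums[OF hs le])
  \<comment> \<open>Lower bound: each \<open>B s\<close> is dominated by \<open>B 0\<close>, so
    every value \<open>f (X - s) * g (Y - s)\<close> is at most the full sum.\<close>
  moreover have "f X * g Y \<le> infsum (B 0) UNIV"
  proof (rule tendsto_upperbound)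
    show "((\<lambda>s. f (X - s) * g (Y - s)) \<longlongrightarrow> f X * g Y) (at_right 0)" using lim by simp
    show "eventually (\<lambda>s. f (X - s) * g (Y - s) \<le> infsum (B 0) UNIV) (at_right 0)"
      using ev
    proof eventually_elim
      case (elim s)
      show ?case
        by (rule has_sum_mono[OF Bs hs]) (use elim Bmono[of s] in auto)
    qed
  qed simp
  ultimately have "(B 0 has_sum f X * g Y) UNIV" using hs by simp
  moreover have "X * (1 - Y) = X\<^sup>2" "Y * (1 - X) = Y\<^sup>2"
  proof -
    have "1 - Y = X" "1 - X = Y" using XY by auto
    thus "X * (1 - Y) = X\<^sup>2" "Y * (1 - X) = Y\<^sup>2" by (simp_all add: power2_eq_square)
  qed
  ultimately show ?thesis by (simp add: B_def f_def g_def)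
qed


lemma appell_factorization_has_sum:
  fixes a b X Y :: real
  assumes "a > 0" "b > 0" "a + b = real m + real n + 1" "0 < X" "0 < Y" "X + Y \<le> 1"
  shows "((\<lambda>(k, j). appell_coeff a b m n k j * (X * (1 - Y)) ^ k * (Y * (1 - X)) ^ j)
      has_sum ((\<Sum>k. gauss_coeff a b m k * X ^ k) * (\<Sum>k. gauss_coeff a b n k * Y ^ k))) UNIV"
  using assms appell_factorization_has_sum_interior appell_factorization_has_sum_boundary
  by (cases "X + Y = 1") simp_all

section \<open>Termwise integration\<close>

text \<open>Summability of the integrals of the absolute values permits the interchange, through the
  Lebesgue integral. The pointwise hypotheses concern the open interval only, since for
  \<open>\<sigma> = \<sigma>'\<close> the series may diverge at the endpoints.\<close>

lemma has_integral_suminf: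
  fixes f :: "nat \<Rightarrow> real \<Rightarrow> real"
  assumes cont: "\<And>p. continuous_on {A..B} (f p)"
    and sums: "\<And>x. x \<in> {A<..<B} \<Longrightarrow> (\<lambda>p. f p x) sums F x"
    and abs: "\<And>x. x \<in> {A<..<B} \<Longrightarrow> summable (\<lambda>p. \<bar>f p x\<bar>)"
    and bound: "summable (\<lambda>p. integral {A..B} (\<lambda>x. \<bar>f p x\<bar>))"
    and J: "\<And>p. (f p has_integral J p) {A..B}" "J sums S"
  shows "(F has_integral S) {A..B}"
proof -
  let ?M = "lebesgue_on {A..B}"
  have int: "integrable ?M (f p)" for p
    by (rule continuous_imp_integrable_real[OF cont])
  have HK: "integral\<^sup>L ?M g = integral {A..B} g" if "integrable ?M g" for g :: "real \<Rightarrow> real"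
    using has_integral_integral_lebesgue_on[OF that] by (simp add: integral_unique)
  have "{A, B} \<in> null_sets lebesgue"
    by (simp flip: negligible_iff_null_sets)
  hence "AE x in lebesgue. x \<notin> {A, B}" by (rule AE_not_in)
  hence AE: "AE x in ?M. summable (\<lambda>p. norm (f p x))"
  proof (subst AE_restrict_space_iff)
    assume "AE x in lebesgue. x \<notin> {A, B}"
    thus "AE x in lebesgue. x \<in> {A..B} \<longrightarrow> summable (\<lambda>p. norm (f p x))"
      by eventually_elim (use abs in auto)
  qed simp
  have nrm: "summable (\<lambda>p. \<integral>x. norm (f p x) \<partial>?M)"
    using bound int by (simp add: HK integrable_norm)
  have "integrable ?M (\<lambda>x. \<Sum>p. f p x)"
    by (rule integrable_suminf[OF int AE nrm])
  hence "((\<lambda>x. \<Sum>p. f p x) has_integral integral\<^sup>L ?M (\<lambda>x. \<Sum>p. f p x)) {A..B}"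
    by (rule has_integral_integral_lebesgue_on) simp
  moreover have "integral\<^sup>L ?M (\<lambda>x. \<Sum>p. f p x) = S"
  proof -
    have "(\<lambda>p. integral\<^sup>L ?M (f p)) sums integral\<^sup>L ?M (\<lambda>x. \<Sum>p. f p x)"
      by (rule sums_integral[OF int AE nrm])
    moreover have "integral\<^sup>L ?M (f p) = J p" for p
      using HK[OF int] J(1)[of p] by (simp add: integral_unique)
    ultimately show ?thesis using J(2) sums_unique2 by simp
  qed
  ultimately have "((\<lambda>x. \<Sum>p. f p x) has_integral S) {A<..<B}"
    by (simp add: has_integral_Icc_iff_Ioo)
  hence "(F has_integral S) {A<..<B}"
    by (rule has_integral_eq[rotated]) (use sums in \<open>auto simp: sums_iff\<close>)
  thus ?thesis by (simp add: has_integral_Icc_iff_Ioo)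
qed

section \<open>Moments of powers of the cosine\<close>

lemma has_integral_cos_int:
  "((\<lambda>x. cos (of_int p * x)) has_integral (if p = 0 then pi else 0)) {0..pi}"
proof (cases "p = 0")
  case True
  thus ?thesis using has_integral_const_real[of "1::real" 0 pi] by simp
next
  case False
  have "((\<lambda>x. cos (of_int p * x)) has_integral (sin (of_int p * pi) / of_int p - sin (of_int p * 0) / of_int p)) {0..pi}"
  proof (rule fundamental_theorem_of_calculus)
    fix x assume "x \<in> {0..pi}"
    have "((\<lambda>x. sin (of_int p * x) / of_int p) has_field_derivative cos (of_int p * x)) (at x within {0..pi})"
      using False by (auto intro!: derivative_eq_intros)
    thus "((\<lambda>x. sin (of_int p * x) / of_int p) has_vector_derivative cos (of_int p * x)) (at x within {0..pi})"
      by (simp add: has_real_derivative_iff_has_vector_derivative)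
  qed simp
  thus ?thesis using False sin_npi_int[of p] by (simp add: mult.commute)
qed

lemma cos_power_expansion:
  "cos x ^ i = (\<Sum>l\<le>i. real (i choose l) / 2 ^ i * cos (of_int (2 * int l - int i) * x))"
proof -
  have "of_real (cos x ^ i) = ((cis x + cis (- x)) / 2) ^ i"
    by (simp add: complex_eq_iff flip: of_real_power)
  also have "\<dots> = (\<Sum>l\<le>i. of_nat (i choose l) * cis x ^ l * cis (- x) ^ (i - l)) / 2 ^ i"
    by (simp add: power_divide binomial_ring)
  also have "\<dots> = (\<Sum>l\<le>i. of_real (real (i choose l) / 2 ^ i) * cis (of_int (2 * int l - int i) * x))"
    unfolding sum_divide_distrib
  proof (intro sum.cong refl)
    fix l assume "l \<in> {..i}"
    hence "cis x ^ l * cis (- x) ^ (i - l) = cis (of_int (2 * int l - int i) * x)"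
      by (simp only: Complex.DeMoivre cis_mult) (simp add: of_nat_diff algebra_simps)
    thus "of_nat (i choose l) * cis x ^ l * cis (- x) ^ (i - l) / 2 ^ i
        = of_real (real (i choose l) / 2 ^ i) * cis (of_int (2 * int l - int i) * x)"
      by (simp add: mult.assoc)
  qed
  finally have "Re (of_real (cos x ^ i)) = Re (\<Sum>l\<le>i. of_real (real (i choose l) / 2 ^ i) * cis (of_int (2 * int l - int i) * x))"
    by (rule arg_cong)
  moreover have "Re (of_real r * cis t) = r * cos t" for r t by simp
  ultimately show ?thesis by (simp only: Re_sum Re_complex_of_real)
qed

lemma has_integral_cos_power_cos:
  "((\<lambda>x. cos x ^ i * cos (real n * x)) has_integral
     (\<Sum>l\<le>i. real (i choose l) / 2 ^ i * ((if i + n = 2 * l then pi / 2 else 0) + (if i = 2 * l + n then pi / 2 else 0)))) {0..pi}"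
proof -
  have "((\<lambda>x. \<Sum>l\<le>i. real (i choose l) / 2 ^ i * ((cos (of_int (2 * int l - int i - int n) * x)
       + cos (of_int (2 * int l - int i + int n) * x)) / 2)) has_integral
     (\<Sum>l\<le>i. real (i choose l) / 2 ^ i * (((if 2 * int l - int i - int n = 0 then pi else 0)
       + (if 2 * int l - int i + int n = 0 then pi else 0)) / 2))) {0..pi}"
    by (intro has_integral_sum has_integral_mult_right has_integral_divide has_integral_add has_integral_cos_int) auto
  also have "(\<lambda>x. \<Sum>l\<le>i. real (i choose l) / 2 ^ i * ((cos (of_int (2 * int l - int i - int n) * x)
       + cos (of_int (2 * int l - int i + int n) * x)) / 2)) = (\<lambda>x. cos x ^ i * cos (real n * x))"
  proof
    fix x :: real
    have "cos (of_int (2 * int l - int i) * x) * cos (real n * x) = (cos (of_int (2 * int l - int i - int n) * x)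
       + cos (of_int (2 * int l - int i + int n) * x)) / 2" for l
      unfolding cos_times_cos by (simp add: algebra_simps)
    thus "(\<Sum>l\<le>i. real (i choose l) / 2 ^ i * ((cos (of_int (2 * int l - int i - int n) * x)
       + cos (of_int (2 * int l - int i + int n) * x)) / 2)) = cos x ^ i * cos (real n * x)"
      unfolding cos_power_expansion[of x i] sum_distrib_right by (simp only: mult.assoc)
  qed
  also have "(\<Sum>l\<le>i. real (i choose l) / 2 ^ i * (((if 2 * int l - int i - int n = 0 then pi else 0)
       + (if 2 * int l - int i + int n = 0 then pi else 0)) / 2))
     = (\<Sum>l\<le>i. real (i choose l) / 2 ^ i * ((if i + n = 2 * l then pi / 2 else 0) + (if i = 2 * l + n then pi / 2 else 0)))"
  proof -
    have "2 * int l - int i - int n = 0 \<longleftrightarrow> i + n = 2 * l" "2 * int l - int i + int n = 0 \<longleftrightarrow> i = 2 * l + n" for l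
      by linarith+
    thus ?thesis by (simp only: add_divide_distrib if_distrib[of "\<lambda>x. x / 2"] div_0)
  qed
  finally show ?thesis .
qed

lemma has_integral_cos_power_cos_eq:
  "((\<lambda>x. cos x ^ (n + 2 * j) * cos (real n * x)) has_integral
     (pi / 2 ^ (n + 2 * j) * real ((n + 2 * j) choose j))) {0..pi}"
proof -
  let ?i = "n + 2 * j"
  \<comment> \<open>The two contributing indices are \<open>n + j\<close> and \<open>j\<close>. For
    \<open>n = 0\<close> they coincide, and the two separate indicators rightly count that index
    twice.\<close>
  have "(\<Sum>l\<le>?i. real (?i choose l) / 2 ^ ?i * ((if ?i + n = 2 * l then pi / 2 else 0) + (if ?i = 2 * l + n then pi / 2 else 0)))
     = (\<Sum>l\<le>?i. (if l = n + j then real (?i choose l) / 2 ^ ?i * (pi / 2) else 0)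
          + (if l = j then real (?i choose l) / 2 ^ ?i * (pi / 2) else 0))"
    by (intro sum.cong refl) (auto simp: algebra_simps)
  also have "\<dots> = real (?i choose (n + j)) / 2 ^ ?i * (pi / 2) + real (?i choose j) / 2 ^ ?i * (pi / 2)"
    by (simp add: sum.distrib)
  also have "?i choose (n + j) = ?i choose j"
    by (subst binomial_symmetric) auto
  also have "real (?i choose j) / 2 ^ ?i * (pi / 2) + real (?i choose j) / 2 ^ ?i * (pi / 2)
      = pi / 2 ^ ?i * real (?i choose j)" by simp
  finally show ?thesis using has_integral_cos_power_cos[of ?i n] by (simp only:)
qed

lemma has_integral_cos_power_cos_0:
  assumes "\<And>j. i \<noteq> n + 2 * j"
  shows "((\<lambda>x. cos x ^ i * cos (real n * x)) has_integral 0) {0..pi}"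
proof -
  have "i + n \<noteq> 2 * l" if "l \<le> i" for l
    using assms[of "l - n"] that by (cases "n \<le> l") auto
  moreover have "i \<noteq> 2 * l + n" for l using assms[of l] by simp
  ultimately have "(\<Sum>l\<le>i. real (i choose l) / 2 ^ i * ((if i + n = 2 * l then pi / 2 else 0) + (if i = 2 * l + n then pi / 2 else 0))) = 0"
    by (intro sum.neutral) auto
  with has_integral_cos_power_cos[of i n] show ?thesis by simp
qed


text \<open>
  The summands of the double series that arises from expanding
  \<open>(1 - B cos x) powr - (m + 1/2 + 2 k)\<close> in each term of the hypergeometric series.
\<close>

definition toroidal_coeff :: "nat \<Rightarrow> real \<Rightarrow> real \<Rightarrow> nat \<Rightarrow> nat \<Rightarrow> real" where
  "toroidal_coeff m A B k i = gauss_coeff ((real m + 3 / 2) / 2) ((real m + 1 / 2) / 2) m k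
     * (pochhammer (real m + 1 / 2 + 2 * real k) i / fact i) * A ^ (2 * k) * B ^ i"

lemma toroidal_coeff_nonneg: "A \<ge> 0 \<Longrightarrow> B \<ge> 0 \<Longrightarrow> toroidal_coeff m A B k i \<ge> 0"
  unfolding toroidal_coeff_def
  by (intro mult_nonneg_nonneg divide_nonneg_nonneg gauss_coeff_nonneg pochhammer_nonneg) auto

lemma sums_toroidal_coeff:
  assumes "\<bar>B * c\<bar> < 1"
  shows "(\<lambda>i. toroidal_coeff m A B k i * c ^ i) sums
    ((1 - B * c) powr - (real m + 1 / 2) * (gauss_coeff ((real m + 3 / 2) / 2) ((real m + 1 / 2) / 2) m k
       * ((A / (1 - B * c))\<^sup>2) ^ k))"
proof -
  define s where "s = real m + 1 / 2 + 2 * real k"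
  define G where "G = gauss_coeff ((real m + 3 / 2) / 2) ((real m + 1 / 2) / 2) m k"
  have pos: "1 - B * c > 0" using assms by linarith
  have "(\<lambda>i. ((-s) gchoose i) * (- (B * c)) ^ i) sums (1 + (- (B * c))) powr (-s)"
    by (rule gen_binomial_real) (use assms in simp)
  moreover have "((-s) gchoose i) * (- (B * c)) ^ i = pochhammer s i / fact i * (B * c) ^ i" for i
  proof -
    have "((-s) gchoose i) * (- (B * c)) ^ i = ((-1) ^ i * (- (B * c)) ^ i) * (pochhammer s i / fact i)"
      by (simp add: gbinomial_pochhammer)
    also have "(-1) ^ i * (- (B * c)) ^ i = (B * c) ^ i"
      by (simp flip: power_mult_distrib)
    finally show ?thesis by simp
  qed
  ultimately have "(\<lambda>i. (G * A ^ (2 * k)) * (pochhammer s i / fact i * (B * c) ^ i)) sums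
      ((G * A ^ (2 * k)) * (1 - B * c) powr (-s))"
    by (intro sums_mult) simp
  moreover have "(G * A ^ (2 * k)) * (pochhammer s i / fact i * (B * c) ^ i) = toroidal_coeff m A B k i * c ^ i" for i
    by (simp add: toroidal_coeff_def s_def G_def power_mult_distrib)
  moreover have "(G * A ^ (2 * k)) * (1 - B * c) powr (-s)
      = (1 - B * c) powr - (real m + 1 / 2) * (G * ((A / (1 - B * c))\<^sup>2) ^ k)"
  proof -
    have "-s = - (real m + 1 / 2) - real (2 * k)" by (simp add: s_def)
    hence "(1 - B * c) powr (-s) = (1 - B * c) powr - (real m + 1 / 2) / (1 - B * c) ^ (2 * k)"
      using pos by (simp only: powr_diff powr_realpow)
    moreover have "((A / (1 - B * c))\<^sup>2) ^ k = A ^ (2 * k) / (1 - B * c) ^ (2 * k)"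
      by (simp only: power_mult[symmetric] power_divide)
    ultimately show ?thesis by simp
  qed
  ultimately show ?thesis by (simp only: G_def[symmetric])
qed

text \<open>The hypothesis says that \<open>A / (1 - B * \<bar>c\<bar>) < 1\<close>, the condition
  for convergence of the Gauss series at \<open>\<bar>c\<bar>\<close>. There all terms are
  nonnegative, so iterated summability yields absolute summability of the double family, which
  transfers to \<open>c\<close>.\<close>

lemma toroidal_coeff_has_sum:
  assumes A: "A > 0" and B: "B \<ge> 0" and c: "A + B * \<bar>c\<bar> < 1"
  shows "((\<lambda>(k, i). toroidal_coeff m A B k i * c ^ i) has_sum
    ((1 - B * c) powr - (real m + 1 / 2) *
      (\<Sum>k. gauss_coeff ((real m + 3 / 2) / 2) ((real m + 1 / 2) / 2) m k * ((A / (1 - B * c))\<^sup>2) ^ k))) UNIV"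
    and "(\<lambda>(k, i). toroidal_coeff m A B k i * \<bar>c\<bar> ^ i) summable_on UNIV"
proof -
  let ?G = "gauss_coeff ((real m + 3 / 2) / 2) ((real m + 1 / 2) / 2) m"
  have nn: "toroidal_coeff m A B k i \<ge> 0" for k i
    using A B by (intro toroidal_coeff_nonneg) auto
  have sq1: "\<bar>(A / (1 - B * c))\<^sup>2\<bar> < 1" and Bc1: "\<bar>B * c\<bar> < 1" if "A + B * \<bar>c\<bar> < 1" for c
  proof -
    show "\<bar>B * c\<bar> < 1" using that A B by (simp add: abs_mult)
    have "B * c \<le> B * \<bar>c\<bar>" using B by (intro mult_left_mono) auto
    hence "A < 1 - B * c" using that by linarith
    hence "0 \<le> A / (1 - B * c)" "A / (1 - B * c) < 1" using A by auto
    hence "(A / (1 - B * c))\<^sup>2 < 1\<^sup>2" by (intro power_strict_mono) auto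
    thus "\<bar>(A / (1 - B * c))\<^sup>2\<bar> < 1" by (simp only: abs_power2 one_power2)
  qed
  have outer: "(\<lambda>k. (1 - B * c) powr - (real m + 1 / 2) * (?G k * ((A / (1 - B * c))\<^sup>2) ^ k)) sums
     ((1 - B * c) powr - (real m + 1 / 2) * (\<Sum>k. ?G k * ((A / (1 - B * c))\<^sup>2) ^ k))"
    if "A + B * \<bar>c\<bar> < 1" for c
    by (intro sums_mult summable_sums summable_gauss_coeff_real sq1 that) auto
  have Gnn: "?G k \<ge> 0" for k by (rule gauss_coeff_nonneg) auto
  have outer': "((\<lambda>k. (1 - B * c) powr - (real m + 1 / 2) * (?G k * ((A / (1 - B * c))\<^sup>2) ^ k)) has_sum
     ((1 - B * c) powr - (real m + 1 / 2) * (\<Sum>k. ?G k * ((A / (1 - B * c))\<^sup>2) ^ k))) UNIV"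
    if "A + B * \<bar>c\<bar> < 1" for c
    by (rule sums_nonneg_imp_has_sum[OF outer[OF that]]) (auto intro!: mult_nonneg_nonneg Gnn)
  have c': "A + B * \<bar>\<bar>c\<bar>\<bar> < 1" using c by simp
  have inner_abs: "((\<lambda>i. toroidal_coeff m A B k i * \<bar>c\<bar> ^ i) has_sum
      ((1 - B * \<bar>c\<bar>) powr - (real m + 1 / 2) * (?G k * ((A / (1 - B * \<bar>c\<bar>))\<^sup>2) ^ k))) UNIV" for k
    by (rule sums_nonneg_imp_has_sum[OF sums_toroidal_coeff[OF Bc1[OF c']]]) (auto intro!: mult_nonneg_nonneg nn)
  have "(\<lambda>(k, i). toroidal_coeff m A B k i * \<bar>c\<bar> ^ i) summable_on Sigma UNIV (\<lambda>_. UNIV)"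
    by (rule summable_on_SigmaI[where g = "\<lambda>k. (1 - B * \<bar>c\<bar>) powr - (real m + 1 / 2) * (?G k * ((A / (1 - B * \<bar>c\<bar>))\<^sup>2) ^ k)"])
       (use inner_abs has_sum_imp_summable[OF outer'[OF c']] in \<open>auto intro!: mult_nonneg_nonneg nn\<close>)
  thus abs: "(\<lambda>(k, i). toroidal_coeff m A B k i * \<bar>c\<bar> ^ i) summable_on UNIV" by simp
  hence sm: "(\<lambda>(k, i). toroidal_coeff m A B k i * c ^ i) summable_on UNIV"
    by (intro abs_summable_summable[where f = "\<lambda>(k, i). toroidal_coeff m A B k i * c ^ i"])
       (simp add: case_prod_unfold abs_mult power_abs nn)
  have inner: "((\<lambda>i. toroidal_coeff m A B k i * c ^ i) has_sum
      ((1 - B * c) powr - (real m + 1 / 2) * (?G k * ((A / (1 - B * c))\<^sup>2) ^ k))) UNIV" for k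
  proof (rule norm_summable_imp_has_sum)
    have "summable (\<lambda>i. toroidal_coeff m A B k i * \<bar>c\<bar> ^ i)"
      using inner_abs[of k] has_sum_imp_sums sums_summable by blast
    thus "summable (\<lambda>i. norm (toroidal_coeff m A B k i * c ^ i))"
      by (simp add: abs_mult power_abs nn)
    show "(\<lambda>i. toroidal_coeff m A B k i * c ^ i) sums
      ((1 - B * c) powr - (real m + 1 / 2) * (?G k * ((A / (1 - B * c))\<^sup>2) ^ k))"
      by (rule sums_toroidal_coeff[OF Bc1[OF c]])
  qed
  have "((\<lambda>(k, i). toroidal_coeff m A B k i * c ^ i) has_sum
     ((1 - B * c) powr - (real m + 1 / 2) * (\<Sum>k. ?G k * ((A / (1 - B * c))\<^sup>2) ^ k))) (Sigma UNIV (\<lambda>_. UNIV))"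
    by (rule has_sum_SigmaI[OF _ outer'[OF c]]) (use inner sm in auto)
  thus "((\<lambda>(k, i). toroidal_coeff m A B k i * c ^ i) has_sum
     ((1 - B * c) powr - (real m + 1 / 2) * (\<Sum>k. ?G k * ((A / (1 - B * c))\<^sup>2) ^ k))) UNIV" by simp
qed

text \<open>With \<open>\<mu> = m + 1/2\<close> the two Pochhammer symbols combine to the one of
  length \<open>n + 2 (k + j)\<close>, which is split again as \<open>pochhammer \<mu> n\<close>
  times that of \<open>\<mu> + n\<close> of length \<open>2 (k + j)\<close>. Duplication of the
  latter produces the Appell parameters.\<close>

lemma toroidal_coeff_cos_integral:
  "toroidal_coeff m A B k (n + 2 * j) * (pi / 2 ^ (n + 2 * j) * real ((n + 2 * j) choose j))
     = pi * (B / 2) ^ n * pochhammer (real m + 1 / 2) n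
       * (appell_coeff ((real (m + n) + 3 / 2) / 2) ((real (m + n) + 1 / 2) / 2) m n k j * (A\<^sup>2) ^ k * (B\<^sup>2) ^ j)"
proof -
  define \<mu> where "\<mu> = real m + 1 / 2"
  have dbl: "pochhammer ((x + 1) / 2) l * pochhammer (x / 2) l = pochhammer x (2 * l) / 4 ^ l" for x :: real and l
  proof -
    have "of_nat (2 ^ (2 * l)) = (4 :: real) ^ l" "x / 2 + 1 / 2 = (x + 1) / 2" "2 * (x / 2) = x"
      by (simp_all add: power_mult add_divide_distrib)
    hence "pochhammer x (2 * l) = 4 ^ l * pochhammer (x / 2) l * pochhammer ((x + 1) / 2) l"
      using pochhammer_double[of "x / 2" l] by (simp only:)
    thus ?thesis by simp
  qed
  have g: "gauss_coeff ((real m + 3 / 2) / 2) ((real m + 1 / 2) / 2) m k = pochhammer \<mu> (2 * k) / 4 ^ k / (fact k * fact (m + k))"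
    using dbl[of \<mu> k] by (simp add: gauss_coeff_def \<mu>_def add.assoc)
  have a: "appell_coeff ((real (m + n) + 3 / 2) / 2) ((real (m + n) + 1 / 2) / 2) m n k j
      = pochhammer (\<mu> + real n) (2 * (k + j)) / 4 ^ (k + j) / (fact k * fact (m + k) * fact j * fact (n + j))"
    using dbl[of "\<mu> + real n" "k + j"] by (simp add: appell_coeff_def \<mu>_def add_ac)
  have p1: "pochhammer \<mu> (2 * k) * pochhammer (\<mu> + 2 * real k) (n + 2 * j) = pochhammer \<mu> (2 * k + (n + 2 * j))"
    using pochhammer_product'[of \<mu> "2 * k" "n + 2 * j"] by simp
  have p2: "pochhammer \<mu> n * pochhammer (\<mu> + real n) (2 * (k + j)) = pochhammer \<mu> (n + 2 * (k + j))"
    using pochhammer_product'[of \<mu> n "2 * (k + j)"] by simp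
  have p: "pochhammer \<mu> (2 * k) * pochhammer (\<mu> + 2 * real k) (n + 2 * j) = pochhammer \<mu> n * pochhammer (\<mu> + real n) (2 * (k + j))"
    unfolding p1 p2 by (simp add: algebra_simps)
  have b: "real ((n + 2 * j) choose j) = fact (n + 2 * j) / (fact j * fact (n + j))"
    by (subst binomial_fact) (auto simp: mult_2)
  have "toroidal_coeff m A B k (n + 2 * j) * (pi / 2 ^ (n + 2 * j) * real ((n + 2 * j) choose j))
     = pi * A ^ (2 * k) * B ^ (n + 2 * j) * (pochhammer \<mu> (2 * k) * pochhammer (\<mu> + 2 * real k) (n + 2 * j))
        / (4 ^ k * 2 ^ (n + 2 * j) * fact k * fact (m + k) * fact j * fact (n + j))"
    unfolding toroidal_coeff_def g b unfolding \<mu>_def[symmetric] by (simp add: mult_ac)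
  also have "\<dots> = pi * (B / 2) ^ n * pochhammer \<mu> n
       * (pochhammer (\<mu> + real n) (2 * (k + j)) / 4 ^ (k + j) / (fact k * fact (m + k) * fact j * fact (n + j)) * (A\<^sup>2) ^ k * (B\<^sup>2) ^ j)"
    unfolding p by (simp add: power_add power_mult power_divide) (simp only: mult_ac)
  finally show ?thesis unfolding a \<mu>_def .
qed


text \<open>
  The even absolute moments of the cosine are the integrals occurring for \<open>n = 0\<close>, and the odd
  ones are at most twice those for \<open>n = 1\<close>, so both halves reduce to a convergent Appell series.
\<close>

lemma toroidal_coeff_summable_on:
  assumes A: "A > 0" and B: "B \<ge> 0"
    and app: "\<And>n. (\<lambda>(k, j). appell_coeff ((real (m + n) + 3 / 2) / 2) ((real (m + n) + 1 / 2) / 2) m n k j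
         * (A\<^sup>2) ^ k * (B\<^sup>2) ^ j) summable_on UNIV"
  shows "(\<lambda>(k, i). toroidal_coeff m A B k i * integral {0..pi} (\<lambda>x. \<bar>cos x\<bar> ^ i)) summable_on UNIV"
proof -
  define w where "w i = integral {0..pi} (\<lambda>x. \<bar>cos x\<bar> ^ i)" for i :: nat
  define f where "f = (\<lambda>(k, i). toroidal_coeff m A B k i * w i)"
  have nn: "toroidal_coeff m A B k i \<ge> 0" for k i
    using A B by (intro toroidal_coeff_nonneg) auto
  have w_int: "(\<lambda>x. \<bar>cos x\<bar> ^ i) integrable_on {0..pi}" for i :: nat
    by (intro integrable_continuous_real continuous_intros)
  have w0: "w i \<ge> 0" for i
    unfolding w_def by (intro integral_nonneg w_int) auto
  have w_even: "w (2 * j) = pi / 2 ^ (2 * j) * real ((2 * j) choose j)" for j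
  proof -
    have "(\<lambda>x. \<bar>cos x\<bar> ^ (2 * j)) = (\<lambda>x::real. cos x ^ (2 * j))"
      by (simp add: power_mult)
    thus ?thesis using has_integral_cos_power_cos_eq[of 0 j] by (simp add: w_def integral_unique)
  qed
  have w_odd: "w (1 + 2 * j) \<le> 2 * (pi / 2 ^ (1 + 2 * j) * real ((1 + 2 * j) choose j))" for j
  proof -
    have "w (1 + 2 * j) \<le> w (2 * j)"
      unfolding w_def by (intro integral_le w_int power_decreasing) auto
    also have "\<dots> \<le> pi / 2 ^ (2 * j) * real ((1 + 2 * j) choose j)"
    proof -
      have "(2 * j) choose j \<le> (1 + 2 * j) choose j" by (cases j) simp_all
      thus ?thesis unfolding w_even by (intro mult_left_mono of_nat_mono) auto
    qed
    finally show ?thesis by simp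
  qed
  have J: "(\<lambda>(k, j). toroidal_coeff m A B k (n + 2 * j) * (pi / 2 ^ (n + 2 * j) * real ((n + 2 * j) choose j))) summable_on UNIV" for n
    unfolding toroidal_coeff_cos_integral
    using summable_on_cmult_right[OF app[of n], of "pi * (B / 2) ^ n * pochhammer (real m + 1 / 2) n"]
    by (simp add: case_prod_unfold)
  have even: "f summable_on (\<lambda>(k, j). (k, 2 * j)) ` UNIV"
  proof (subst summable_on_reindex)
    show "inj (\<lambda>(k, j). (k :: nat, 2 * j :: nat))" by (auto simp: inj_on_def)
    show "f \<circ> (\<lambda>(k, j). (k, 2 * j)) summable_on UNIV"
      using J[of 0] by (simp add: f_def w_even case_prod_unfold o_def)
  qed
  have odd: "f summable_on (\<lambda>(k, j). (k, 1 + 2 * j)) ` UNIV"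
  proof (subst summable_on_reindex)
    show "inj (\<lambda>(k, j). (k :: nat, 1 + 2 * j :: nat))" by (auto simp: inj_on_def)
    show "f \<circ> (\<lambda>(k, j). (k, 1 + 2 * j)) summable_on UNIV"
    proof (rule summable_on_comparison_test[OF summable_on_cmult_right[OF J[of 1], of 2]])
      fix p :: "nat \<times> nat"
      obtain k j where p: "p = (k, j)" by (cases p)
      show "0 \<le> (f \<circ> (\<lambda>(k, j). (k, 1 + 2 * j))) p"
        by (simp add: f_def p nn w0 del: One_nat_def)
      have "toroidal_coeff m A B k (1 + 2 * j) * w (1 + 2 * j)
          \<le> toroidal_coeff m A B k (1 + 2 * j) * (2 * (pi / 2 ^ (1 + 2 * j) * real ((1 + 2 * j) choose j)))"
        by (intro mult_left_mono w_odd nn)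
      thus "(f \<circ> (\<lambda>(k, j). (k, 1 + 2 * j))) p
          \<le> 2 * (case p of (k, j) \<Rightarrow> toroidal_coeff m A B k (1 + 2 * j) * (pi / 2 ^ (1 + 2 * j) * real ((1 + 2 * j) choose j)))"
        by (simp only: f_def p o_def case_prod_conv mult_ac)
    qed
  qed
  have "(UNIV :: (nat \<times> nat) set) = (\<lambda>(k, j). (k, 2 * j)) ` UNIV \<union> (\<lambda>(k, j). (k, 1 + 2 * j)) ` UNIV"
  proof -
    have "(k, i) \<in> (\<lambda>(k, j). (k, 2 * j)) ` UNIV \<union> (\<lambda>(k, j). (k, 1 + 2 * j)) ` UNIV" for k i :: nat
    proof (cases "even i")
      case True
      then obtain j where "i = 2 * j" by (auto elim: evenE)
      hence "(k, i) = (\<lambda>(k, j). (k, 2 * j)) (k, j)" by simp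
      thus ?thesis by blast
    next
      case False
      then obtain j where "i = 1 + 2 * j" by (auto elim: oddE)
      hence "(k, i) = (\<lambda>(k, j). (k, 1 + 2 * j)) (k, j)" by simp
      thus ?thesis by blast
    qed
    thus ?thesis by auto
  qed
  with summable_on_union[OF even odd] have "f summable_on UNIV" by simp
  thus ?thesis by (simp add: f_def w_def)
qed

text \<open>The theorem for nonnegative integers with Legendre functions removed: up to a constant
  factor the integrand is the series of \<open>Q\<close> in powers of
  \<open>1 / \<chi>\<^sup>2\<close>, where \<open>1 / \<chi> = A / (1 - B cos x)\<close>.\<close>

proposition toroidal_integral:
  fixes m n :: nat and X Y :: real
  assumes XY: "0 < X" "0 < Y" "X + Y \<le> 1"
  defines "A \<equiv> sqrt (X * (1 - Y))" and "B \<equiv> sqrt (Y * (1 - X))"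
    and "a \<equiv> (real (m + n) + 3 / 2) / 2" and "b \<equiv> (real (m + n) + 1 / 2) / 2"
  shows "((\<lambda>x. (1 - B * cos x) powr - (real m + 1 / 2) *
      (\<Sum>k. gauss_coeff ((real m + 3 / 2) / 2) ((real m + 1 / 2) / 2) m k * ((A / (1 - B * cos x))\<^sup>2) ^ k)
        * cos (real n * x)) has_integral
     (pi * (B / 2) ^ n * pochhammer (real m + 1 / 2) n
       * ((\<Sum>k. gauss_coeff a b m k * X ^ k) * (\<Sum>k. gauss_coeff a b n k * Y ^ k)))) {0..pi}"
proof -
  have XY': "X < 1" "Y < 1" using XY by auto
  have A: "A > 0" and B: "B > 0" using XY XY' by (auto simp: A_def B_def)
  have A2: "A\<^sup>2 = X * (1 - Y)" "B\<^sup>2 = Y * (1 - X)" using XY XY' by (auto simp: A_def B_def)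
  have AB: "A + B \<le> 1"
  proof -
    have "A \<le> (X + (1 - Y)) / 2" "B \<le> (Y + (1 - X)) / 2"
      unfolding A_def B_def using XY XY' by (intro arith_geo_mean_sqrt; simp)+
    hence "A + B \<le> (X + (1 - Y)) / 2 + (Y + (1 - X)) / 2" by (rule add_mono)
    thus ?thesis by (simp add: field_simps)
  qed
  have app: "((\<lambda>(k, j). appell_coeff ((real (m + l) + 3 / 2) / 2) ((real (m + l) + 1 / 2) / 2) m l k j
         * (A\<^sup>2) ^ k * (B\<^sup>2) ^ j) has_sum
     ((\<Sum>k. gauss_coeff ((real (m + l) + 3 / 2) / 2) ((real (m + l) + 1 / 2) / 2) m k * X ^ k)
       * (\<Sum>k. gauss_coeff ((real (m + l) + 3 / 2) / 2) ((real (m + l) + 1 / 2) / 2) l k * Y ^ k))) UNIV" for l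
    unfolding A2 by (rule appell_factorization_has_sum) (use XY in \<open>auto simp: field_simps\<close>)
  \<comment> \<open>Pairs are enumerated by \<open>prod_decode\<close>, so that a single interchange
    of series and integral treats the double series.\<close>
  define f where "f p x = (case prod_decode p of (k, i) \<Rightarrow> toroidal_coeff m A B k i * (cos x ^ i * cos (real n * x)))" for p x
  define j where "j i = (if \<exists>j. i = n + 2 * j then pi / 2 ^ i * real (i choose ((i - n) div 2)) else 0)" for i
  define J where "J p = (case prod_decode p of (k, i) \<Rightarrow> toroidal_coeff m A B k i * j i)" for p
  define C where "C = pi * (B / 2) ^ n * pochhammer (real m + 1 / 2) n"
  define S where "S = (\<Sum>k. gauss_coeff a b m k * X ^ k) * (\<Sum>k. gauss_coeff a b n k * Y ^ k)"
  define F where "F x = (1 - B * cos x) powr - (real m + 1 / 2) *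
      (\<Sum>k. gauss_coeff ((real m + 3 / 2) / 2) ((real m + 1 / 2) / 2) m k * ((A / (1 - B * cos x))\<^sup>2) ^ k)" for x
  have nn: "toroidal_coeff m A B k i \<ge> 0" for k i
    using A B by (intro toroidal_coeff_nonneg) auto
  have bij: "bij_betw prod_decode UNIV UNIV" by (rule bij_prod_decode)
  \<comment> \<open>\<open>A + B\<close> equals 1 on the boundary \<open>X + Y = 1\<close>;
    strictness then comes from \<open>\<bar>cos x\<bar> < 1\<close> in the open interval.\<close>
  have cos1: "A + B * \<bar>cos x\<bar> < 1" if "x \<in> {0<..<pi}" for x
  proof -
    have "(cos x)\<^sup>2 < 1" using sin_gt_zero[of x] that by (simp add: cos_squared_eq)
    hence "\<bar>cos x\<bar> < 1" by (simp add: abs_square_less_1)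
    hence "B * \<bar>cos x\<bar> < B" using B by simp
    thus ?thesis using AB by linarith
  qed
  have "((\<lambda>x. F x * cos (real n * x)) has_integral C * S) {0..pi}"
  proof (rule has_integral_suminf[where f = f and J = J])
    show "continuous_on {0..pi} (f p)" for p
      unfolding f_def by (cases "prod_decode p") (auto intro!: continuous_intros)
    fix x assume x: "x \<in> {0<..<pi}"
    have "((\<lambda>(k, i). toroidal_coeff m A B k i * cos x ^ i) has_sum F x) UNIV"
      unfolding F_def using A B cos1[OF x] by (intro toroidal_coeff_has_sum) auto
    hence "((\<lambda>p. (case prod_decode p of (k, i) \<Rightarrow> toroidal_coeff m A B k i * cos x ^ i)) has_sum F x) UNIV"
      by (subst has_sum_reindex_bij_betw[OF bij])
    hence "(\<lambda>p. (case prod_decode p of (k, i) \<Rightarrow> toroidal_coeff m A B k i * cos x ^ i) * cos (real n * x)) sums (F x * cos (real n * x))"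
      by (intro sums_mult2 has_sum_imp_sums)
    thus "(\<lambda>p. f p x) sums (F x * cos (real n * x))"
      by (simp add: f_def case_prod_unfold mult.assoc)
    have "(\<lambda>(k, i). toroidal_coeff m A B k i * \<bar>cos x\<bar> ^ i) summable_on UNIV"
      using A B cos1[OF x] by (intro toroidal_coeff_has_sum) auto
    hence "(\<lambda>p. (case prod_decode p of (k, i) \<Rightarrow> toroidal_coeff m A B k i * \<bar>cos x\<bar> ^ i)) summable_on UNIV"
      by (subst summable_on_reindex_bij_betw[OF bij])
    hence "summable (\<lambda>p. (case prod_decode p of (k, i) \<Rightarrow> toroidal_coeff m A B k i * \<bar>cos x\<bar> ^ i))"
      by (rule summable_on_imp_summable)
    thus "summable (\<lambda>p. \<bar>f p x\<bar>)"
    proof (rule summable_comparison_test'[where N = 0])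
      fix p
      show "norm \<bar>f p x\<bar> \<le> (case prod_decode p of (k, i) \<Rightarrow> toroidal_coeff m A B k i * \<bar>cos x\<bar> ^ i)"
        using nn by (auto simp: f_def abs_mult power_abs mult_left_le intro!: mult_left_mono split: prod.split)
    qed
  next
    have "(\<lambda>(k, i). toroidal_coeff m A B k i * integral {0..pi} (\<lambda>x. \<bar>cos x\<bar> ^ i)) summable_on UNIV"
      using A B app has_sum_imp_summable by (intro toroidal_coeff_summable_on) auto
    hence "(\<lambda>p. (case prod_decode p of (k, i) \<Rightarrow> toroidal_coeff m A B k i * integral {0..pi} (\<lambda>x. \<bar>cos x\<bar> ^ i))) summable_on UNIV"
      by (subst summable_on_reindex_bij_betw[OF bij])
    hence "summable (\<lambda>p. (case prod_decode p of (k, i) \<Rightarrow> toroidal_coeff m A B k i * integral {0..pi} (\<lambda>x. \<bar>cos x\<bar> ^ i)))"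
      by (rule summable_on_imp_summable)
    thus "summable (\<lambda>p. integral {0..pi} (\<lambda>x. \<bar>f p x\<bar>))"
    proof (rule summable_comparison_test'[where N = 0])
      fix p
      obtain k i where p: "prod_decode p = (k, i)" by (cases "prod_decode p")
      have "integral {0..pi} (\<lambda>x. \<bar>f p x\<bar>) \<le> integral {0..pi} (\<lambda>x. toroidal_coeff m A B k i * \<bar>cos x\<bar> ^ i)"
      proof (rule integral_le)
        show "(\<lambda>x. \<bar>f p x\<bar>) integrable_on {0..pi}"
          unfolding f_def p by (auto intro!: integrable_continuous_real continuous_intros)
        show "(\<lambda>x. toroidal_coeff m A B k i * \<bar>cos x\<bar> ^ i) integrable_on {0..pi}"
          by (intro integrable_continuous_real continuous_intros)
        show "\<bar>f p x\<bar> \<le> toroidal_coeff m A B k i * \<bar>cos x\<bar> ^ i" for x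
          using nn[of k i] by (auto simp: f_def p abs_mult power_abs mult_left_le intro!: mult_left_mono)
      qed
      moreover have "0 \<le> integral {0..pi} (\<lambda>x. \<bar>f p x\<bar>)"
        by (intro integral_nonneg) (auto simp: f_def p intro!: integrable_continuous_real continuous_intros)
      ultimately show "norm (integral {0..pi} (\<lambda>x. \<bar>f p x\<bar>)) \<le>
          (case prod_decode p of (k, i) \<Rightarrow> toroidal_coeff m A B k i * integral {0..pi} (\<lambda>x. \<bar>cos x\<bar> ^ i))"
        by (simp add: p)
    qed
  next
    fix p
    obtain k i where p: "prod_decode p = (k, i)" by (cases "prod_decode p")
    have "((\<lambda>x. cos x ^ i * cos (real n * x)) has_integral j i) {0..pi}"
    proof (cases "\<exists>j. i = n + 2 * j")
      case True
      then obtain l where "i = n + 2 * l" by blast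
      thus ?thesis using has_integral_cos_power_cos_eq[of n l] by (simp add: j_def)
    next
      case False
      thus ?thesis using has_integral_cos_power_cos_0[of i n] by (simp add: j_def)
    qed
    hence "((\<lambda>x. toroidal_coeff m A B k i * (cos x ^ i * cos (real n * x))) has_integral toroidal_coeff m A B k i * j i) {0..pi}"
      by (rule has_integral_mult_right)
    thus "(f p has_integral J p) {0..pi}" unfolding f_def J_def p by simp
  next
    \<comment> \<open>The moment \<open>j i\<close> vanishes unless \<open>i = n + 2 l\<close>, so
      the sum over all pairs is the Appell sum transported along this injection.\<close>
    let ?h = "\<lambda>(k, l). (k :: nat, n + 2 * l :: nat)"
    have "((\<lambda>p. C * (case p of (k, l) \<Rightarrow> appell_coeff a b m n k l * (A\<^sup>2) ^ k * (B\<^sup>2) ^ l)) has_sum C * S) UNIV"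
      unfolding S_def a_def b_def by (intro has_sum_cmult_right app)
    moreover have "C * (case p of (k, l) \<Rightarrow> appell_coeff a b m n k l * (A\<^sup>2) ^ k * (B\<^sup>2) ^ l)
        = ((\<lambda>(k, i). toroidal_coeff m A B k i * j i) \<circ> ?h) p" for p
    proof -
      obtain k l where p: "p = (k, l)" by (cases p)
      have "j (n + 2 * l) = pi / 2 ^ (n + 2 * l) * real ((n + 2 * l) choose l)" by (simp add: j_def)
      thus ?thesis
        by (simp only: p case_prod_conv o_def toroidal_coeff_cos_integral C_def a_def b_def)
    qed
    ultimately have "((\<lambda>(k, i). toroidal_coeff m A B k i * j i) \<circ> ?h has_sum C * S) UNIV"
      by (simp add: o_def)
    hence "((\<lambda>(k, i). toroidal_coeff m A B k i * j i) has_sum C * S) (?h ` UNIV)"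
      by (subst has_sum_reindex) (auto simp: inj_on_def)
    moreover have "((\<lambda>(k, i). toroidal_coeff m A B k i * j i) has_sum C * S) (?h ` UNIV)
        \<longleftrightarrow> ((\<lambda>(k, i). toroidal_coeff m A B k i * j i) has_sum C * S) UNIV"
      by (rule has_sum_cong_neutral) (auto simp: j_def image_iff)
    ultimately have "((\<lambda>(k, i). toroidal_coeff m A B k i * j i) has_sum C * S) UNIV" by simp
    hence "(J has_sum C * S) UNIV"
      unfolding J_def by (subst has_sum_reindex_bij_betw[OF bij])
    thus "J sums (C * S)" by (rule has_sum_imp_sums)
  qed
  thus ?thesis by (simp only: F_def C_def S_def)
qed


section \<open>Legendre functions of half-integer degree\<close>

lemma half_int_notin_Ints: "of_int p + 1 / 2 \<notin> (\<int> :: complex set)"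
proof
  assume "of_int p + 1 / 2 \<in> (\<int> :: complex set)"
  then obtain q where "of_int p + 1 / 2 = (of_int q :: complex)" by (auto elim: Ints_cases)
  hence "of_int (2 * p + 1) = (of_int (2 * q) :: complex)" by (simp add: field_simps)
  hence "2 * p + 1 = 2 * q" by (simp only: of_int_eq_iff)
  thus False by presburger
qed

lemma half_int_notin_nonpos_Ints: "of_int p + 1 / 2 \<notin> (\<int>\<^sub>\<le>\<^sub>0 :: complex set)"
  using half_int_notin_Ints[of p] nonpos_Ints_subset_Ints by blast

lemma Gamma_half_int_nonzero: "Gamma (of_int p + 1 / 2 :: complex) \<noteq> 0"
  using half_int_notin_nonpos_Ints[of p] by (simp add: Gamma_eq_zero_iff)

lemma Gamma_half_int_reflection:
  "Gamma (of_int p + 1 / 2 :: complex) * Gamma (of_int (- p) + 1 / 2) = of_real pi * (-1) powi p"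
proof -
  have "Gamma (of_int p + 1 / 2 :: complex) * Gamma (1 - (of_int p + 1 / 2))
      = of_real pi / sin (of_real pi * (of_int p + 1 / 2))"
    by (rule Gamma_reflection_complex)
  also have "of_real pi * (of_int p + 1 / 2) = complex_of_real (pi * of_int p + pi / 2)"
    by (simp add: algebra_simps)
  also have "sin \<dots> = of_real (cos (pi * of_int p))"
    by (simp only: sin_of_real) (simp add: sin_add)
  also have "cos (pi * of_int p) = (-1) powi p"
    by (cases "even p") (simp_all add: cos_npi_int)
  also have "of_real pi / complex_of_real ((-1) powi p) = of_real pi * (-1) powi p"
    by (cases "even p") simp_all
  finally show ?thesis by (simp add: algebra_simps)
qed

lemma hyp2F1_reg_of_real:
  fixes a b x :: real
  assumes "\<bar>x\<bar> < 1"
  shows "hyp2F1_reg (of_real a) (of_real b) (1 + of_nat m) (of_real x)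
     = of_real (\<Sum>k. gauss_coeff a b m k * x ^ k)"
proof -
  have r: "rGamma (1 + of_nat m + of_nat k) = (inverse (fact (m + k)) :: complex)" for k
  proof -
    have "1 + of_nat m + of_nat k = (1 + of_nat (m + k) :: complex)" by simp
    thus ?thesis by (simp only: rGamma_inverse_Gamma Gamma_fact)
  qed
  have "hyp2F1_coeff (of_real a) (of_real b) (1 + of_nat m) k = of_real (gauss_coeff a b m k)" for k
    unfolding hyp2F1_coeff_def gauss_coeff_def r pochhammer_of_real by (simp add: divide_inverse)
  hence "(\<lambda>k. complex_of_real (gauss_coeff a b m k * x ^ k)) sums
      hyp2F1_reg (of_real a) (of_real b) (1 + of_nat m) (of_real x)"
    using hyp2F1_reg_sums[of "of_real b" "1 + of_nat m" "of_real x" "of_real a"] assms by simp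
  moreover from this have "summable (\<lambda>k. gauss_coeff a b m k * x ^ k)"
    using sums_summable summable_complex_of_real by blast
  hence "(\<lambda>k. complex_of_real (gauss_coeff a b m k * x ^ k)) sums of_real (\<Sum>k. gauss_coeff a b m k * x ^ k)"
    unfolding sums_of_real_iff by (rule summable_sums)
  ultimately show ?thesis by (rule sums_unique2)
qed

section \<open>Dependence of the Legendre functions on the signs of degree and order\<close>

lemma inverse_square_in_hyp_domain:
  assumes "x > (1::real)"
  shows "1 / (of_real x)\<^sup>2 \<in> hyp_domain"
proof -
  have "norm (1 / (complex_of_real x)\<^sup>2) = 1 / x\<^sup>2"
    by (simp add: norm_divide norm_power)
  also have "\<dots> < 1" using assms by (simp add: power_less_one_iff one_less_power)
  finally show ?thesis using ball_subset_hyp_domain by auto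
qed

text \<open>In degree \<open>- N - 1/2\<close> the lower parameter is \<open>1 - N\<close>, so the
  series starts with the power \<open>N\<close> of \<open>1 / z\<^sup>2\<close>. By duplication the
  extracted Pochhammer symbols turn \<open>Gamma p\<close> into \<open>Gamma (p + 2 N)\<close> over
  \<open>4 ^ N\<close>, and the powers of \<open>z\<close> and 2 match as well. As \<open>p\<close>
  is a half-integer, no pole of Gamma is met.\<close>

lemma legendreQ_minus_half_int:
  assumes x: "x > (1::real)"
  shows "legendreQ (- of_nat N - 1 / 2) (of_int m) (of_real x) = legendreQ (of_nat N - 1 / 2) (of_int m) (of_real x)"
proof -
  define z where "z = complex_of_real x"
  have z: "z \<noteq> 0" using x by (simp add: z_def)
  define p :: complex where "p = of_int (m - int N) + 1 / 2"
  define y where "y = 1 / z\<^sup>2"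
  define E where "E = exp (of_int m * of_real pi * \<i>) * of_real (sqrt pi) * (z\<^sup>2 - 1) powr (of_int m / 2)"
  define R where "R = hyp2F1_reg ((p + 1) / 2 + of_nat N) (p / 2 + of_nat N) (1 + of_nat N) y"
  have yd: "y \<in> hyp_domain" unfolding y_def z_def by (rule inverse_square_in_hyp_domain[OF x])
  have pR: "p / 2 \<in> \<real>" by (simp add: p_def)
  have L: "legendreQ (- of_nat N - 1 / 2) (of_int m) z
      = E * Gamma p / (2 powr (1 / 2 - of_nat N) * z powr p) * hyp2F1_reg ((p + 1) / 2) (p / 2) (1 - of_nat N) y"
  proof -
    have "- of_nat N - 1 / 2 + of_int m + 1 = p" "(- of_nat N - 1 / 2 + of_int m) / 2 + 1 = (p + 1) / 2"
      "(- of_nat N - 1 / 2 + of_int m + 1) / 2 = p / 2" "- of_nat N - 1 / 2 + 1 = (1 / 2 - of_nat N :: complex)"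
      "- of_nat N - 1 / 2 + 3 / 2 = (1 - of_nat N :: complex)"
      by (simp_all add: p_def field_simps)
    thus ?thesis unfolding legendreQ_def E_def y_def by (simp only: mult_ac)
  qed
  have Rt: "legendreQ (of_nat N - 1 / 2) (of_int m) z
      = E * Gamma (p + of_nat (2 * N)) / (2 powr (1 / 2 + of_nat N) * z powr (p + of_nat (2 * N))) * R"
  proof -
    have "of_nat N - 1 / 2 + of_int m + 1 = p + of_nat (2 * N)" "(of_nat N - 1 / 2 + of_int m) / 2 + 1 = (p + 1) / 2 + of_nat N"
      "(of_nat N - 1 / 2 + of_int m + 1) / 2 = p / 2 + of_nat N" "of_nat N - 1 / 2 + 1 = (1 / 2 + of_nat N :: complex)"
      "of_nat N - 1 / 2 + 3 / 2 = (1 + of_nat N :: complex)"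
      by (simp_all add: p_def field_simps)
    thus ?thesis unfolding legendreQ_def E_def y_def R_def by (simp only: mult_ac)
  qed
  have H: "hyp2F1_reg ((p + 1) / 2) (p / 2) (1 - of_nat N) y
      = pochhammer ((p + 1) / 2) N * pochhammer (p / 2) N * y ^ N * R"
    unfolding R_def by (rule hyp2F1_reg_nonpos_int[OF pR yd])
  have P: "Gamma p * (pochhammer ((p + 1) / 2) N * pochhammer (p / 2) N) = Gamma (p + of_nat (2 * N)) / 4 ^ N"
  proof -
    have "of_nat (2 ^ (2 * N)) = (4 :: complex) ^ N" "p / 2 + 1 / 2 = (p + 1) / 2" "2 * (p / 2) = p"
      by (simp_all add: power_mult add_divide_distrib)
    hence "pochhammer p (2 * N) = 4 ^ N * pochhammer (p / 2) N * pochhammer ((p + 1) / 2) N"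
      using pochhammer_double[of "p / 2" N] by (simp only:)
    moreover have "pochhammer p (2 * N) = Gamma (p + of_nat (2 * N)) / Gamma p"
      unfolding p_def by (rule pochhammer_Gamma[OF half_int_notin_nonpos_Ints])
    moreover have "Gamma p \<noteq> 0" unfolding p_def by (rule Gamma_half_int_nonzero)
    ultimately show ?thesis by (simp add: field_simps)
  qed
  have Z: "z powr (p + of_nat (2 * N)) = z powr p * z ^ (2 * N)"
    using z by (simp only: powr_add) (subst powr_nat', auto)
  have T: "2 powr (1 / 2 + of_nat N) = 2 powr (1 / 2 - of_nat N) * (4 :: complex) ^ N"
  proof -
    have "1 / 2 + of_nat N = (1 / 2 - of_nat N) + (of_nat (2 * N) :: complex)" by simp
    hence "2 powr (1 / 2 + of_nat N) = 2 powr (1 / 2 - of_nat N) * (2 :: complex) powr (of_nat (2 * N))"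
      by (simp only: powr_add)
    also have "(2 :: complex) powr (of_nat (2 * N)) = 2 ^ (2 * N)" by (subst powr_nat') auto
    finally show ?thesis by (simp add: power_mult)
  qed
  have Y: "y ^ N = 1 / z ^ (2 * N)" by (simp add: y_def power_divide power_mult)
  have "legendreQ (- of_nat N - 1 / 2) (of_int m) z = E * (Gamma p * (pochhammer ((p + 1) / 2) N * pochhammer (p / 2) N))
        * R / (2 powr (1 / 2 - of_nat N) * z powr p * z ^ (2 * N))"
    unfolding L H Y by simp
  also have "\<dots> = legendreQ (of_nat N - 1 / 2) (of_int m) z"
    unfolding P Rt Z T by simp
  finally show ?thesis unfolding z_def .
qed

text \<open>
  The Legendre functions of degree \<open>n - 1/2\<close> and order \<open>\<plusminus> M\<close>, stripped of their Gamma factors and signs.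
\<close>

definition half_int_Q :: "nat \<Rightarrow> nat \<Rightarrow> real \<Rightarrow> real" where
  "half_int_Q n M x = sqrt pi * sqrt (x\<^sup>2 - 1) ^ M / (2 powr (real n + 1 / 2) * x powr (real (M + n) + 1 / 2))
     * (\<Sum>k. gauss_coeff ((real (M + n) + 3 / 2) / 2) ((real (M + n) + 1 / 2) / 2) n k * (1 / x\<^sup>2) ^ k)"

definition half_int_P :: "nat \<Rightarrow> nat \<Rightarrow> real \<Rightarrow> real" where
  "half_int_P n M x = (sqrt (x\<^sup>2 - 1) / 2) ^ M * x powr - (real (M + n) + 1 / 2)
     * (\<Sum>k. gauss_coeff ((real (M + n) + 3 / 2) / 2) ((real (M + n) + 1 / 2) / 2) M k * (1 - 1 / x\<^sup>2) ^ k)"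

lemma of_real_powr_half_int:
  assumes "x > (0::real)"
  shows "complex_of_real x powr (of_int m / 2) = of_real (sqrt x) powi m"
proof -
  have "complex_of_real x powr (of_int m / 2) = complex_of_real x powr (of_real (of_int m / 2))"
    by simp
  also have "\<dots> = of_real (x powr (of_int m / 2))"
    using assms by (subst powr_of_real) auto
  also have "x powr (of_int m / 2) = (x powr (1 / 2)) powr of_int m"
    by (simp add: powr_powr)
  also have "\<dots> = sqrt x powi m"
    using assms by (simp add: powr_half_sqrt powr_real_of_int')
  finally show ?thesis by simp
qed

lemma exp_int_pi_i: "exp (of_int m * of_real pi * \<i>) = (-1) powi m"
proof -
  have "exp (of_int m * of_real pi * \<i>) = cis (pi * of_int m)"
    by (simp add: cis_conv_exp mult_ac)
  also have "\<dots> = of_real (cos (pi * of_int m))"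
    by (simp add: complex_eq_iff sin_npi_int)
  also have "\<dots> = (-1) powi m"
    by (cases "even m") (simp_all add: cos_npi_int)
  finally show ?thesis .
qed

text \<open>For negative order Euler's transformation with exponent \<open>M\<close> contributes
  \<open>(1 - 1 / z\<^sup>2) ^ M = (h / x) ^ (2 * M)\<close>, which converts the prefactor
  \<open>(h / x) powi (- M)\<close> into \<open>(h / x) ^ M\<close>. Thus the sign of
  \<open>m\<close> affects only the Gamma factor.\<close>

lemma legendreQ_half_int:
  assumes x: "x > (1::real)"
  shows "legendreQ (of_nat n - 1 / 2) (of_int m) (of_real x)
    = (-1) powi m * Gamma (of_int (int n + m) + 1 / 2) * of_real (half_int_Q n (nat \<bar>m\<bar>) x)"
proof -
  define z where "z = complex_of_real x"
  define M where "M = nat \<bar>m\<bar>"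
  define a b where "a = (real (M + n) + 3 / 2) / 2" and "b = (real (M + n) + 1 / 2) / 2"
  define S where "S = (\<Sum>k. gauss_coeff a b n k * (1 / x\<^sup>2) ^ k)"
  define h where "h = sqrt (x\<^sup>2 - 1)"
  have x2: "x\<^sup>2 > 1" using x by (simp add: one_less_power)
  have h: "h > 0" using x2 by (simp add: h_def)
  have h2: "h\<^sup>2 = x\<^sup>2 - 1" using x2 by (simp add: h_def)
  have yd: "1 / z\<^sup>2 \<in> hyp_domain" unfolding z_def by (rule inverse_square_in_hyp_domain[OF x])
  have zR: "1 / z\<^sup>2 = of_real (1 / x\<^sup>2)" by (simp add: z_def)
  have hyp: "hyp2F1_reg (of_real a) (of_real b) (1 + of_nat n) (1 / z\<^sup>2) = of_real S"
    unfolding zR S_def using x2 by (intro hyp2F1_reg_of_real) (simp add: divide_less_eq)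
  have powh: "(z\<^sup>2 - 1) powr (of_int m / 2) = of_real (h powi m)"
  proof -
    have "z\<^sup>2 - 1 = of_real (x\<^sup>2 - 1)" by (simp add: z_def)
    thus ?thesis using x2 by (simp add: of_real_powr_half_int h_def del: of_real_diff)
  qed
  have pow2: "(2 :: complex) powr (of_nat n - 1 / 2 + 1) = of_real (2 powr (real n + 1 / 2))"
  proof -
    have "of_nat n - 1 / 2 + 1 = complex_of_real (real n + 1 / 2)" by simp
    hence "(2 :: complex) powr (of_nat n - 1 / 2 + 1) = complex_of_real 2 powr of_real (real n + 1 / 2)"
      by (simp only: of_real_numeral)
    thus ?thesis by (subst (asm) powr_of_real) auto
  qed
  have powz: "z powr (of_nat n - 1 / 2 + of_int m + 1) = of_real (x powr (real n + 1 / 2) * x powi m)"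
  proof -
    have "of_nat n - 1 / 2 + of_int m + 1 = complex_of_real ((real n + 1 / 2) + of_int m)" by simp
    hence "z powr (of_nat n - 1 / 2 + of_int m + 1) = of_real (x powr ((real n + 1 / 2) + of_int m))"
      using x by (simp only: z_def) (subst powr_of_real, auto)
    also have "x powr ((real n + 1 / 2) + of_int m) = x powr (real n + 1 / 2) * x powi m"
      using x by (simp add: powr_add powr_real_of_int')
    finally show ?thesis .
  qed
  have main: "(h / x) powi m * hyp2F1_reg ((of_nat n - 1 / 2 + of_int m) / 2 + 1) ((of_nat n - 1 / 2 + of_int m + 1) / 2)
      (of_nat n - 1 / 2 + 3 / 2) (1 / z\<^sup>2) = of_real ((h / x) ^ M * S)"
  proof (cases "m \<ge> 0")
    case True
    hence m: "m = int M" by (simp add: M_def)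
    have "(of_nat n - 1 / 2 + of_int m) / 2 + 1 = complex_of_real a" "(of_nat n - 1 / 2 + of_int m + 1) / 2 = complex_of_real b"
      "of_nat n - 1 / 2 + 3 / 2 = (1 + of_nat n :: complex)"
      by (simp_all add: a_def b_def m field_simps)
    thus ?thesis using hyp by (simp only: m) simp
  next
    case False
    hence m: "m = - int M" by (simp add: M_def)
    define a' b' :: complex where "a' = (of_nat n - 1 / 2 + of_int m) / 2 + 1" and "b' = (of_nat n - 1 / 2 + of_int m + 1) / 2"
    define c :: complex where "c = 1 + of_nat n"
    have ab: "a' \<in> \<real>" "b' \<in> \<real>" by (simp_all add: a'_def b'_def)
    have c: "c = a' + b' + of_nat M" by (simp add: a'_def b'_def c_def m field_simps)
    have c0: "c \<notin> \<int>\<^sub>\<le>\<^sub>0"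
    proof -
      have "c = of_nat (Suc n)" by (simp add: c_def)
      thus ?thesis by (simp only: of_nat_in_nonpos_Ints_iff)
    qed
    have "c - a' = of_real b" "c - b' = of_real a"
      by (simp_all add: a'_def b'_def c_def m a_def b_def field_simps)
    hence "hyp2F1_reg a' b' c (1 / z\<^sup>2) = (1 - 1 / z\<^sup>2) ^ M * hyp2F1_reg (of_real b) (of_real a) c (1 / z\<^sup>2)"
      using hyp2F1_reg_Euler_transformation[OF ab c0 c yd] by simp
    also have "hyp2F1_reg (of_real b) (of_real a) c (1 / z\<^sup>2) = of_real S"
      unfolding c_def using hyp by (simp only: hyp2F1_reg_commute)
    also have "1 - 1 / z\<^sup>2 = of_real ((h / x)\<^sup>2)"
      unfolding power_divide h2 using x by (simp add: z_def field_simps)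
    finally have E: "hyp2F1_reg a' b' c (1 / z\<^sup>2) = of_real (((h / x)\<^sup>2) ^ M * S)" by simp
    have "of_nat n - 1 / 2 + 3 / 2 = c" by (simp add: c_def)
    hence "(h / x) powi m * hyp2F1_reg ((of_nat n - 1 / 2 + of_int m) / 2 + 1) ((of_nat n - 1 / 2 + of_int m + 1) / 2)
      (of_nat n - 1 / 2 + 3 / 2) (1 / z\<^sup>2) = of_real ((h / x) powi m * ((h / x)\<^sup>2) ^ M * S)"
      unfolding a'_def[symmetric] b'_def[symmetric] using E by simp
    also have "(h / x) powi m * ((h / x)\<^sup>2) ^ M = (h / x) ^ M"
    proof -
      have "h / x \<noteq> 0" using h x by simp
      have "((h / x)\<^sup>2) ^ M = (h / x) ^ M * (h / x) ^ M"
        by (simp only: power2_eq_square power_mult_distrib)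
      thus ?thesis using \<open>h / x \<noteq> 0\<close> by (simp add: m power_int_minus field_simps)
    qed
    finally show ?thesis .
  qed
  have G: "of_nat n - 1 / 2 + of_int m + 1 = (of_int (int n + m) + 1 / 2 :: complex)" by simp
  define H where "H = hyp2F1_reg ((of_nat n - 1 / 2 + of_int m) / 2 + 1) ((of_nat n - 1 / 2 + of_int m + 1) / 2)
      (of_nat n - 1 / 2 + 3 / 2) (1 / z\<^sup>2)"
  have "legendreQ (of_nat n - 1 / 2) (of_int m) z = (-1) powi m * Gamma (of_int (int n + m) + 1 / 2)
      * of_real (sqrt pi) / of_real (2 powr (real n + 1 / 2) * x powr (real n + 1 / 2))
      * ((h / x) powi m * H)"
    unfolding legendreQ_def powh pow2 powz exp_int_pi_i H_def[symmetric] unfolding G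
    by (simp add: power_int_divide_distrib mult_ac)
  also have "\<dots> = (-1) powi m * Gamma (of_int (int n + m) + 1 / 2) * of_real (half_int_Q n M x)"
  proof -
    have "x powr (real (M + n) + 1 / 2) = x powr (real n + 1 / 2) * x ^ M"
      using x by (simp add: powr_add powr_realpow mult_ac)
    hence "half_int_Q n M x = sqrt pi / (2 powr (real n + 1 / 2) * x powr (real n + 1 / 2)) * ((h / x) ^ M * S)"
      unfolding half_int_Q_def h_def[symmetric] a_def[symmetric] b_def[symmetric] S_def[symmetric]
      by (simp add: power_divide)
    thus ?thesis unfolding main[folded H_def] by simp
  qed
  finally show ?thesis by (simp only: z_def M_def)
qed


text \<open>The last Gamma factor on the left is the one contributed by
  \<open>legendreQ_half_int\<close>. Grouped with it, both signs of \<open>m\<close> give the same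
  value: for \<open>m \<ge> 0\<close> the lower parameter \<open>1 - m\<close> is raised to
  \<open>1 + M\<close>, for \<open>m < 0\<close> Euler's transformation applies, and either way
  \<open>hyp2F1_reg A B (1 + of_nat M) w\<close> with prefactor \<open>(h / 2) ^ M\<close>
  remains.\<close>

lemma legendreP_half_int:
  assumes x: "x > (1::real)"
  shows "Gamma (of_int (int n - m) + 1 / 2) / Gamma (of_int (int n + m) + 1 / 2)
      * legendreP (of_nat n - 1 / 2) (of_int m) (of_real x) * Gamma (of_int (int n + m) + 1 / 2)
    = Gamma (of_nat (nat \<bar>m\<bar> + n) + 1 / 2) * of_real (half_int_P n (nat \<bar>m\<bar>) x)"
proof -
  define z where "z = complex_of_real x"
  define M where "M = nat \<bar>m\<bar>"
  define a b where "a = (real (M + n) + 3 / 2) / 2" and "b = (real (M + n) + 1 / 2) / 2"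
  define h where "h = sqrt (x\<^sup>2 - 1)"
  define w where "w = (1 - z) / 2"
  \<comment> \<open>Here \<open>A + B + 1 = 2 (1 + M)\<close>, the condition of the quadratic
    transformation.\<close>
  define A B :: complex where "A = of_nat n + 1 / 2 + of_nat M" and "B = 1 / 2 - of_nat n + of_nat M"
  define S where "S = (\<Sum>k. gauss_coeff a b M k * (1 - 1 / x\<^sup>2) ^ k)"
  have x2: "x\<^sup>2 > 1" using x by (simp add: one_less_power)
  have h: "h > 0" using x2 by (simp add: h_def)
  have h2: "h\<^sup>2 = (x - 1) * (x + 1)" using x2 by (simp add: h_def power2_eq_square algebra_simps)
  have wR: "w = of_real ((1 - x) / 2)" by (simp add: w_def z_def)
  have Rew: "Re w < 1 / 2" unfolding wR using x by simp
  have wd: "w \<in> hyp_domain" unfolding wR using x by (auto simp: hyp_domain_def)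
  have c0: "1 + of_nat M \<notin> (\<int>\<^sub>\<le>\<^sub>0 :: complex set)"
  proof -
    have "1 + of_nat M = (of_nat (Suc M) :: complex)" by simp
    thus ?thesis by (simp only: of_nat_in_nonpos_Ints_iff)
  qed
  have quad: "hyp2F1_reg A B (1 + of_nat M) w = of_real (x powr - (real (M + n) + 1 / 2) * S)"
  proof -
    have "A \<in> \<real>" "B \<in> \<real>" by (simp_all add: A_def B_def)
    moreover have "1 + of_nat M = (A + B + 1) / 2" by (simp add: A_def B_def field_simps)
    ultimately have "hyp2F1_reg A B (1 + of_nat M) w = (1 - 2 * w) powr (- A)
       * hyp2F1_reg (A / 2) ((A + 1) / 2) (1 + of_nat M) (1 - 1 / (1 - 2 * w)\<^sup>2)"
      using c0 Rew by (intro hyp2F1_reg_quadratic_transformation) auto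
    also have "1 - 2 * w = of_real x" by (simp add: w_def z_def field_simps)
    also have "A / 2 = of_real b" by (simp add: A_def b_def field_simps)
    also have "(A + 1) / 2 = of_real a" by (simp add: A_def a_def field_simps)
    also have "1 - 1 / (complex_of_real x)\<^sup>2 = of_real (1 - 1 / x\<^sup>2)" by simp
    also have "hyp2F1_reg (of_real b) (of_real a) (1 + of_nat M) (of_real (1 - 1 / x\<^sup>2)) = of_real S"
    proof -
      have "\<bar>1 - 1 / x\<^sup>2\<bar> < 1"
      proof -
        have "0 < 1 / x\<^sup>2" "1 / x\<^sup>2 < 1" using x2 x by (simp_all add: divide_less_eq)
        thus ?thesis by linarith
      qed
      thus ?thesis unfolding S_def hyp2F1_reg_commute[of "of_real b"] by (rule hyp2F1_reg_of_real)
    qed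
    also have "complex_of_real x powr (- A) = of_real (x powr - (real (M + n) + 1 / 2))"
    proof -
      have "- A = of_real (- (real (M + n) + 1 / 2))" by (simp add: A_def)
      thus ?thesis using x by (simp only:) (subst powr_of_real, auto)
    qed
    finally show ?thesis by simp
  qed
  have pre: "((z + 1) / (z - 1)) powr (of_int m / 2) = of_real (sqrt ((x + 1) / (x - 1)) powi m)"
  proof -
    have "(z + 1) / (z - 1) = of_real ((x + 1) / (x - 1))" by (simp add: z_def)
    moreover have "(x + 1) / (x - 1) > 0" using x by simp
    ultimately show ?thesis by (simp add: of_real_powr_half_int del: of_real_divide)
  qed
  \<comment> \<open>\<open>q1\<close> merges the prefactor with \<open>w ^ M\<close> for
    \<open>m \<ge> 0\<close>, and \<open>q2\<close> merges it with \<open>(1 - w) ^ M\<close> for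
    \<open>m < 0\<close>. Both leave powers of \<open>h / 2\<close>.\<close>
  have q1: "sqrt ((x + 1) / (x - 1)) * (x - 1) = h"
  proof -
    have "sqrt ((x + 1) / (x - 1)) * (x - 1) = sqrt ((x + 1) / (x - 1)) * sqrt ((x - 1)\<^sup>2)"
      using x by simp
    also have "\<dots> = sqrt ((x + 1) / (x - 1) * (x - 1)\<^sup>2)" by (simp only: real_sqrt_mult)
    also have "(x + 1) / (x - 1) * (x - 1)\<^sup>2 = x\<^sup>2 - 1"
      using x by (simp add: power2_eq_square field_simps)
    finally show ?thesis by (simp add: h_def)
  qed
  have q2: "(x + 1) / sqrt ((x + 1) / (x - 1)) = h"
  proof -
    have "sqrt ((x + 1) / (x - 1)) > 0" using x by simp
    moreover have "h * sqrt ((x + 1) / (x - 1)) = (sqrt ((x + 1) / (x - 1)))\<^sup>2 * (x - 1)"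
      unfolding q1[symmetric] by (simp only: power2_eq_square mult_ac)
    hence "h * sqrt ((x + 1) / (x - 1)) = x + 1" using x by simp
    ultimately show ?thesis by (metis less_irrefl nonzero_eq_divide_eq)
  qed
  have Ph: "of_real (half_int_P n M x) = of_real ((h / 2) ^ M) * hyp2F1_reg A B (1 + of_nat M) w"
    unfolding quad half_int_P_def h_def[symmetric] a_def[symmetric] b_def[symmetric] S_def[symmetric] by simp
  have P: "legendreP (of_nat n - 1 / 2) (of_int m) z = of_real (sqrt ((x + 1) / (x - 1)) powi m)
      * hyp2F1_reg (of_nat n + 1 / 2) (1 / 2 - of_nat n) (1 - of_int m) w"
  proof -
    have "of_nat n - 1 / 2 + 1 = (of_nat n + 1 / 2 :: complex)" "- (of_nat n - 1 / 2) = (1 / 2 - of_nat n :: complex)"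
      by simp_all
    thus ?thesis unfolding legendreP_def pre w_def by (simp only:)
  qed
  have G0: "Gamma (of_int (int n + m) + 1 / 2 :: complex) \<noteq> 0" by (rule Gamma_half_int_nonzero)
  show ?thesis
  proof (cases "m \<ge> 0")
    case True
    hence m: "m = int M" by (simp add: M_def)
    have "hyp2F1_reg (of_nat n + 1 / 2) (1 / 2 - of_nat n) (1 - of_int m) w
       = pochhammer (of_nat n + 1 / 2) M * pochhammer (1 / 2 - of_nat n) M * w ^ M * hyp2F1_reg A B (1 + of_nat M) w"
      using hyp2F1_reg_nonpos_int[OF _ wd, of "1 / 2 - of_nat n" "of_nat n + 1 / 2" M]
      by (simp add: m A_def B_def)
    moreover have "of_real (sqrt ((x + 1) / (x - 1)) powi m) * w ^ M = (-1) ^ M * of_real ((h / 2) ^ M)"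
    proof -
      have "sqrt ((x + 1) / (x - 1)) * ((1 - x) / 2) = (-1) * (h / 2)"
        unfolding q1[symmetric] by (simp add: field_simps)
      hence "sqrt ((x + 1) / (x - 1)) ^ M * ((1 - x) / 2) ^ M = (-1) ^ M * (h / 2) ^ M"
        by (simp only: power_mult_distrib[symmetric])
      hence "complex_of_real (sqrt ((x + 1) / (x - 1)) ^ M * ((1 - x) / 2) ^ M) = of_real ((-1) ^ M * (h / 2) ^ M)"
        by (simp only:)
      thus ?thesis by (simp add: m wR)
    qed
    ultimately have "legendreP (of_nat n - 1 / 2) (of_int m) z
        = pochhammer (of_nat n + 1 / 2) M * pochhammer (1 / 2 - of_nat n) M * (-1) ^ M * of_real (half_int_P n M x)"
      unfolding P Ph by (simp add: mult_ac)
    moreover have "Gamma (of_int (int n - m) + 1 / 2) * (pochhammer (of_nat n + 1 / 2) M * pochhammer (1 / 2 - of_nat n) M * (-1) ^ M)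
       = (Gamma (of_nat (M + n) + 1 / 2) :: complex)"
    proof -
      have e: "of_nat n + 1 / 2 = (of_int (int n) + 1 / 2 :: complex)" "1 / 2 - of_nat n = (of_int (- int n) + 1 / 2 :: complex)"
        by simp_all
      have p1: "pochhammer (of_nat n + 1 / 2) M = (Gamma (of_nat (M + n) + 1 / 2) / Gamma (of_int (int n) + 1 / 2) :: complex)"
        unfolding e using pochhammer_Gamma[OF half_int_notin_nonpos_Ints, of "int n" M] by (simp add: algebra_simps)
      have p2: "pochhammer (1 / 2 - of_nat n) M = (Gamma (of_int (- (int n - m)) + 1 / 2) / Gamma (of_int (- int n) + 1 / 2) :: complex)"
        unfolding e using pochhammer_Gamma[OF half_int_notin_nonpos_Ints, of "- int n" M] by (simp add: m algebra_simps)
      have r1: "Gamma (of_int (int n - m) + 1 / 2) * Gamma (of_int (- (int n - m)) + 1 / 2) = of_real pi * (-1 :: complex) powi (int n - m)"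
        by (rule Gamma_half_int_reflection)
      have r2: "Gamma (of_int (int n) + 1 / 2) * Gamma (of_int (- int n) + 1 / 2) = of_real pi * (-1 :: complex) powi int n"
        by (rule Gamma_half_int_reflection)
      \<comment> \<open>Reflection pairs the Gamma factors in numerator and denominator; the powers
        of -1 cancel because \<open>m = int M\<close>.\<close>
      have "Gamma (of_int (int n - m) + 1 / 2) * (pochhammer (of_nat n + 1 / 2) M * pochhammer (1 / 2 - of_nat n) M * (-1) ^ M)
         = Gamma (of_nat (M + n) + 1 / 2) * ((Gamma (of_int (int n - m) + 1 / 2) * Gamma (of_int (- (int n - m)) + 1 / 2)) * (-1) ^ M
             / (Gamma (of_int (int n) + 1 / 2) * Gamma (of_int (- int n) + 1 / 2 :: complex)))"
        unfolding p1 p2 by simp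
      also have "(of_real pi * (-1 :: complex) powi (int n - m)) * (-1) ^ M / (of_real pi * (-1) powi int n) = 1"
        by (cases "even n"; cases "even M") (simp_all add: m)
      hence "(Gamma (of_int (int n - m) + 1 / 2) * Gamma (of_int (- (int n - m)) + 1 / 2)) * (-1) ^ M
             / (Gamma (of_int (int n) + 1 / 2) * Gamma (of_int (- int n) + 1 / 2 :: complex)) = 1"
        unfolding r1 r2 .
      finally show ?thesis by simp
    qed
    ultimately show ?thesis using G0 unfolding z_def[symmetric] M_def[symmetric]
      by (simp add: mult_ac)
  next
    case False
    hence m: "m = - int M" by (simp add: M_def)
    have c: "1 + of_nat M = (of_nat n + 1 / 2) + (1 / 2 - of_nat n) + (of_nat M :: complex)" by simp
    have "hyp2F1_reg (of_nat n + 1 / 2) (1 / 2 - of_nat n) (1 + of_nat M) w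
       = (1 - w) ^ M * hyp2F1_reg (1 + of_nat M - (of_nat n + 1 / 2)) (1 + of_nat M - (1 / 2 - of_nat n)) (1 + of_nat M) w"
      by (rule hyp2F1_reg_Euler_transformation[OF _ _ c0 c wd]) simp_all
    also have "1 + of_nat M - (of_nat n + 1 / 2) = B" by (simp add: B_def)
    also have "1 + of_nat M - (1 / 2 - of_nat n) = A" by (simp add: A_def)
    also have "hyp2F1_reg B A = hyp2F1_reg A B" by (rule ext) (rule hyp2F1_reg_commute)
    finally have 1: "hyp2F1_reg (of_nat n + 1 / 2) (1 / 2 - of_nat n) (1 - of_int m) w
        = (1 - w) ^ M * hyp2F1_reg A B (1 + of_nat M) w" by (simp add: m)
    have "of_real (sqrt ((x + 1) / (x - 1)) powi m) * (1 - w) ^ M = of_real ((h / 2) ^ M)"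
    proof -
      have "1 - w = of_real ((x + 1) / 2)" by (simp add: wR field_simps)
      moreover have "sqrt ((x + 1) / (x - 1)) powi m * ((x + 1) / 2) ^ M = (((x + 1) / sqrt ((x + 1) / (x - 1))) / 2) ^ M"
      proof -
        have "q powi (- int M) * (y / 2) ^ M = ((y / q) / 2) ^ M" for q y :: real
          by (simp add: power_int_minus power_divide inverse_eq_divide)
        thus ?thesis unfolding m .
      qed
      ultimately show ?thesis unfolding q2 by (metis of_real_mult of_real_power)
    qed
    hence 2: "legendreP (of_nat n - 1 / 2) (of_int m) z = of_real (half_int_P n M x)"
      unfolding P Ph 1 by (simp add: mult.assoc[symmetric])
    have 3: "of_int (int n - m) = (of_nat (M + n) :: complex)" by (simp add: m)
    show ?thesis unfolding z_def[symmetric] M_def[symmetric] 2 3 using G0 by simp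
  qed
qed


text \<open>Reflection produces the signs \<open>(-1) powi (p + q)\<close> and
  \<open>(-1) powi (p - q)\<close>, which agree by parity. This is the invariance of the Gamma
  quotient under \<open>n \<mapsto> - n\<close>.\<close>

lemma Gamma_half_int_quotient_minus:
  "Gamma (of_int (- p - q) + 1 / 2) / Gamma (of_int (- p + q) + 1 / 2 :: complex)
     = Gamma (of_int (p - q) + 1 / 2) / Gamma (of_int (p + q) + 1 / 2)"
proof -
  have "Gamma (of_int (p + q) + 1 / 2) * Gamma (of_int (- (p + q)) + 1 / 2) = of_real pi * (-1 :: complex) powi (p + q)"
    by (rule Gamma_half_int_reflection)
  also have "(-1 :: complex) powi (p + q) = (-1) powi (p - q)"
    by (cases "even p"; cases "even q") simp_all
  also have "of_real pi * \<dots> = Gamma (of_int (p - q) + 1 / 2) * Gamma (of_int (- (p - q)) + 1 / 2)"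
    by (rule Gamma_half_int_reflection[symmetric])
  finally have "Gamma (of_int (p + q) + 1 / 2) * Gamma (of_int (- p - q) + 1 / 2)
      = Gamma (of_int (p - q) + 1 / 2) * Gamma (of_int (- p + q) + 1 / 2 :: complex)"
    by (simp add: algebra_simps)
  moreover have "u * v = w * x \<Longrightarrow> u \<noteq> 0 \<Longrightarrow> x \<noteq> 0 \<Longrightarrow> v / x = w / u" for u v w x :: complex
    by (simp add: field_simps)
  ultimately show ?thesis using Gamma_half_int_nonzero by blast
qed

lemma Gamma_of_nat_half: "Gamma (of_nat K + 1 / 2 :: complex) = of_real (Gamma (real K + 1 / 2))"
  by (simp flip: Gamma_complex_of_real)

text \<open>Replacing the degree \<open>\<nu>\<close> by \<open>- 1 - \<nu>\<close> interchanges the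
  two upper parameters.\<close>

lemma legendreP_minus_half_int:
  "legendreP (- of_nat N - 1 / 2) mu z = legendreP (of_nat N - 1 / 2) mu z"
proof -
  have "- of_nat N - 1 / 2 + 1 = - (of_nat N - 1 / 2 :: complex)" "- (- of_nat N - 1 / 2) = (of_nat N - 1 / 2 + 1 :: complex)"
    by simp_all
  thus ?thesis unfolding legendreP_def by (simp only: hyp2F1_reg_commute)
qed

text \<open>The sign \<open>(-1) powi m\<close> from \<open>Q\<close> cancels the explicit one, and
  the Gamma factors combine to a single value. The right-hand side is real and involves only
  \<open>\<bar>m\<bar>\<close> and \<open>\<bar>n\<bar>\<close>.\<close>

lemma legendreP_legendreQ_half_int:
  assumes x: "x > (1::real)" and y: "y > 1"
  shows "(-1) powi m * Gamma (of_int n - of_int m + 1 / 2) / Gamma (of_int n + of_int m + 1 / 2)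
      * legendreP (of_int n - 1 / 2) (of_int m) (of_real x) * legendreQ (of_int n - 1 / 2) (of_int m) (of_real y)
    = of_real (Gamma (real (nat \<bar>m\<bar> + nat \<bar>n\<bar>) + 1 / 2) * half_int_P (nat \<bar>n\<bar>) (nat \<bar>m\<bar>) x * half_int_Q (nat \<bar>n\<bar>) (nat \<bar>m\<bar>) y)"
proof -
  define N where "N = nat \<bar>n\<bar>"
  have "Gamma (of_int n - of_int m + 1 / 2) / Gamma (of_int n + of_int m + 1 / 2)
      = (Gamma (of_int (int N - m) + 1 / 2) / Gamma (of_int (int N + m) + 1 / 2) :: complex)
    \<and> legendreP (of_int n - 1 / 2) (of_int m) (of_real x) = legendreP (of_nat N - 1 / 2) (of_int m) (of_real x)
    \<and> legendreQ (of_int n - 1 / 2) (of_int m) (of_real y) = legendreQ (of_nat N - 1 / 2) (of_int m) (of_real y)"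
  proof (cases "n \<ge> 0")
    case True
    hence "n = int N" by (simp add: N_def)
    thus ?thesis by simp
  next
    case False
    hence n: "n = - int N" by (simp add: N_def)
    show ?thesis
      using Gamma_half_int_quotient_minus[of "int N" m] legendreQ_minus_half_int[OF y, of N m]
      by (simp add: n legendreP_minus_half_int)
  qed
  hence "(-1) powi m * Gamma (of_int n - of_int m + 1 / 2) / Gamma (of_int n + of_int m + 1 / 2)
      * legendreP (of_int n - 1 / 2) (of_int m) (of_real x) * legendreQ (of_int n - 1 / 2) (of_int m) (of_real y)
    = (-1) powi m * (Gamma (of_int (int N - m) + 1 / 2) / Gamma (of_int (int N + m) + 1 / 2))
      * legendreP (of_nat N - 1 / 2) (of_int m) (of_real x) * legendreQ (of_nat N - 1 / 2) (of_int m) (of_real y)"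
    by (simp only: times_divide_eq_right[symmetric])
  also have "\<dots> = ((-1) powi m * (-1) powi m) * (Gamma (of_int (int N - m) + 1 / 2) / Gamma (of_int (int N + m) + 1 / 2)
      * legendreP (of_nat N - 1 / 2) (of_int m) (of_real x) * Gamma (of_int (int N + m) + 1 / 2)) * of_real (half_int_Q N (nat \<bar>m\<bar>) y)"
    unfolding legendreQ_half_int[OF y] by (simp only: mult_ac)
  also have "(-1) powi m * (-1) powi m = (1 :: complex)" by (cases "even m") simp_all
  also have "Gamma (of_int (int N - m) + 1 / 2) / Gamma (of_int (int N + m) + 1 / 2)
      * legendreP (of_nat N - 1 / 2) (of_int m) (of_real x) * Gamma (of_int (int N + m) + 1 / 2)
      = Gamma (of_nat (nat \<bar>m\<bar> + N) + 1 / 2) * of_real (half_int_P N (nat \<bar>m\<bar>) x)"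
    by (rule legendreP_half_int[OF x])
  also have "Gamma (of_nat (nat \<bar>m\<bar> + N) + 1 / 2 :: complex) = of_real (Gamma (real (nat \<bar>m\<bar> + N) + 1 / 2))"
    by (rule Gamma_of_nat_half)
  finally show ?thesis by (simp add: N_def)
qed

lemma legendreQ_0_half_int:
  assumes x: "x > (1::real)"
  shows "legendreQ (of_int m - 1 / 2) 0 (of_real x)
    = of_real (Gamma (real (nat \<bar>m\<bar>) + 1 / 2) * half_int_Q (nat \<bar>m\<bar>) 0 x)"
proof -
  define M where "M = nat \<bar>m\<bar>"
  have "legendreQ (of_int m - 1 / 2) 0 (of_real x) = legendreQ (of_nat M - 1 / 2) 0 (of_real x)"
  proof (cases "m \<ge> 0")
    case True
    hence "m = int M" by (simp add: M_def)
    thus ?thesis by simp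
  next
    case False
    hence m: "m = - int M" by (simp add: M_def)
    show ?thesis using legendreQ_minus_half_int[OF x, of M 0] by (simp add: m)
  qed
  also have "\<dots> = Gamma (of_nat M + 1 / 2) * of_real (half_int_Q M 0 x)"
    using legendreQ_half_int[OF x, of M 0] by simp
  also have "Gamma (of_nat M + 1 / 2 :: complex) = of_real (Gamma (real M + 1 / 2))"
    by (rule Gamma_of_nat_half)
  finally show ?thesis by (simp add: M_def)
qed

section \<open>Return to the variables of the theorem and comparison of constants\<close>

lemma toroidal_integral_cosh:
  fixes M N :: nat and s t :: real
  assumes st: "0 < s" "s \<le> t"
  shows "((\<lambda>\<psi>. Gamma (real M + 1 / 2) * half_int_Q M 0 ((cosh s * cosh t - cos \<psi>) / (sinh s * sinh t)) * cos (real N * \<psi>))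
      has_integral (pi * sqrt (sinh s * sinh t) * (Gamma (real (M + N) + 1 / 2) * half_int_P N M (cosh s) * half_int_Q N M (cosh t)))) {0..pi}"
proof -
  define A where "A = sinh s * sinh t / (cosh s * cosh t)"
  define B where "B = 1 / (cosh s * cosh t)"
  define a b where "a = (real (M + N) + 3 / 2) / 2" and "b = (real (M + N) + 1 / 2) / 2"
  \<comment> \<open>This is \<open>(tanh s)\<^sup>2\<close> in the form in which it occurs in
    \<open>half_int_P\<close>; likewise \<open>Y\<close> is the argument in
    \<open>half_int_Q\<close>. The ordering \<open>s \<le> t\<close> amounts to
    \<open>X + Y \<le> 1\<close>.\<close>
  define X where "X = 1 - 1 / (cosh s)\<^sup>2"
  define Y where "Y = 1 / (cosh t)\<^sup>2"
  define f where "f = (\<Sum>k. gauss_coeff a b M k * X ^ k)"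
  define g where "g = (\<Sum>k. gauss_coeff a b N k * Y ^ k)"
  have t: "t > 0" using st by simp
  have c: "cosh s > 1" "cosh t > 1" using st t cosh_real_strict_mono[of 0 s] cosh_real_strict_mono[of 0 t] by auto
  have c0: "cosh s > 0" "cosh t > 0" using c by auto
  have sh: "sinh s > 0" "sinh t > 0" using st t by auto
  have cc: "(cosh s)\<^sup>2 > 1" "(cosh t)\<^sup>2 > 1" using c by (auto simp: one_less_power)
  have XY: "0 < X" "0 < Y" "X + Y \<le> 1"
  proof -
    show "0 < X" "0 < Y" using cc c0 by (auto simp: X_def Y_def divide_less_eq)
    have "cosh s \<le> cosh t" using st cosh_real_nonneg_le_iff[of s t] by simp
    hence "(cosh s)\<^sup>2 \<le> (cosh t)\<^sup>2" using c0 by (intro power_mono) auto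
    hence "1 / (cosh t)\<^sup>2 \<le> 1 / (cosh s)\<^sup>2" using c0 by (intro divide_left_mono) auto
    thus "X + Y \<le> 1" by (simp add: X_def Y_def)
  qed
  have sX: "1 - 1 / (cosh r)\<^sup>2 = (sinh r / cosh r)\<^sup>2" if "cosh r > 0" for r :: real
    using that by (simp add: power_divide sinh_square_eq diff_divide_distrib)
  have AA: "A = sqrt (X * (1 - Y))"
  proof -
    have "X * (1 - Y) = A\<^sup>2"
      unfolding X_def Y_def A_def by (simp only: sX[OF c0(1)] sX[OF c0(2)]) (simp add: power_divide power_mult_distrib)
    moreover have "A > 0" using sh c0 by (simp add: A_def)
    ultimately show ?thesis by simp
  qed
  have BB: "B = sqrt (Y * (1 - X))"
  proof -
    have "Y * (1 - X) = B\<^sup>2" by (simp add: X_def Y_def B_def power_divide power_mult_distrib mult.commute)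
    moreover have "B > 0" using c0 by (simp add: B_def)
    ultimately show ?thesis by simp
  qed
  have A0: "A > 0" and B0: "B > 0" using sh c0 by (simp_all add: A_def B_def)
  define C where "C = Gamma (real M + 1 / 2) * (sqrt pi / 2 powr (real M + 1 / 2) * A powr (real M + 1 / 2))"
  define F where "F \<psi> = (1 - B * cos \<psi>) powr - (real M + 1 / 2) *
      (\<Sum>k. gauss_coeff ((real M + 3 / 2) / 2) ((real M + 1 / 2) / 2) M k * ((A / (1 - B * cos \<psi>))\<^sup>2) ^ k)" for \<psi>
  have Q: "Gamma (real M + 1 / 2) * half_int_Q M 0 ((cosh s * cosh t - cos \<psi>) / (sinh s * sinh t)) = C * F \<psi>" for \<psi>
  proof -
    define v where "v = 1 - B * cos \<psi>"
    have "B * cos \<psi> < 1"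
    proof -
      have "B < 1" using c by (simp add: B_def divide_less_eq less_1_mult)
      have "B * cos \<psi> \<le> B * 1" using B0 by (intro mult_left_mono) auto
      thus ?thesis using \<open>B < 1\<close> by simp
    qed
    hence v: "v > 0" by (simp add: v_def)
    have chi: "(cosh s * cosh t - cos \<psi>) / (sinh s * sinh t) = v / A"
      using c0 sh by (simp add: v_def A_def B_def field_simps)
    have E: "1 / (v / A) powr e = A powr e * v powr - e" for e
      using v A0 by (simp add: powr_divide powr_minus_divide)
    have E2: "1 / (v / A)\<^sup>2 = (A / v)\<^sup>2" by (simp add: power_divide)
    have "half_int_Q M 0 (v / A) = sqrt pi / 2 powr (real M + 1 / 2) * (1 / (v / A) powr (real M + 1 / 2))
        * (\<Sum>k. gauss_coeff ((real M + 3 / 2) / 2) ((real M + 1 / 2) / 2) M k * (1 / (v / A)\<^sup>2) ^ k)"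
      by (simp add: half_int_Q_def)
    thus ?thesis
      unfolding chi E E2 C_def F_def v_def[symmetric] by (simp only: mult_ac)
  qed
  have "((\<lambda>\<psi>. F \<psi> * cos (real N * \<psi>)) has_integral
     (pi * (B / 2) ^ N * pochhammer (real M + 1 / 2) N * (f * g))) {0..pi}"
    using toroidal_integral[OF XY, of M N] unfolding AA[symmetric] BB[symmetric]
    by (simp only: F_def f_def g_def a_def b_def)
  hence "((\<lambda>\<psi>. C * (F \<psi> * cos (real N * \<psi>))) has_integral
     C * (pi * (B / 2) ^ N * pochhammer (real M + 1 / 2) N * (f * g))) {0..pi}"
    by (rule has_integral_mult_right)
  moreover have "C * (pi * (B / 2) ^ N * pochhammer (real M + 1 / 2) N * (f * g))
     = pi * sqrt (sinh s * sinh t) * (Gamma (real (M + N) + 1 / 2) * half_int_P N M (cosh s) * half_int_Q N M (cosh t))"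
  proof -
    have G: "Gamma (real M + 1 / 2) * pochhammer (real M + 1 / 2) N = Gamma (real (M + N) + 1 / 2)"
    proof -
      have pos: "real M + 1 / 2 > 0" by simp
      hence "pochhammer (real M + 1 / 2) N = Gamma (real M + 1 / 2 + real N) / Gamma (real M + 1 / 2)"
        by (intro pochhammer_Gamma) (auto elim!: nonpos_Ints_cases)
      moreover have "Gamma (real M + 1 / 2) \<noteq> 0" using Gamma_real_pos[OF pos] by linarith
      ultimately show ?thesis by (simp add: add_ac)
    qed
    have sq: "sqrt ((cosh r)\<^sup>2 - 1) = sinh r" if "r > 0" for r :: real
      using that by (simp add: sinh_square_eq[symmetric])
    have pw: "x powr (real M + 1 / 2) = x ^ M * sqrt x" if "x > 0" for x :: real
      using that by (simp add: powr_add powr_realpow powr_half_sqrt)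
    have pwN: "x powr (real (M + N) + 1 / 2) = x ^ M * x ^ N * sqrt x" if "x > 0" for x :: real
      using that by (simp add: powr_add powr_realpow powr_half_sqrt power_add)
    have pw2: "x powr (real N + 1 / 2) = x ^ N * sqrt x" if "x > 0" for x :: real
      using that by (simp add: powr_add powr_realpow powr_half_sqrt)
    \<comment> \<open>The integral yields \<open>u\<close> to the power \<open>M + 1/2\<close> over
      \<open>w\<close> to the power \<open>M + N + 1/2\<close>. \<open>P\<close> and
      \<open>Q\<close> together account for all of this except \<open>sqrt u\<close>, the root in
      front of the right-hand side.\<close>
    define u where "u = sinh s * sinh t"
    define w where "w = cosh s * cosh t"
    have uw: "u > 0" "w > 0" using sh c0 by (simp_all add: u_def w_def)
    have P: "half_int_P N M (cosh s) = sinh s ^ M / 2 ^ M / (cosh s ^ M * cosh s ^ N * sqrt (cosh s)) * f"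
      unfolding half_int_P_def sq[OF st(1)] powr_minus_divide pwN[OF c0(1)] a_def[symmetric] b_def[symmetric]
        X_def[symmetric] f_def[symmetric] by (simp add: power_divide)
    have Qh: "half_int_Q N M (cosh t) = sqrt pi * sinh t ^ M / (2 ^ N * sqrt 2 * (cosh t ^ M * cosh t ^ N * sqrt (cosh t))) * g"
      unfolding half_int_Q_def sq[OF t] pwN[OF c0(2)] a_def[symmetric] b_def[symmetric]
        Y_def[symmetric] g_def[symmetric] by (simp add: pw2)
    have PQ: "half_int_P N M (cosh s) * half_int_Q N M (cosh t)
       = sqrt pi * u ^ M / (2 ^ M * 2 ^ N * sqrt 2 * (w ^ M * w ^ N * sqrt w)) * (f * g)"
      unfolding P Qh u_def w_def by (simp add: power_mult_distrib real_sqrt_mult mult_ac)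
    have CC: "C = Gamma (real M + 1 / 2) * (sqrt pi / (2 ^ M * sqrt 2) * (u ^ M * sqrt u / (w ^ M * sqrt w)))"
    proof -
      have "A = u / w" by (simp add: A_def u_def w_def)
      hence "A powr (real M + 1 / 2) = u ^ M * sqrt u / (w ^ M * sqrt w)"
        using A0 by (simp only: pw) (simp add: power_divide real_sqrt_divide)
      thus ?thesis unfolding C_def by (simp add: pw)
    qed
    have BN: "(B / 2) ^ N = 1 / (w ^ N * 2 ^ N)"
      by (simp add: B_def w_def power_divide)
    have R: "pi * sqrt u * (Gamma (real (M + N) + 1 / 2) * half_int_P N M (cosh s) * half_int_Q N M (cosh t))
       = pi * sqrt u * (Gamma (real M + 1 / 2) * pochhammer (real M + 1 / 2) N) * (half_int_P N M (cosh s) * half_int_Q N M (cosh t))"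
      unfolding G by (simp only: mult_ac)
    show ?thesis
      unfolding u_def[symmetric] R PQ CC BN by (simp add: mult_ac)
  qed
  ultimately show ?thesis unfolding Q by (simp only: mult.assoc)
qed

theorem theorem3p7:
  fixes m n :: int and \<sigma> \<sigma>' :: real
  assumes "0 < \<sigma>" and "0 < \<sigma>'"
  shows "((\<lambda>\<psi>::real. legendreQ (of_int m - 1/2) 0
              (of_real (cosh \<sigma> / sinh \<sigma> * (cosh \<sigma>' / sinh \<sigma>')
                        - 1 / sinh \<sigma> * (1 / sinh \<sigma>') * cos \<psi>))
            * of_real (cos (of_int n * \<psi>)))
         has_integral
           (of_real pi * (-1) powi m * of_real (sqrt (sinh \<sigma> * sinh \<sigma>'))
            * Gamma (of_int n - of_int m + 1/2) / Gamma (of_int n + of_int m + 1/2)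
            * legendreP (of_int n - 1/2) (of_int m) (of_real (cosh (min \<sigma> \<sigma>')))
            * legendreQ (of_int n - 1/2) (of_int m) (of_real (cosh (max \<sigma> \<sigma>')))))
         {0..pi}"
proof -
  define M N where "M = nat \<bar>m\<bar>" and "N = nat \<bar>n\<bar>"
  define s t where "s = min \<sigma> \<sigma>'" and "t = max \<sigma> \<sigma>'"
  have st: "0 < s" "s \<le> t" using assms by (auto simp: s_def t_def)
  have t: "t > 0" using st by simp
  have sw: "cosh \<sigma> * cosh \<sigma>' = cosh s * cosh t" "sinh \<sigma> * sinh \<sigma>' = sinh s * sinh t"
    by (auto simp: s_def t_def min_def max_def mult.commute)
  have sh: "sinh s > 0" "sinh t > 0" using st t by auto
  define X where "X \<psi> = (cosh s * cosh t - cos \<psi>) / (sinh s * sinh t)" for \<psi>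
  have chi: "cosh \<sigma> / sinh \<sigma> * (cosh \<sigma>' / sinh \<sigma>') - 1 / sinh \<sigma> * (1 / sinh \<sigma>') * cos \<psi> = X \<psi>" for \<psi>
    unfolding X_def sw[symmetric] by (simp add: diff_divide_distrib)
  \<comment> \<open>\<open>\<chi> > 1\<close> follows from
    \<open>cos \<psi> < 1 \<le> cosh (s - t)\<close>. If \<open>\<sigma> = \<sigma>'\<close>, then
    \<open>\<chi> = 1\<close> at \<open>\<psi> = 0\<close>, on the cut of \<open>Q\<close>, so the
    integrands are compared on the open interval only.\<close>
  have chi1: "X \<psi> > 1" if "\<psi> \<in> {0<..<pi}" for \<psi>
  proof -
    have "cos \<psi> < cos 0" using that by (intro cos_monotone_0_pi) auto
    hence "cos \<psi> < 1" by simp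
    also have "1 \<le> cosh (s - t)" by (rule cosh_real_ge_1)
    finally have "sinh s * sinh t < cosh s * cosh t - cos \<psi>" by (simp add: cosh_diff)
    thus ?thesis using sh by (simp add: X_def less_divide_eq)
  qed
  have cn: "cos (of_int n * \<psi>) = cos (real N * \<psi>)" for \<psi> :: real
  proof (cases "n \<ge> 0")
    case False
    hence "of_int n = - real N" by (simp add: N_def)
    thus ?thesis by simp
  qed (simp add: N_def)
  have "((\<lambda>\<psi>. complex_of_real (Gamma (real M + 1 / 2) * half_int_Q M 0 (X \<psi>) * cos (real N * \<psi>))) has_integral
      of_real (pi * sqrt (sinh s * sinh t) * (Gamma (real (M + N) + 1 / 2) * half_int_P N M (cosh s) * half_int_Q N M (cosh t)))) {0..pi}"
    unfolding X_def by (intro has_integral_of_real toroidal_integral_cosh st)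
  hence I: "((\<lambda>\<psi>. complex_of_real (Gamma (real M + 1 / 2) * half_int_Q M 0 (X \<psi>) * cos (real N * \<psi>))) has_integral
      of_real (pi * sqrt (sinh s * sinh t) * (Gamma (real (M + N) + 1 / 2) * half_int_P N M (cosh s) * half_int_Q N M (cosh t)))) {0<..<pi}"
    by (simp only: has_integral_Icc_iff_Ioo)
  have "((\<lambda>\<psi>. legendreQ (of_int m - 1 / 2) 0 (of_real (X \<psi>)) * of_real (cos (of_int n * \<psi>))) has_integral
      of_real (pi * sqrt (sinh s * sinh t) * (Gamma (real (M + N) + 1 / 2) * half_int_P N M (cosh s) * half_int_Q N M (cosh t)))) {0<..<pi}"
  proof (rule has_integral_eq[OF _ I])
    fix \<psi> assume "\<psi> \<in> {0<..<pi}"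
    from legendreQ_0_half_int[OF chi1[OF this], of m]
    show "complex_of_real (Gamma (real M + 1 / 2) * half_int_Q M 0 (X \<psi>) * cos (real N * \<psi>))
       = legendreQ (of_int m - 1 / 2) 0 (of_real (X \<psi>)) * of_real (cos (of_int n * \<psi>))"
      by (simp only: cn M_def of_real_mult)
  qed
  moreover have "of_real (pi * sqrt (sinh s * sinh t) * (Gamma (real (M + N) + 1 / 2) * half_int_P N M (cosh s) * half_int_Q N M (cosh t)))
     = of_real pi * (-1) powi m * of_real (sqrt (sinh \<sigma> * sinh \<sigma>'))
            * Gamma (of_int n - of_int m + 1/2) / Gamma (of_int n + of_int m + 1/2)
            * legendreP (of_int n - 1/2) (of_int m) (of_real (cosh s))
            * legendreQ (of_int n - 1/2) (of_int m) (of_real (cosh t))"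
  proof -
    have c: "cosh s > 1" "cosh t > 1" using st t cosh_real_strict_mono[of 0 s] cosh_real_strict_mono[of 0 t] by auto
    have "of_real pi * (-1) powi m * of_real (sqrt (sinh \<sigma> * sinh \<sigma>'))
            * Gamma (of_int n - of_int m + 1/2) / Gamma (of_int n + of_int m + 1/2)
            * legendreP (of_int n - 1/2) (of_int m) (of_real (cosh s))
            * legendreQ (of_int n - 1/2) (of_int m) (of_real (cosh t))
        = of_real pi * of_real (sqrt (sinh s * sinh t)) * ((-1) powi m
            * Gamma (of_int n - of_int m + 1/2) / Gamma (of_int n + of_int m + 1/2)
            * legendreP (of_int n - 1/2) (of_int m) (of_real (cosh s))
            * legendreQ (of_int n - 1/2) (of_int m) (of_real (cosh t)))"
    proof -
      have "p * q * r * g / h * P * Q = p * r * (q * g / h * P * Q)" for p q r g h P Q :: complex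
        by simp
      thus ?thesis unfolding sw by blast
    qed
    also have "\<dots> = of_real pi * of_real (sqrt (sinh s * sinh t))
        * of_real (Gamma (real (M + N) + 1 / 2) * half_int_P N M (cosh s) * half_int_Q N M (cosh t))"
      unfolding legendreP_legendreQ_half_int[OF c] M_def N_def ..
    finally show ?thesis by simp
  qed
  ultimately show ?thesis
    unfolding chi s_def[symmetric] t_def[symmetric] by (simp only: has_integral_Icc_iff_Ioo)
qed

end
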